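(* Let $X$ be a complete metric space and $p\ge1$. Then $P_p(X)$ is the free complete extended metric Wasserstein algebra of order $p$ over $X$, with universal arrow the Dirac map $\delta:X\to P_p(X)$. That is, for every extended metric Wasserstein algebra $B$ of order $p$ whose underlying extended metric space is complete, and every nonexpansive map $f:X\to B$, there is a unique nonexpansive affine map $\overline{f}:P_p(X)\to B$ with $\overline{f}\circ\delta=f$.
   Context: An extended metric space is a set with a function $d:X^2\to[0,\infty]$ satisfying the metric axioms, where $x+\infty=\infty+x=\infty$ and $x\le\infty$; Cauchy sequences and completeness are defined as usual. Nonexpansive maps satisfy $d(f(x),f(y))\le d(x,y)$. All measures are Borel. $P_p(X)$ is the set of Radon probability measures $\mu$ on $X$ (every Borel $B$ satisfies $\mu(B)=\sup\{\mu(K)\mid K\subseteq B\text{ compact}\}$) with finite moment of order $p$ ($\int d(x_0,-)^p\,\mathrm{d}\mu<\infty$ for some, equivalently all, $x_0$), with metric $\mathrm{W}_p(\mu,\nu)=\left(\inf_\gamma\int d_X^p\,\mathrm{d}\gamma\right)^{1/p}$ (infimum over couplings with marginals $\mu,\nu$) and operations $(\mu+_r\nu)(B)=r\mu(B)+(1-r)\nu(B)$. A barycentric algebra is a set with operations $+_r$ ($r\in[0,1]$) satisfying $x+_1y=x$, $x+_rx=x$, $x+_ry=y+_{1-r}x$, and $(x+_py)+_rz=x+_{pr}(y+_{\frac{r-pr}{1-pr}}z)$ for $r<1,p<1$; affine maps preserve all $+_r$. An extended metric Wasserstein algebra of order $p$ is an extended metric space with nonexpansive operations $+_r:X\times X\to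 X$ (max metric on the product) forming a barycentric algebra and satisfying $d(x+_ry,x'+_ry')^p\le r\,d(x,x')^p+(1-r)\,d(y,y')^p$ for all $x,x',y,y'$. *)

theory Defs
  imports "HOL-Probability.Giry_Monad"
begin

section \<open>Extended metric Wasserstein algebras\<close>

text \<open>Powers of extended nonnegative reals, for a positive real exponent only.\<close>

definition ennpowr :: "ennreal \<Rightarrow> real \<Rightarrow> ennreal" where
  "ennpowr x p = (if x = \<infinity> then \<infinity> else ennreal (enn2real x powr p))"

locale extended_metric_space =
  fixes A :: "'a set" and d :: "'a \<Rightarrow> 'a \<Rightarrow> ennreal"
  assumes eq_0_iff: "x \<in> A \<Longrightarrow> y \<in> A \<Longrightarrow> d x y = 0 \<longleftrightarrow> x = y"
    and sym: "x \<in> A \<Longrightarrow> y \<in> A \<Longrightarrow> d x y = d y x"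
    and triangle: "x \<in> A \<Longrightarrow> y \<in> A \<Longrightarrow> z \<in> A \<Longrightarrow> d x z \<le> d x y + d y z"

locale complete_extended_metric_space = extended_metric_space +
  assumes Cauchy_convergent:
    "range (s :: nat \<Rightarrow> 'a) \<subseteq> A \<Longrightarrow> (\<And>e. e > 0 \<Longrightarrow> \<exists>N. \<forall>m\<ge>N. \<forall>n\<ge>N. d (s m) (s n) < e) \<Longrightarrow>
      \<exists>l\<in>A. \<forall>e>0. \<exists>N. \<forall>n\<ge>N. d (s n) l < e"

definition nonexpansive_on ::
  "'a set \<Rightarrow> ('a \<Rightarrow> 'a \<Rightarrow> ennreal) \<Rightarrow> 'b set \<Rightarrow> ('b \<Rightarrow> 'b \<Rightarrow> ennreal) \<Rightarrow> ('a \<Rightarrow> 'b) \<Rightarrow> bool" where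
  "nonexpansive_on A d B d' f \<longleftrightarrow>
    f \<in> A \<rightarrow> B \<and> (\<forall>x\<in>A. \<forall>y\<in>A. d' (f x) (f y) \<le> d x y)"

text \<open>\<open>cc r x y\<close> stands for $x +_r y$, with weight \<open>r\<close> on the first argument; its values for
  \<open>r\<close> outside the unit interval are irrelevant.\<close>

locale barycentric_algebra =
  fixes A :: "'a set" and cc :: "real \<Rightarrow> 'a \<Rightarrow> 'a \<Rightarrow> 'a"
  assumes closed: "r \<in> {0..1} \<Longrightarrow> x \<in> A \<Longrightarrow> y \<in> A \<Longrightarrow> cc r x y \<in> A"
    and one: "x \<in> A \<Longrightarrow> y \<in> A \<Longrightarrow> cc 1 x y = x"
    and idem: "r \<in> {0..1} \<Longrightarrow> x \<in> A \<Longrightarrow> cc r x x = x"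
    and skew_comm: "r \<in> {0..1} \<Longrightarrow> x \<in> A \<Longrightarrow> y \<in> A \<Longrightarrow> cc r x y = cc (1 - r) y x"
    and skew_assoc: "s \<in> {0..<1} \<Longrightarrow> r \<in> {0..<1} \<Longrightarrow> x \<in> A \<Longrightarrow> y \<in> A \<Longrightarrow> z \<in> A \<Longrightarrow>
      cc r (cc s x y) z = cc (s * r) x (cc ((r - s * r) / (1 - s * r)) y z)"

definition affine_on ::
  "'a set \<Rightarrow> (real \<Rightarrow> 'a \<Rightarrow> 'a \<Rightarrow> 'a) \<Rightarrow> (real \<Rightarrow> 'b \<Rightarrow> 'b \<Rightarrow> 'b) \<Rightarrow> ('a \<Rightarrow> 'b) \<Rightarrow> bool" where
  "affine_on A cc cc' f \<longleftrightarrow>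
    (\<forall>r\<in>{0..1}. \<forall>x\<in>A. \<forall>y\<in>A. f (cc r x y) = cc' r (f x) (f y))"

locale extended_metric_wasserstein_algebra =
  extended_metric_space A d + barycentric_algebra A cc
  for p :: real and A :: "'a set" and d :: "'a \<Rightarrow> 'a \<Rightarrow> ennreal"
    and cc :: "real \<Rightarrow> 'a \<Rightarrow> 'a \<Rightarrow> 'a" +
  assumes nonexpansive:
    "r \<in> {0..1} \<Longrightarrow> x \<in> A \<Longrightarrow> x' \<in> A \<Longrightarrow> y \<in> A \<Longrightarrow> y' \<in> A \<Longrightarrow>
      d (cc r x y) (cc r x' y') \<le> max (d x x') (d y y')"
    and wasserstein:
    "r \<in> {0..1} \<Longrightarrow> x \<in> A \<Longrightarrow> x' \<in> A \<Longrightarrow> y \<in> A \<Longrightarrow> y' \<in> A \<Longrightarrow>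
      ennpowr (d (cc r x y) (cc r x' y')) p
        \<le> ennreal r * ennpowr (d x x') p + ennreal (1 - r) * ennpowr (d y y') p"

locale complete_extended_metric_wasserstein_algebra =
  extended_metric_wasserstein_algebra p A d cc + complete_extended_metric_space A d
  for p :: real and A :: "'a set" and d :: "'a \<Rightarrow> 'a \<Rightarrow> ennreal"
    and cc :: "real \<Rightarrow> 'a \<Rightarrow> 'a \<Rightarrow> 'a"


section \<open>Wasserstein spaces\<close>

text \<open>A metric space is given as a subset \<open>X\<close> of a type of class \<^class>\<open>metric_space\<close>, so that the
  empty space is covered; \<open>borel_on X\<close> is then the Borel sigma-algebra of \<open>X\<close>. On the product of
  two copies of \<open>X\<close> the sigma-algebra \<open>borel_on (X \<times> X)\<close> is that of the product topology, which for
  nonseparable \<open>X\<close> may be strictly finer than \<open>borel_on X \<Otimes>\<^sub>M borel_on X\<close>.\<close>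

abbreviation borel_on :: "'a::topological_space set \<Rightarrow> 'a measure" where
  "borel_on X \<equiv> restrict_space borel X"

definition radon_measure :: "'a::topological_space measure \<Rightarrow> bool" where
  "radon_measure M \<longleftrightarrow>
    (\<forall>B\<in>sets M. emeasure M B = (SUP K\<in>{K. compact K \<and> K \<subseteq> B}. emeasure M K))"

definition Pp :: "real \<Rightarrow> 'a::metric_space set \<Rightarrow> 'a measure set" where
  "Pp p X = {M. sets M = sets (borel_on X) \<and> prob_space M \<and> radon_measure M \<and>
    (\<exists>x\<^sub>0\<in>X. (\<integral>\<^sup>+ x. ennreal (dist x\<^sub>0 x powr p) \<partial>M) < \<infinity>)}"

definition couplings ::
  "'a::metric_space set \<Rightarrow> 'a measure \<Rightarrow> 'a measure \<Rightarrow> ('a \<times> 'a) measure set" where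
  "couplings X M N = {G. sets G = sets (borel_on (X \<times> X)) \<and> prob_space G \<and>
    distr G (borel_on X) fst = M \<and> distr G (borel_on X) snd = N}"

definition wasserstein_dist ::
  "real \<Rightarrow> 'a::metric_space set \<Rightarrow> 'a measure \<Rightarrow> 'a measure \<Rightarrow> ennreal" where
  "wasserstein_dist p X M N =
    ennpowr (INF G\<in>couplings X M N. \<integral>\<^sup>+ (x, y). ennreal (dist x y powr p) \<partial>G) (1 / p)"

definition mixture :: "real \<Rightarrow> 'a measure \<Rightarrow> 'a measure \<Rightarrow> 'a measure" where
  "mixture r M N = measure_of (space M) (sets M)
    (\<lambda>B. ennreal r * emeasure M B + ennreal (1 - r) * emeasure N B)"

lemma sets_mixture [simp]: "sets (mixture r M N) = sets M"
  by (simp add: mixture_def)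

lemma emeasure_mixture:
  assumes "sets N = sets M" "B \<in> sets M"
  shows "emeasure (mixture r M N) B = ennreal r * emeasure M B + ennreal (1 - r) * emeasure N B"
proof (rule emeasure_measure_of[OF mixture_def])
  show "countably_additive (sets (mixture r M N))
      (\<lambda>B. ennreal r * emeasure M B + ennreal (1 - r) * emeasure N B)"
  proof (rule countably_additiveI)
    fix F :: "nat \<Rightarrow> _" assume "range F \<subseteq> sets (mixture r M N)" "disjoint_family F"
    then show "(\<Sum>i. ennreal r * emeasure M (F i) + ennreal (1 - r) * emeasure N (F i)) =
        ennreal r * emeasure M (\<Union>i. F i) + ennreal (1 - r) * emeasure N (\<Union>i. F i)"
      using assms(1) by (simp add: suminf_add[symmetric] suminf_emeasure)
  qed
qed (use assms in \<open>auto simp: positive_def dest: sets.sets_into_space\<close>)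

end

theory Submission
  imports Defs
begin

text \<open>Simple (finitely supported) measures are dense for the Wasserstein distance, and everything is
  reduced to them. The triangle inequality needs no disintegration: two couplings are glued along a
  finite partition of the middle space into small pieces, which costs an arbitrarily small error, and
  the error is estimated by Minkowski's inequality. For completeness, a fast Cauchy sequence is
  approximated by simple measures; near-optimal couplings of consecutive ones are finite matrices, so they
  can be realised by a sequence of simple functions on the unit interval, which converges in the
  \<open>L\<^sup>p\<close> sense; the law of the limit is Radon by Lusin's argument. For the universal property,
  the image of a simple measure is forced to be a finite convex combination, and the Wasserstein
  inequality of the target algebra compares the combinations obtained from two simple approximations
  \<open>S\<close>, \<open>T\<close> of the two coordinates of a coupling \<open>\<gamma>\<close>: their distance is at most the
  \<open>L\<^sup>p(\<gamma>)\<close>-norm of the distance between \<open>S\<close> and \<open>T\<close>. Taking limits gives existence,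
  nonexpansiveness and affinity at the same time, and density gives uniqueness.\<close>

section \<open>Powers of extended nonnegative reals and the Minkowski inequality\<close>

text \<open>The obstacle behind most detours is that \<open>X\<close> may be nonseparable: a pair of
  measurable maps into \<open>X\<close> need not be measurable into
  \<open>borel_on (X \<times> X)\<close>, where couplings live. Radon measures repair this, since
  each of them is concentrated on the closure of a countable set; after a change on a null set the
  maps in question take values there, and pairs become measurable. Simple functions cause no
  trouble, because their pairs and distances are measurable outright. For the triangle inequality
  the two couplings only have to agree on the label of a cell of a finite partition, so a finite sum
  of product measures replaces conditional probabilities. For completeness one probability space has
  to carry a whole sequence of couplings; the unit interval can do so because it has no atoms, so
  every fibre of a simple function can be cut further into pieces of prescribed mass.\<close>

lemma ennpowr_ennreal [simp]: "0 \<le> a \<Longrightarrow> ennpowr (ennreal a) p = ennreal (a powr p)"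
  by (simp add: ennpowr_def)

lemma ennpowr_top [simp]: "ennpowr top p = top"
  by (simp add: ennpowr_def)

lemma ennpowr_0 [simp]: "ennpowr 0 p = 0"
  by (simp add: ennpowr_def)

lemma ennpowr_mono: "x \<le> y \<Longrightarrow> 0 \<le> p \<Longrightarrow> ennpowr x p \<le> ennpowr y p"
  by (cases x; cases y) (auto intro!: ennreal_leI powr_mono2 simp: top_unique)

lemma ennpowr_ennpowr_inverse [simp]: "0 < p \<Longrightarrow> ennpowr (ennpowr x p) (1 / p) = x"
  by (cases x) (auto simp: powr_powr)

lemma ennpowr_inverse_ennpowr [simp]: "0 < p \<Longrightarrow> ennpowr (ennpowr x (1 / p)) p = x"
  by (cases x) (auto simp: powr_powr)

lemma ennpowr_le_iff [simp]: "0 < p \<Longrightarrow> ennpowr x p \<le> ennpowr y p \<longleftrightarrow> x \<le> y"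
  by (metis ennpowr_ennpowr_inverse ennpowr_mono less_imp_le zero_le_divide_1_iff)

lemma ennpowr_less_iff: "0 < p \<Longrightarrow> ennpowr x p < ennpowr y p \<longleftrightarrow> x < y"
  by (simp add: not_le [symmetric])

lemma ennpowr_inverse_le_iff: "0 < p \<Longrightarrow> ennpowr x (1 / p) \<le> y \<longleftrightarrow> x \<le> ennpowr y p"
  by (metis ennpowr_inverse_ennpowr ennpowr_le_iff)

lemma ennpowr_inverse_less_iff: "0 < p \<Longrightarrow> ennpowr x (1 / p) < y \<longleftrightarrow> x < ennpowr y p"
  by (metis ennpowr_inverse_ennpowr ennpowr_less_iff)

lemma ennpowr_eq_0_iff [simp]: "ennpowr x p = 0 \<longleftrightarrow> x = 0"
  by (cases x) auto

lemma ennpowr_pos_iff [simp]: "0 < ennpowr x p \<longleftrightarrow> 0 < x"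
  by (simp add: zero_less_iff_neq_zero)

lemma ennpowr_less_top_iff [simp]: "ennpowr x p < top \<longleftrightarrow> x < top"
  by (cases x) auto

lemma borel_measurable_ennpowr [measurable]: "(\<lambda>x. ennpowr x p) \<in> borel_measurable borel"
  unfolding ennpowr_def by measurable

text \<open>A positive power is an order isomorphism with inverse power \<open>1 / p\<close>, hence
  preserves suprema.\<close>

lemma ennpowr_SUP:
  assumes "0 < p"
  shows "ennpowr (SUP i\<in>I. f i) p = (SUP i\<in>I. ennpowr (f i) p)"
proof (rule antisym)
  show "(SUP i\<in>I. ennpowr (f i) p) \<le> ennpowr (SUP i\<in>I. f i) p"
    using assms by (auto intro!: SUP_least SUP_upper)
  have "(SUP i\<in>I. f i) \<le> ennpowr (SUP i\<in>I. ennpowr (f i) p) (1 / p)"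
  proof (rule SUP_least)
    fix i assume "i \<in> I"
    then have "ennpowr (ennpowr (f i) p) (1 / p) \<le> ennpowr (SUP i\<in>I. ennpowr (f i) p) (1 / p)"
      using assms by (intro ennpowr_mono SUP_upper) auto
    then show "f i \<le> ennpowr (SUP i\<in>I. ennpowr (f i) p) (1 / p)" using assms by simp
  qed
  then show "ennpowr (SUP i\<in>I. f i) p \<le> (SUP i\<in>I. ennpowr (f i) p)"
    using assms by (metis ennpowr_inverse_ennpowr ennpowr_le_iff)
qed

text \<open>Convexity of the power function up to the boundary: if \<open>x\<close> or
  \<open>y\<close> vanishes, it reduces to \<open>v powr p \<le> v\<close> for \<open>v\<close> in
  the unit interval.\<close>

lemma powr_convex_combination_le:
  fixes u x y p :: real
  assumes p: "1 \<le> p" and u: "0 \<le> u" "u \<le> 1" and xy: "0 \<le> x" "0 \<le> y"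
  shows "((1 - u) * x + u * y) powr p \<le> (1 - u) * x powr p + u * y powr p"
proof -
  have le: "(v * z) powr p \<le> v * z powr p" if "0 \<le> v" "v \<le> 1" "0 \<le> z" for v z :: real
  proof -
    have "v powr p \<le> v powr 1" using p that by (intro powr_mono')
    then show ?thesis using that by (auto simp: powr_mult intro!: mult_right_mono)
  qed
  show ?thesis
  proof (cases "0 < x \<and> 0 < y")
    case True
    then show ?thesis using convex_onD[OF powr_convex[OF p], of u x y] u by simp
  next
    case False
    then consider "x = 0" | "y = 0" using xy by linarith
    then show ?thesis
    proof cases
      case 1
      then show ?thesis using le[of u y] u xy by simp
    next
      case 2
      then show ?thesis using le[of "1 - u" x] u xy by simp
    qed
  qed
qed

text \<open>This is convexity of the power function with weights \<open>a / (a + b)\<close> and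
  \<open>b / (a + b)\<close> at the points \<open>x / a\<close> and \<open>y / b\<close>. With
  \<open>a\<close> and \<open>b\<close> close to the norms of two functions, integration turns it
  directly into Minkowski's inequality.\<close>

lemma ennpowr_add_le:
  assumes p: "1 \<le> p" and a: "0 < a" and b: "0 < b"
  shows "ennpowr (x + y) p \<le> ennreal ((a + b) powr (p - 1)) *
    (ennreal (a powr (1 - p)) * ennpowr x p + ennreal (b powr (1 - p)) * ennpowr y p)"
proof (cases "x = top \<or> y = top")
  case True
  then show ?thesis using a b by (auto simp: ennreal_mult_top)
next
  case False
  then obtain s t where xy: "x = ennreal s" "y = ennreal t" "0 \<le> s" "0 \<le> t"
    by (metis ennreal_cases)
  define u where "u = b / (a + b)"
  have u: "0 \<le> u" "u \<le> 1" "1 - u = a / (a + b)"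
    using a b by (auto simp: u_def field_simps)
  have le: "((1 - u) * (s / a) + u * (t / b)) powr p \<le> (1 - u) * (s / a) powr p + u * (t / b) powr p"
    using a b xy u(1,2) by (intro powr_convex_combination_le p) auto
  have eq: "(1 - u) * (s / a) + u * (t / b) = (s + t) / (a + b)"
    unfolding u(3) unfolding u_def using a b by (simp add: add_divide_distrib)
  have "((s + t) / (a + b)) powr p \<le> a / (a + b) * (s / a) powr p + (b / (a + b)) * (t / b) powr p"
    using le unfolding eq unfolding u(3) unfolding u_def .
  then have "(s + t) powr p \<le> (a + b) powr p *
      (a / (a + b) * (s / a) powr p + (b / (a + b)) * (t / b) powr p)"
    using a b xy by (simp add: powr_divide field_simps)
  also have "\<dots> = (a + b) powr (p - 1) * (a powr (1 - p) * s powr p + b powr (1 - p) * t powr p)"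
    using a b xy by (simp add: powr_divide powr_diff distrib_left)
  finally show ?thesis using xy by (simp flip: ennreal_plus ennreal_mult add: ennreal_leI)
qed

section \<open>L^p norms with values in [0, \<infinity>] and Minkowski's inequality\<close>

definition lp_norm :: "'a measure \<Rightarrow> real \<Rightarrow> ('a \<Rightarrow> ennreal) \<Rightarrow> ennreal" where
  "lp_norm P p f = ennpowr (\<integral>\<^sup>+x. ennpowr (f x) p \<partial>P) (1 / p)"

lemma ennpowr_lp_norm: "0 < p \<Longrightarrow> ennpowr (lp_norm P p f) p = (\<integral>\<^sup>+x. ennpowr (f x) p \<partial>P)"
  by (simp add: lp_norm_def)

lemma lp_norm_le_iff: "0 < p \<Longrightarrow> lp_norm P p f \<le> c \<longleftrightarrow> (\<integral>\<^sup>+x. ennpowr (f x) p \<partial>P) \<le> ennpowr c p"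
  by (simp add: lp_norm_def ennpowr_inverse_le_iff)

lemma lp_norm_less_iff: "0 < p \<Longrightarrow> lp_norm P p f < c \<longleftrightarrow> (\<integral>\<^sup>+x. ennpowr (f x) p \<partial>P) < ennpowr c p"
  by (simp add: lp_norm_def ennpowr_inverse_less_iff)

lemma lp_norm_mono_AE: "AE x in P. f x \<le> g x \<Longrightarrow> 0 < p \<Longrightarrow> lp_norm P p f \<le> lp_norm P p g"
  unfolding lp_norm_def by (intro ennpowr_mono nn_integral_mono_AE) auto

lemma lp_norm_mono: "(\<And>x. x \<in> space P \<Longrightarrow> f x \<le> g x) \<Longrightarrow> 0 < p \<Longrightarrow> lp_norm P p f \<le> lp_norm P p g"
  by (intro lp_norm_mono_AE AE_I2)

lemma lp_norm_cong_AE: "AE x in P. f x = g x \<Longrightarrow> lp_norm P p f = lp_norm P p g"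
  unfolding lp_norm_def by (intro arg_cong2[where f=ennpowr] refl nn_integral_cong_AE) auto

lemma lp_norm_distr:
  assumes "h \<in> measurable P M" "f \<in> borel_measurable M"
  shows "lp_norm (distr P M h) p f = lp_norm P p (\<lambda>x. f (h x))"
  using assms unfolding lp_norm_def by (subst nn_integral_distr) auto

lemma (in prob_space) lp_norm_const: "0 < p \<Longrightarrow> lp_norm M p (\<lambda>_. c) = c"
  by (simp add: lp_norm_def emeasure_space_1)

lemma lp_norm_add_le:
  assumes p: "1 \<le> p" and [measurable]: "f \<in> borel_measurable P" "g \<in> borel_measurable P"
  shows "lp_norm P p (\<lambda>x. f x + g x) \<le> lp_norm P p f + lp_norm P p g"
proof (rule ennreal_le_epsilon)
  fix e :: real
  assume fin: "lp_norm P p f + lp_norm P p g < top" and e: "0 < e"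
  have p0: "0 < p" using p by simp
  obtain a b where ab: "lp_norm P p f = ennreal a" "lp_norm P p g = ennreal b" "0 \<le> a" "0 \<le> b"
    using fin by (metis ennreal_add_eq_top ennreal_cases less_irrefl)
  \<comment> \<open>The norms may vanish, whereas \<open>ennpowr_add_le\<close> asks for positive
    weights; the two increments add up to \<open>e\<close>.\<close>
  define a' b' where "a' = a + e / 2" and "b' = b + e / 2"
  have pos: "0 < a'" "0 < b'" using ab e by (auto simp: a'_def b'_def)
  have A: "(\<integral>\<^sup>+x. ennpowr (f x) p \<partial>P) \<le> ennreal (a' powr p)"
  proof -
    have "lp_norm P p f \<le> ennreal a'" unfolding ab a'_def using e by (intro ennreal_leI) linarith
    then show ?thesis unfolding lp_norm_le_iff[OF p0] ennpowr_ennreal[OF less_imp_le[OF pos(1)]] .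
  qed
  have B: "(\<integral>\<^sup>+x. ennpowr (g x) p \<partial>P) \<le> ennreal (b' powr p)"
  proof -
    have "lp_norm P p g \<le> ennreal b'" unfolding ab b'_def using e by (intro ennreal_leI) linarith
    then show ?thesis unfolding lp_norm_le_iff[OF p0] ennpowr_ennreal[OF less_imp_le[OF pos(2)]] .
  qed
  have "(\<integral>\<^sup>+x. ennpowr (f x + g x) p \<partial>P) \<le> (\<integral>\<^sup>+x. ennreal ((a' + b') powr (p - 1)) *
    (ennreal (a' powr (1 - p)) * ennpowr (f x) p + ennreal (b' powr (1 - p)) * ennpowr (g x) p) \<partial>P)"
    by (intro nn_integral_mono ennpowr_add_le p pos)
  also have "\<dots> = ennreal ((a' + b') powr (p - 1)) *
    (ennreal (a' powr (1 - p)) * (\<integral>\<^sup>+x. ennpowr (f x) p \<partial>P) + ennreal (b' powr (1 - p)) * (\<integral>\<^sup>+x. ennpowr (g x) p \<partial>P))"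
    by (simp add: nn_integral_cmult nn_integral_add)
  also have "\<dots> \<le> ennreal ((a' + b') powr (p - 1)) *
    (ennreal (a' powr (1 - p)) * ennreal (a' powr p) + ennreal (b' powr (1 - p)) * ennreal (b' powr p))"
    by (intro mult_left_mono add_mono A B) auto
  also have "\<dots> = ennreal ((a' + b') powr (p - 1) * (a' powr (1 - p) * a' powr p + b' powr (1 - p) * b' powr p))"
    by (simp flip: ennreal_mult ennreal_plus)
  also have "(a' + b') powr (p - 1) * (a' powr (1 - p) * a' powr p + b' powr (1 - p) * b' powr p) = (a' + b') powr p"
    using pos by (simp add: powr_diff)
  also have "ennreal ((a' + b') powr p) = ennpowr (ennreal (a' + b')) p"
    using pos by (simp del: ennreal_plus)
  finally have "lp_norm P p (\<lambda>x. f x + g x) \<le> ennreal (a' + b')"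
    unfolding lp_norm_le_iff[OF p0] .
  also have "\<dots> = lp_norm P p f + lp_norm P p g + ennreal e"
    using ab e by (simp add: a'_def b'_def flip: ennreal_plus)
  finally show "lp_norm P p (\<lambda>x. f x + g x) \<le> lp_norm P p f + lp_norm P p g + ennreal e" .
qed

lemma lp_norm_sum_le:
  assumes p: "1 \<le> p" and "finite I" and "\<And>i. i \<in> I \<Longrightarrow> f i \<in> borel_measurable P"
  shows "lp_norm P p (\<lambda>x. \<Sum>i\<in>I. f i x) \<le> (\<Sum>i\<in>I. lp_norm P p (f i))"
  using assms(2,3)
proof induction
  case empty
  then show ?case using p by (simp add: lp_norm_def)
next
  case (insert i I)
  then have "lp_norm P p (\<lambda>x. f i x + (\<Sum>i\<in>I. f i x)) \<le> lp_norm P p (f i) + lp_norm P p (\<lambda>x. \<Sum>i\<in>I. f i x)"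
    by (intro lp_norm_add_le p) auto
  also have "\<dots> \<le> lp_norm P p (f i) + (\<Sum>i\<in>I. lp_norm P p (f i))"
    using insert by (intro add_mono) auto
  finally show ?case using insert by simp
qed

text \<open>Monotone convergence applied to the partial sums. It serves to bound the total length of
  a random path by the norms of its steps.\<close>

lemma lp_norm_suminf_le:
  assumes p: "1 \<le> p" and [measurable]: "\<And>i. f i \<in> borel_measurable P"
  shows "lp_norm P p (\<lambda>x. \<Sum>i. f i x) \<le> (\<Sum>i. lp_norm P p (f i))"
proof -
  have p0: "0 < p" using p by simp
  have "(\<integral>\<^sup>+x. ennpowr (\<Sum>i. f i x) p \<partial>P) = (\<integral>\<^sup>+x. (SUP n. ennpowr (\<Sum>i<n. f i x) p) \<partial>P)"
    by (simp add: suminf_eq_SUP ennpowr_SUP[OF p0])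
  also have "\<dots> = (SUP n. (\<integral>\<^sup>+x. ennpowr (\<Sum>i<n. f i x) p \<partial>P))"
    by (intro nn_integral_monotone_convergence_SUP)
      (auto intro!: incseq_SucI le_funI simp: p0)
  also have "\<dots> \<le> ennpowr (\<Sum>i. lp_norm P p (f i)) p"
  proof (rule SUP_least)
    fix n
    have "lp_norm P p (\<lambda>x. \<Sum>i<n. f i x) \<le> (\<Sum>i<n. lp_norm P p (f i))"
      by (intro lp_norm_sum_le p) auto
    also have "\<dots> \<le> (\<Sum>i. lp_norm P p (f i))"
      by (rule sum_le_suminf) auto
    finally show "(\<integral>\<^sup>+x. ennpowr (\<Sum>i<n. f i x) p \<partial>P) \<le> ennpowr (\<Sum>i. lp_norm P p (f i)) p"
      unfolding lp_norm_le_iff[OF p0] .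
  qed
  finally show ?thesis unfolding lp_norm_le_iff[OF p0] .
qed

section \<open>Radon measures on metric spaces\<close>

lemma space_borel_on [simp]: "space (borel_on X) = X"
  by (simp add: space_restrict_space)

lemma compact_in_sets_borel_on:
  fixes K :: "'a::t2_space set"
  shows "compact K \<Longrightarrow> K \<subseteq> X \<Longrightarrow> K \<in> sets (borel_on X)"
  by (auto simp: sets_restrict_space image_iff intro!: bexI[of _ K] borel_closed compact_imp_closed)

text \<open>Inner regularity in its working form: a compact subset with small remainder. Remainders,
  unlike suprema, add up when several compact sets are united or intersected.\<close>

lemma radon_measureI:
  assumes "finite_measure M"
    and "\<And>B e. B \<in> sets M \<Longrightarrow> 0 < e \<Longrightarrow> \<exists>K. compact K \<and> K \<subseteq> B \<and> K \<in> sets M \<and> measure M (B - K) \<le> e"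
  shows "radon_measure M"
  unfolding radon_measure_def
proof (intro ballI antisym)
  interpret finite_measure M by fact
  fix B assume B: "B \<in> sets M"
  show "(SUP K\<in>{K. compact K \<and> K \<subseteq> B}. emeasure M K) \<le> emeasure M B"
    using B by (auto intro!: SUP_least emeasure_mono)
  show "emeasure M B \<le> (SUP K\<in>{K. compact K \<and> K \<subseteq> B}. emeasure M K)"
  proof (rule ennreal_le_epsilon)
    fix e :: real assume "0 < e"
    then obtain K where K: "compact K" "K \<subseteq> B" "K \<in> sets M" "measure M (B - K) \<le> e"
      using assms(2) B by blast
    then have "measure M B \<le> measure M K + e"
      using finite_measure_Diff[OF B, of K] by simp
    then have "emeasure M B \<le> emeasure M K + ennreal e"
      using \<open>0 < e\<close> by (simp add: emeasure_eq_measure flip: ennreal_plus)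
    also have "\<dots> \<le> (SUP K\<in>{K. compact K \<and> K \<subseteq> B}. emeasure M K) + ennreal e"
      using K by (intro add_right_mono SUP_upper) auto
    finally show "emeasure M B \<le> (SUP K\<in>{K. compact K \<and> K \<subseteq> B}. emeasure M K) + ennreal e" .
  qed
qed

lemma radon_measureD:
  fixes M :: "'a::t2_space measure"
  assumes "finite_measure M" "sets M = sets (borel_on X)" "radon_measure M" "B \<in> sets M" "0 < e"
  shows "\<exists>K. compact K \<and> K \<subseteq> B \<and> K \<in> sets M \<and> measure M (B - K) \<le> e"
proof (cases "measure M B \<le> e")
  case True
  then show ?thesis by (intro exI[of _ "{}"]) auto
next
  case False
  interpret finite_measure M by fact
  \<comment> \<open>Here \<open>measure M B - e\<close> is positive, so \<open>ennreal\<close> does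
    not truncate it and the bound can be read back in the reals.\<close>
  have "ennreal (measure M B - e) < emeasure M B"
    using False \<open>0 < e\<close> by (simp add: emeasure_eq_measure ennreal_lessI)
  also have "\<dots> = (SUP K\<in>{K. compact K \<and> K \<subseteq> B}. emeasure M K)"
    using assms by (simp add: radon_measure_def)
  finally obtain K where K: "compact K" "K \<subseteq> B" "ennreal (measure M B - e) < emeasure M K"
    by (auto simp: less_SUP_iff)
  have "K \<in> sets M"
    using K assms(2) \<open>B \<in> sets M\<close> sets.sets_into_space[OF \<open>B \<in> sets M\<close>] sets_eq_imp_space_eq[OF assms(2)]
    by (auto intro!: compact_in_sets_borel_on)
  moreover have "measure M B - e < measure M K"
    using K(3) False by (simp add: emeasure_eq_measure ennreal_less_iff)
  ultimately show ?thesis using K(1,2) finite_measure_Diff[OF \<open>B \<in> sets M\<close>, of K] by auto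
qed

text \<open>The substitute for separability of \<open>X\<close>, from which joint measurability of
  pairs is recovered.\<close>

definition essentially_separable :: "'a::metric_space measure \<Rightarrow> bool" where
  "essentially_separable M \<longleftrightarrow> (\<exists>D. countable D \<and> D \<subseteq> space M \<and> (AE x in M. x \<in> closure D))"

lemma compact_imp_subset_closure_countable:
  fixes K :: "'a::metric_space set"
  assumes "compact K"
  shows "\<exists>D. countable D \<and> D \<subseteq> K \<and> K \<subseteq> closure D"
proof -
  have "\<exists>k. finite k \<and> k \<subseteq> K \<and> K \<subseteq> (\<Union>x\<in>k. ball x (1 / Suc n))" for n
    using seq_compact_imp_totally_bounded[of K] assms compact_imp_seq_compact by fastforce
  then obtain k where k: "\<And>n. finite (k n)" "\<And>n. K \<subseteq> (\<Union>x\<in>k n. ball x (1 / Suc n))" "\<And>n. k n \<subseteq> K"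
    by metis
  have "K \<subseteq> closure (\<Union>n. k n)"
  proof
    fix x assume x: "x \<in> K"
    show "x \<in> closure (\<Union>n. k n)"
      unfolding closure_approachable
    proof (intro allI impI)
      fix e :: real assume "0 < e"
      then obtain n where n: "1 / Suc n < e" using nat_approx_posE by blast
      obtain y where "y \<in> k n" "dist y x < 1 / Suc n" using x k(2)[of n] by auto
      then show "\<exists>y\<in>\<Union>n. k n. dist y x < e" using n by (intro bexI[of _ y]) auto
    qed
  qed
  then show ?thesis using k(1,3) by (intro exI[of _ "\<Union>n. k n"]) (auto intro: countable_finite)
qed

text \<open>Countably many compact sets exhaust the space up to a null set, and each of them has a
  countable dense subset.\<close>

lemma radon_imp_essentially_separable:
  fixes M :: "'a::metric_space measure"
  assumes "finite_measure M" "sets M = sets (borel_on X)" "radon_measure M"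
  shows "essentially_separable M"
proof -
  interpret finite_measure M by fact
  have "\<exists>K. compact K \<and> K \<subseteq> space M \<and> K \<in> sets M \<and> measure M (space M - K) \<le> 1 / Suc n" for n
    by (rule radon_measureD[OF assms]) auto
  then obtain K where K: "\<And>n. compact (K n)" "\<And>n. K n \<in> sets M" "\<And>n. measure M (space M - K n) \<le> 1 / Suc n"
    by metis
  obtain D where D: "\<And>n. countable (D n)" "\<And>n. K n \<subseteq> closure (D n)" "\<And>n. D n \<subseteq> K n"
    using compact_imp_subset_closure_countable[OF K(1)] by metis
  have "measure M (space M - (\<Union>n. K n)) \<le> 0"
  proof (rule field_le_epsilon)
    fix e :: real assume "0 < e"
    then obtain n where n: "1 / Suc n < e" using nat_approx_posE by blast
    have "measure M (space M - (\<Union>n. K n)) \<le> measure M (space M - K n)"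
      using K(2) by (intro finite_measure_mono) auto
    then show "measure M (space M - (\<Union>n. K n)) \<le> 0 + e" using K(3)[of n] n by linarith
  qed
  then have "space M - (\<Union>n. K n) \<in> null_sets M"
    using K(2) by (auto simp: null_sets_def emeasure_eq_measure intro!: antisym)
  moreover have "(\<Union>n. K n) \<subseteq> closure (\<Union>n. D n)"
    using D(2) closure_mono[of "D n" "\<Union>n. D n" for n] by blast
  ultimately have "AE x in M. x \<in> closure (\<Union>n. D n)"
    by (intro AE_I'[of "space M - (\<Union>n. K n)"]) auto
  then show ?thesis unfolding essentially_separable_def
    using D(1,3) sets.sets_into_space[OF K(2)] by (intro exI[of _ "\<Union>n. D n"]) blast
qed

text \<open>Balls with centres in \<open>D\<close> and radii \<open>1 / Suc n\<close> form a
  countable base at the points of \<open>closure D\<close>.\<close>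

lemma exists_ball_in_open:
  fixes D :: "'a::metric_space set"
  assumes "x \<in> closure D" "0 < e"
  shows "\<exists>d\<in>D. \<exists>n::nat. x \<in> ball d (1 / Suc n) \<and> ball d (1 / Suc n) \<subseteq> ball x e"
proof -
  obtain n :: nat where n: "1 / Suc n < e / 2" using nat_approx_posE[of "e / 2"] assms by auto
  obtain d where d: "d \<in> D" "dist d x < 1 / Suc n"
    using assms(1) unfolding closure_approachable by (metis of_nat_0_less_iff zero_less_Suc zero_less_divide_1_iff)
  have "ball d (1 / Suc n) \<subseteq> ball x e"
  proof
    fix y assume "y \<in> ball d (1 / Suc n)"
    then show "y \<in> ball x e" using d n dist_triangle[of x y d] by (simp add: dist_commute)
  qed
  with d show ?thesis by (intro bexI[of _ d] exI[of _ n]) auto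
qed

text \<open>An open set of the product need not be a countable union of boxes. Its preimage,
  however, is a countable union of preimages of boxes, because only points of
  \<open>closure D\<close> occur and balls around points of \<open>D\<close> suffice for
  them.\<close>

lemma borel_measurable_Pair_separable:
  fixes F H :: "'w \<Rightarrow> 'a::metric_space"
  assumes [measurable]: "F \<in> borel_measurable M" "H \<in> borel_measurable M" and D: "countable D"
    and F: "\<And>w. w \<in> space M \<Longrightarrow> F w \<in> closure D" and H: "\<And>w. w \<in> space M \<Longrightarrow> H w \<in> closure D"
  shows "(\<lambda>w. (F w, H w)) \<in> borel_measurable M"
proof (rule borel_measurableI)
  fix U :: "('a \<times> 'a) set" assume U: "open U"
  define I where "I = {(a, m, b, n). a \<in> D \<and> b \<in> D \<and> ball a (1 / Suc m) \<times> ball b (1 / Suc n) \<subseteq> U}"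
  have "I \<subseteq> D \<times> UNIV \<times> D \<times> (UNIV :: nat set)" by (auto simp: I_def)
  then have I: "countable I" by (rule countable_subset) (auto intro!: countable_SIGMA D)
  have "(\<lambda>w. (F w, H w)) -` U \<inter> space M =
    (\<Union>(a, m, b, n)\<in>I. {w \<in> space M. F w \<in> ball a (1 / Suc m) \<and> H w \<in> ball b (1 / Suc n)})"
    (is "?L = ?R")
  proof
    show "?R \<subseteq> ?L"
    proof
      fix w assume "w \<in> ?R"
      then obtain a m b n where i: "ball a (1 / Suc m) \<times> ball b (1 / Suc n) \<subseteq> U"
        "w \<in> space M" "F w \<in> ball a (1 / Suc m)" "H w \<in> ball b (1 / Suc n)"
        unfolding I_def by blast
      then have "(F w, H w) \<in> U" by (meson SigmaI subsetD)
      then show "w \<in> ?L" using i by simp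
    qed
    show "?L \<subseteq> ?R"
    proof
      fix w assume w: "w \<in> ?L"
      then obtain A B where AB: "open A" "open B" "F w \<in> A" "H w \<in> B" "A \<times> B \<subseteq> U"
        using U by (auto elim!: open_prod_elim)
      obtain e1 e2 where e: "0 < e1" "ball (F w) e1 \<subseteq> A" "0 < e2" "ball (H w) e2 \<subseteq> B"
        using AB by (meson open_contains_ball)
      obtain a m where a: "a \<in> D" "F w \<in> ball a (1 / Suc m)" "ball a (1 / Suc m) \<subseteq> ball (F w) e1"
        using exists_ball_in_open F w e(1) by blast
      obtain b n where b: "b \<in> D" "H w \<in> ball b (1 / Suc n)" "ball b (1 / Suc n) \<subseteq> ball (H w) e2"
        using exists_ball_in_open H w e(3) by blast
      have "(a, m, b, n) \<in> I" using a b e AB(5) unfolding I_def by blast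
      then show "w \<in> ?R" using a b w by (intro UN_I[of "(a, m, b, n)"]) auto
    qed
  qed
  also have "\<dots> \<in> sets M"
  proof -
    have "{w \<in> space M. F w \<in> ball a r \<and> H w \<in> ball b s} \<in> sets M" for a b r s
    proof -
      have "{w \<in> space M. F w \<in> ball a r \<and> H w \<in> ball b s} =
          (F -` ball a r \<inter> space M) \<inter> (H -` ball b s \<inter> space M)" by auto
      also have "\<dots> \<in> sets M" by (intro sets.Int measurable_sets[OF assms(1)] measurable_sets[OF assms(2)]) auto
      finally show ?thesis .
    qed
    then show ?thesis
      by (intro sets.countable_UN'[OF I]) (auto simp: split_beta simp del: mem_ball)
  qed
  finally show "(\<lambda>w. (F w, H w)) -` U \<inter> space M \<in> sets M" .
qed

text \<open>The argument is that of Lusin's theorem: \<open>f\<close> is continuous on a compact set of almost full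
  measure, because it is enough to control the preimages of countably many balls.\<close>

lemma radon_measure_distr_separable:
  fixes f :: "'w::t2_space \<Rightarrow> 'a::metric_space"
  assumes fin: "finite_measure M"
    and inner: "\<And>A e. A \<in> sets M \<Longrightarrow> 0 < e \<Longrightarrow> \<exists>K. compact K \<and> K \<subseteq> A \<and> K \<in> sets M \<and> measure M (A - K) \<le> e"
    and f[measurable]: "f \<in> measurable M (borel_on X)"
    and D: "countable D" and fD: "\<And>w. w \<in> space M \<Longrightarrow> f w \<in> closure D"
  shows "radon_measure (distr M (borel_on X) f)"
proof (rule radon_measureI)
  interpret finite_measure M by fact
  show "finite_measure (distr M (borel_on X) f)" by (rule finite_measure_distr) fact
  fix B and e :: real assume "B \<in> sets (distr M (borel_on X) f)" and e: "0 < e"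
  then have B[measurable]: "B \<in> sets (borel_on X)" by simp
  \<comment> \<open>Being nonempty, \<open>E\<close> is enumerated by \<open>from_nat_into\<close>;
    the added point only contributes further balls to the countable family.\<close>
  define E where "E = insert undefined D"
  have E: "countable E" "E \<noteq> {}" "\<And>w. w \<in> space M \<Longrightarrow> f w \<in> closure E"
    using D fD closure_mono[of D E] by (auto simp: E_def)
  define U where "U k = (case prod_decode k of (i, n) \<Rightarrow> ball (from_nat_into E i) (1 / Suc n))" for k
  have U[measurable]: "U k \<in> sets borel" for k by (auto simp: U_def split: prod.split)
  have fb[measurable]: "f \<in> borel_measurable M"
    using f by (simp add: measurable_restrict_space2_iff)
  \<comment> \<open>These numbers sum to \<open>e / 4\<close>. For each \<open>k\<close> the
    preimage of \<open>U k\<close> and its complement both lose \<open>\<delta> k\<close>, in total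
    \<open>e / 2\<close>; the other half of \<open>e\<close> is spent on \<open>K0\<close>.\<close>
  define \<delta> where "\<delta> k = e / 4 * (1 / 2) ^ Suc k" for k
  have \<delta>: "0 < \<delta> k" for k using e by (simp add: \<delta>_def)
  have \<delta>s: "\<delta> sums (e / 4)"
    unfolding \<delta>_def using sums_mult[OF power_half_series, of "e / 4"] by simp
  obtain K1 where K1: "\<And>k. compact (K1 k)" "\<And>k. K1 k \<subseteq> f -` U k \<inter> space M" "\<And>k. K1 k \<in> sets M"
      "\<And>k. measure M (f -` U k \<inter> space M - K1 k) \<le> \<delta> k"
  proof -
    have "\<exists>K. compact K \<and> K \<subseteq> f -` U k \<inter> space M \<and> K \<in> sets M \<and> measure M (f -` U k \<inter> space M - K) \<le> \<delta> k" for k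
      using inner[OF measurable_sets[OF fb U] \<delta>] .
    then show ?thesis using that by metis
  qed
  have Uc: "space M - f -` U k \<in> sets M" for k
    using measurable_sets[OF fb, of "- U k"] by (auto simp: vimage_Compl Diff_eq Int_commute)
  obtain K2 where K2: "\<And>k. compact (K2 k)" "\<And>k. K2 k \<subseteq> space M - f -` U k" "\<And>k. K2 k \<in> sets M"
      "\<And>k. measure M (space M - f -` U k - K2 k) \<le> \<delta> k"
  proof -
    have "\<exists>K. compact K \<and> K \<subseteq> space M - f -` U k \<and> K \<in> sets M \<and> measure M (space M - f -` U k - K) \<le> \<delta> k" for k
      using inner[OF Uc \<delta>] .
    then show ?thesis using that by metis
  qed
  obtain K0 where K0: "compact K0" "K0 \<subseteq> f -` B \<inter> space M" "K0 \<in> sets M"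
      "measure M (f -` B \<inter> space M - K0) \<le> e / 2"
    using inner[OF measurable_sets[OF f B], of "e / 2"] e by auto
  \<comment> \<open>A point of \<open>K\<close> lies in exactly one of \<open>K1 k\<close> and
    \<open>K2 k\<close>, according to whether its image lies in \<open>U k\<close>. So the preimage
    of \<open>U k\<close> in \<open>K\<close> is the trace of the open set \<open>- K2 k\<close>,
    which makes \<open>f\<close> continuous on \<open>K\<close>.\<close>
  define K where "K = K0 \<inter> (\<Inter>k. K1 k \<union> K2 k)"
  have K_compact: "compact K"
    unfolding K_def using K0 K1 K2
    by (intro compact_Int_closed closed_INT ballI closed_Un compact_imp_closed) auto
  have K_sets: "K \<in> sets M" unfolding K_def using K0 K1 K2 by auto
  have K_sub: "K \<subseteq> f -` B \<inter> space M" using K0 by (auto simp: K_def)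
  have "continuous_on K f"
    unfolding continuous_on_open_invariant
  proof (intro allI impI)
    fix V :: "'a set" assume V: "open V"
    define J where "J = {k. U k \<subseteq> V}"
    show "\<exists>A. open A \<and> A \<inter> K = f -` V \<inter> K"
    proof (intro exI conjI)
      show "open (\<Union>k\<in>J. - K2 k)" using K2(1) by (auto intro: compact_imp_closed)
      show "(\<Union>k\<in>J. - K2 k) \<inter> K = f -` V \<inter> K"
      proof (intro equalityI subsetI)
        fix w assume "w \<in> (\<Union>k\<in>J. - K2 k) \<inter> K"
        then obtain k where k: "U k \<subseteq> V" "w \<in> K1 k" "w \<in> K" by (auto simp: J_def K_def)
        then show "w \<in> f -` V \<inter> K" using K1(2)[of k] by auto
      next
        fix w assume w: "w \<in> f -` V \<inter> K"
        then obtain r where r: "0 < r" "ball (f w) r \<subseteq> V" using V by (auto simp: open_contains_ball)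
        have "w \<in> space M" using w K_sub by auto
        then obtain d n where d: "d \<in> E" "f w \<in> ball d (1 / Suc n)" "ball d (1 / Suc n) \<subseteq> ball (f w) r"
          using exists_ball_in_open[OF E(3) r(1)] by blast
        obtain i where i: "d = from_nat_into E i" using from_nat_into_surj[OF E(1) d(1)] by metis
        have U: "U (prod_encode (i, n)) = ball d (1 / Suc n)" by (simp add: U_def i)
        then have "prod_encode (i, n) \<in> J" using d r by (auto simp: J_def)
        moreover have "w \<notin> K2 (prod_encode (i, n))" using K2(2)[of "prod_encode (i, n)"] d(2) U by auto
        ultimately show "w \<in> (\<Union>k\<in>J. - K2 k) \<inter> K" using w by auto
      qed
    qed
  qed
  then have cfK: "compact (f ` K)" using K_compact by (rule compact_continuous_image)
  have fKB: "f ` K \<subseteq> B" using K_sub by auto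
  moreover have "B \<subseteq> X" using sets.sets_into_space[OF B] by simp
  ultimately have fK[measurable]: "f ` K \<in> sets (borel_on X)" by (intro compact_in_sets_borel_on cfK) auto
  have bad: "measure M (space M - (K1 k \<union> K2 k)) \<le> 2 * \<delta> k" for k
  proof -
    have m: "f -` U k \<inter> space M - K1 k \<in> sets M" "space M - f -` U k - K2 k \<in> sets M"
      using K1(3) K2(3) Uc measurable_sets[OF fb U] by (auto intro: sets.Diff)
    have "measure M (space M - (K1 k \<union> K2 k)) \<le> measure M ((f -` U k \<inter> space M - K1 k) \<union> (space M - f -` U k - K2 k))"
      using m by (intro finite_measure_mono) auto
    also have "\<dots> \<le> measure M (f -` U k \<inter> space M - K1 k) + measure M (space M - f -` U k - K2 k)"
      using m by (intro measure_Un_le) auto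
    finally show ?thesis using K1(4)[of k] K2(4)[of k] by linarith
  qed
  have s: "summable (\<lambda>k. 2 * \<delta> k)" using \<delta>s by (intro summable_mult) (rule sums_summable)
  have sb: "summable (\<lambda>k. measure M (space M - (K1 k \<union> K2 k)))"
    by (rule summable_comparison_test'[OF s]) (use bad in auto)
  have "measure M (\<Union>k. space M - (K1 k \<union> K2 k)) \<le> (\<Sum>k. measure M (space M - (K1 k \<union> K2 k)))"
    by (rule finite_measure_subadditive_countably) (use K1 K2 sb in auto)
  also have "\<dots> \<le> (\<Sum>k. 2 * \<delta> k)" by (rule suminf_le[OF bad sb s])
  also have "\<dots> = e / 2" using sums_unique[OF sums_mult[OF \<delta>s, of 2]] by simp
  finally have b: "measure M (\<Union>k. space M - (K1 k \<union> K2 k)) \<le> e / 2" .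
  have "measure (distr M (borel_on X) f) (B - f ` K) = measure M (f -` (B - f ` K) \<inter> space M)"
    by (rule measure_distr) auto
  also have "\<dots> \<le> measure M ((f -` B \<inter> space M - K0) \<union> (\<Union>k. space M - (K1 k \<union> K2 k)))"
    using K0(3) K1(3) K2(3) by (intro finite_measure_mono) (auto simp: K_def)
  also have "\<dots> \<le> measure M (f -` B \<inter> space M - K0) + measure M (\<Union>k. space M - (K1 k \<union> K2 k))"
    using K0(3) K1(3) K2(3) by (intro measure_Un_le) auto
  also have "\<dots> \<le> e" using K0(4) b by simp
  finally show "\<exists>K. compact K \<and> K \<subseteq> B \<and> K \<in> sets (distr M (borel_on X) f) \<and> measure (distr M (borel_on X) f) (B - K) \<le> e"
    using cfK fKB fK by (intro exI[of _ "f ` K"]) auto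
qed

section \<open>Couplings and simple approximations\<close>

lemma borel_measurable_dist_const [measurable]:
  fixes a :: "'a::metric_space"
  shows "dist a \<in> borel_measurable borel"
  by (intro borel_measurable_continuous_onI continuous_intros)

lemma measurable_borel_onD: "f \<in> measurable M (borel_on X) \<Longrightarrow> f \<in> borel_measurable M"
  by (simp add: measurable_restrict_space2_iff)

lemma measurable_fst_borel_on [measurable]: "fst \<in> measurable (borel_on (X \<times> Y)) (borel_on X)"
  and measurable_snd_borel_on [measurable]: "snd \<in> measurable (borel_on (X \<times> Y)) (borel_on Y)"
proof -
  have "fst \<in> borel_measurable (borel_on (X \<times> Y))" "snd \<in> borel_measurable (borel_on (X \<times> Y))"
    by (intro measurable_restrict_space1 borel_measurable_continuous_onI continuous_intros)+
  then show "fst \<in> measurable (borel_on (X \<times> Y)) (borel_on X)" "snd \<in> measurable (borel_on (X \<times> Y)) (borel_on Y)"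
    by (auto simp: measurable_restrict_space2_iff)
qed

lemma borel_measurable_dist_fst_snd [measurable]:
  fixes X :: "'a::metric_space set"
  shows "(\<lambda>z. dist (fst z) (snd z)) \<in> borel_measurable (borel_on (X \<times> X))"
  by (auto intro!: measurable_restrict_space1 borel_measurable_continuous_onI continuous_intros)

lemma couplingsD:
  assumes "G \<in> couplings X M N"
  shows "sets G = sets (borel_on (X \<times> X))" "space G = X \<times> X" "prob_space G"
    "distr G (borel_on X) fst = M" "distr G (borel_on X) snd = N"
  using assms by (auto simp: couplings_def dest: sets_eq_imp_space_eq)

lemma wasserstein_dist_eq:
  assumes "0 < p"
  shows "ennpowr (wasserstein_dist p X M N) p = (INF G\<in>couplings X M N. ennpowr (lp_norm G p (\<lambda>z. ennreal (dist (fst z) (snd z)))) p)"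
  using assms by (simp add: wasserstein_dist_def ennpowr_lp_norm case_prod_beta')

lemma wasserstein_dist_le:
  assumes "0 < p" "G \<in> couplings X M N"
  shows "wasserstein_dist p X M N \<le> lp_norm G p (\<lambda>z. ennreal (dist (fst z) (snd z)))"
  using assms by (subst ennpowr_le_iff[symmetric, of p]) (auto simp: wasserstein_dist_eq intro!: INF_lower)

lemma wasserstein_dist_less_iff:
  assumes "0 < p"
  shows "wasserstein_dist p X M N < c \<longleftrightarrow> (\<exists>G\<in>couplings X M N. lp_norm G p (\<lambda>z. ennreal (dist (fst z) (snd z))) < c)"
  using assms by (subst ennpowr_less_iff[symmetric, of p]) (auto simp: wasserstein_dist_eq INF_less_iff ennpowr_less_iff)

text \<open>The pair of \<open>F\<close> and \<open>H\<close> need not be measurable into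
  \<open>borel_on (X \<times> X)\<close>. Retracting both maps onto \<open>closure D\<close> changes
  them on null sets only and makes the pair measurable, so its law is a coupling with the same
  marginals and the same cost.\<close>

lemma wasserstein_dist_le_lp_norm:
  fixes F H :: "'w \<Rightarrow> 'a::metric_space"
  assumes p: "0 < p" and "prob_space P"
    and F[measurable]: "F \<in> measurable P (borel_on X)" and H[measurable]: "H \<in> measurable P (borel_on X)"
    and D: "countable D" and FD: "AE w in P. F w \<in> closure D" and HD: "AE w in P. H w \<in> closure D"
  shows "wasserstein_dist p X (distr P (borel_on X) F) (distr P (borel_on X) H)
    \<le> lp_norm P p (\<lambda>w. ennreal (dist (F w) (H w)))"
proof -
  interpret prob_space P by fact
  note [measurable] = measurable_borel_onD[OF F] measurable_borel_onD[OF H]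
  obtain w0 where w0: "w0 \<in> space P" "F w0 \<in> closure D"
    using eventually_happens'[OF ae_filter_bot, of "\<lambda>w. w \<in> space P \<and> F w \<in> closure D"] FD by auto
  \<comment> \<open>The default value lies in \<open>closure D\<close> and in \<open>X\<close>, so
    the retraction also keeps points of \<open>X\<close> in \<open>X\<close>.\<close>
  define r where "r x = (if x \<in> closure D then x else F w0)" for x
  have FX: "F w \<in> X" "H w \<in> X" if "w \<in> space P" for w
    using measurable_space[OF F that] measurable_space[OF H that] by auto
  have rX: "r x \<in> X" if "x \<in> X" for x using that FX[OF w0(1)] by (auto simp: r_def)
  have rD: "r x \<in> closure D" for x using w0 by (simp add: r_def)
  have [measurable]: "r \<in> measurable borel borel" unfolding r_def by measurable
  have rF: "(\<lambda>w. r (F w)) \<in> measurable P (borel_on X)" and rH: "(\<lambda>w. r (H w)) \<in> measurable P (borel_on X)"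
    using FX rX by (auto intro!: measurable_restrict_space2)
  have pair: "(\<lambda>w. (r (F w), r (H w))) \<in> measurable P (borel_on (X \<times> X))"
    using FX rX by (intro measurable_restrict_space2 borel_measurable_Pair_separable[OF _ _ D] rD) auto
  define G where "G = distr P (borel_on (X \<times> X)) (\<lambda>w. (r (F w), r (H w)))"
  have eqF: "AE w in P. r (F w) = F w" and eqH: "AE w in P. r (H w) = H w"
    using FD HD by (auto simp: r_def)
  have "G \<in> couplings X (distr P (borel_on X) F) (distr P (borel_on X) H)"
    unfolding couplings_def
  proof (intro CollectI conjI)
    show "prob_space G" unfolding G_def by (rule prob_space_distr[OF pair])
    show "distr G (borel_on X) fst = distr P (borel_on X) F"
      unfolding G_def distr_distr[OF measurable_fst_borel_on pair] comp_def fst_conv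
      by (rule distr_cong_AE[OF refl refl eqF rF F])
    show "distr G (borel_on X) snd = distr P (borel_on X) H"
      unfolding G_def distr_distr[OF measurable_snd_borel_on pair] comp_def snd_conv
      by (rule distr_cong_AE[OF refl refl eqH rH H])
  qed (simp add: G_def)
  then have "wasserstein_dist p X (distr P (borel_on X) F) (distr P (borel_on X) H)
      \<le> lp_norm G p (\<lambda>z. ennreal (dist (fst z) (snd z)))"
    using p by (rule wasserstein_dist_le[rotated])
  also have "\<dots> = lp_norm P p (\<lambda>w. ennreal (dist (r (F w)) (r (H w))))"
    unfolding G_def by (subst lp_norm_distr[OF pair]) auto
  also have "\<dots> = lp_norm P p (\<lambda>w. ennreal (dist (F w) (H w)))"
    by (rule lp_norm_cong_AE) (use eqF eqH in eventually_elim, simp)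
  finally show ?thesis .
qed

section \<open>Measures of finite moment and their approximation by simple maps\<close>

lemma PpD:
  assumes "M \<in> Pp p X"
  shows "sets M = sets (borel_on X)" "space M = X" "prob_space M" "radon_measure M" "finite_measure M"
    "essentially_separable M"
proof -
  show *: "sets M = sets (borel_on X)" "prob_space M" "radon_measure M" using assms by (auto simp: Pp_def)
  then show "space M = X" by (auto dest: sets_eq_imp_space_eq)
  show "finite_measure M" using * by (auto intro: prob_space.finite_measure)
  then show "essentially_separable M" using * by (auto intro: radon_imp_essentially_separable)
qed

lemma Pp_moment:
  assumes "1 \<le> p" "M \<in> Pp p X"
  shows "lp_norm M p (\<lambda>x. ennreal (dist a x)) < top"
proof -
  interpret prob_space M using PpD(3)[OF assms(2)] .
  have [measurable_cong]: "sets M = sets (borel_on X)" using PpD(1)[OF assms(2)] .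
  have [measurable]: "dist b \<in> borel_measurable M" for b
    by (auto intro: measurable_restrict_space1 simp: measurable_cong_sets[OF \<open>sets M = _\<close> refl])
  obtain x0 where "(\<integral>\<^sup>+ x. ennreal (dist x0 x powr p) \<partial>M) < \<infinity>" using assms by (auto simp: Pp_def)
  then have *: "lp_norm M p (\<lambda>x. ennreal (dist x0 x)) < top"
    using assms(1) by (subst lp_norm_less_iff) auto
  have "lp_norm M p (\<lambda>x. ennreal (dist a x)) \<le> lp_norm M p (\<lambda>x. ennreal (dist a x0) + ennreal (dist x0 x))"
    using assms(1) by (intro lp_norm_mono) (auto simp: dist_triangle simp flip: ennreal_plus intro!: ennreal_leI)
  also have "\<dots> \<le> lp_norm M p (\<lambda>x. ennreal (dist a x0)) + lp_norm M p (\<lambda>x. ennreal (dist x0 x))"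
    using assms(1) by (intro lp_norm_add_le) auto
  also have "\<dots> < top" using * assms(1) by (simp add: lp_norm_const ennreal_add_less_top)
  finally show ?thesis .
qed

lemma PpI:
  assumes p: "0 < p" and "sets M = sets (borel_on X)" "prob_space M" "radon_measure M"
    and "a \<in> X" "lp_norm M p (\<lambda>x. ennreal (dist a x)) < top"
  shows "M \<in> Pp p X"
  using assms(2-) unfolding Pp_def lp_norm_less_iff[OF p] by auto

text \<open>On each of the finitely many level sets of \<open>T\<close> this is the distance to a
  fixed point, which is measurable even if \<open>X\<close> is nonseparable.\<close>

lemma borel_measurable_dist_simple:
  fixes T :: "'a::metric_space \<Rightarrow> 'a"
  assumes "simple_function (borel_on X) T"
  shows "(\<lambda>x. dist x (T x)) \<in> borel_measurable (borel_on X)"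
proof (rule measurable_compose_countable'[where g=T and I="T ` X"])
  show "(\<lambda>x. dist x t) \<in> borel_measurable (borel_on X)" for t
    by (intro measurable_restrict_space1 borel_measurable_continuous_onI continuous_intros)
  show "T \<in> measurable (borel_on X) (count_space (T ` X))"
    using measurable_simple_function[OF assms] by (auto simp: measurable_def)
  show "countable (T ` X)"
    using simple_functionD(1)[OF assms] by (auto intro: countable_finite)
qed

lemma exists_simple_approximation:
  assumes p: "1 \<le> p" and M: "M \<in> Pp p X" and e: "0 < e"
  shows "\<exists>T. simple_function (borel_on X) T \<and> T \<in> X \<rightarrow> X \<and> lp_norm M p (\<lambda>x. ennreal (dist x (T x))) < e"
proof -
  have p0: "0 < p" using p by simp
  interpret prob_space M using PpD(3)[OF M] .
  have sM: "sets M = sets (borel_on X)" and spM: "space M = X" using PpD[OF M] by auto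
  have [measurable]: "dist b \<in> borel_measurable M" for b
    by (auto intro: measurable_restrict_space1 simp: measurable_cong_sets[OF sM refl])
  \<comment> \<open>As \<open>e\<close> may be infinite, a real number \<open>r\<close> below its
    p-th power takes over. One half of \<open>r\<close> pays for the points close to a centre, the
    other half for the rest.\<close>
  obtain r where r: "0 < r" "ennreal r \<le> ennpowr e p"
    using e ennpowr_pos_iff[of e p]
    by (metis (full_types) ennreal_cases ennreal_less_zero_iff le_less less_numeral_extra(1) top_greatest)
  obtain D where D: "countable D" "D \<subseteq> X" "AE x in M. x \<in> closure D"
    using PpD(6)[OF M] spM by (auto simp: essentially_separable_def)
  obtain x1 where "x1 \<in> closure D"
    using eventually_happens'[OF ae_filter_bot D(3)] by auto
  then have ne: "D \<noteq> {}" by auto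
  define c where "c = from_nat_into D"
  have cX: "c i \<in> X" for i using D(2) from_nat_into[OF ne, of i] by (auto simp: c_def)
  define \<delta> where "\<delta> = (r / 2) powr (1 / p)"
  have \<delta>: "0 < \<delta>" "\<delta> powr p = r / 2" using r p0 by (auto simp: \<delta>_def powr_powr)
  \<comment> \<open>Among the first \<open>n\<close> centres the last one closer than \<delta> wins.
    A point far from all of them is sent to \<open>c 0\<close>, where its error is part of the
    moment about \<open>c 0\<close>.\<close>
  define T where "T = rec_nat (\<lambda>_. c 0) (\<lambda>n t x. if dist (c n) x < \<delta> then c n else t x)"
  have T0: "T 0 x = c 0" and TS: "T (Suc n) x = (if dist (c n) x < \<delta> then c n else T n x)" for n x
    by (auto simp: T_def)
  have sT: "simple_function (borel_on X) (T n)" for n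
  proof (induction n)
    case 0
    then show ?case by (simp add: T_def)
  next
    case (Suc n)
    have "{x \<in> space M. dist (c n) x < \<delta>} \<in> sets M" by measurable
    then have "{x \<in> space (borel_on X). dist (c n) x < \<delta>} \<in> sets (borel_on X)"
      using sM spM by simp
    then show ?case using Suc unfolding T_def by (auto intro!: simple_function_If)
  qed
  have TX: "T n x \<in> X" for n x by (induction n) (auto simp: T0 TS cX)
  have T_near: "dist (T n x) x < \<delta>" if "i < n" "dist (c i) x < \<delta>" for i n x
    using that by (induction n) (auto simp: TS less_Suc_eq)
  have T_far: "T n x = c 0" if "\<forall>i<n. \<not> dist (c i) x < \<delta>" for n x
    using that by (induction n) (auto simp: T0 TS)
  define A where "A n = {x \<in> space M. \<forall>i<n. \<not> dist (c i) x < \<delta>}" for n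
  have [measurable]: "A n \<in> sets M" for n unfolding A_def by measurable
  have bound: "ennpowr (ennreal (dist x (T n x))) p
      \<le> ennreal (r / 2) + ennpowr (ennreal (dist (c 0) x)) p * indicator (A n) x" if "x \<in> space M" for n x
  proof (cases "x \<in> A n")
    case True
    then show ?thesis by (simp add: A_def T_far dist_commute)
  next
    case False
    then have "dist x (T n x) < \<delta>" using that T_near by (auto simp: A_def dist_commute)
    then have "dist x (T n x) powr p \<le> \<delta> powr p" using p0 by (intro powr_mono2) auto
    then show ?thesis using False \<delta>(2) by (simp add: ennreal_leI)
  qed
  \<comment> \<open>Almost every point has a centre within \<delta> and therefore leaves
    \<open>A n\<close> eventually; the finite moment about \<open>c 0\<close> dominates.\<close>
  have "(\<lambda>n. \<integral>\<^sup>+x. ennpowr (ennreal (dist (c 0) x)) p * indicator (A n) x \<partial>M) \<longlonglongrightarrow> (\<integral>\<^sup>+x. 0 \<partial>M)"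
  proof (rule nn_integral_dominated_convergence[where w="\<lambda>x. ennpowr (ennreal (dist (c 0) x)) p"])
    show "(\<integral>\<^sup>+x. ennpowr (ennreal (dist (c 0) x)) p \<partial>M) < \<infinity>"
      using Pp_moment[OF p M, of "c 0"] unfolding lp_norm_less_iff[OF p0] by simp
    show "AE x in M. ennpowr (ennreal (dist (c 0) x)) p * indicator (A n) x \<le> ennpowr (ennreal (dist (c 0) x)) p" for n
      by (auto split: split_indicator)
    show "AE x in M. (\<lambda>n. ennpowr (ennreal (dist (c 0) x)) p * indicator (A n) x) \<longlonglongrightarrow> 0"
      using D(3)
    proof eventually_elim
      fix x assume "x \<in> closure D"
      then obtain d where "d \<in> D" "dist d x < \<delta>" using \<delta>(1) unfolding closure_approachable by blast
      then obtain i where i: "dist (c i) x < \<delta>" using from_nat_into_surj[OF D(1)] unfolding c_def by metis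
      have "eventually (\<lambda>n. ennpowr (ennreal (dist (c 0) x)) p * indicator (A n) x = 0) sequentially"
        using eventually_gt_at_top[of i] by eventually_elim (use i in \<open>auto simp: A_def indicator_def\<close>)
      then show "(\<lambda>n. ennpowr (ennreal (dist (c 0) x)) p * indicator (A n) x) \<longlonglongrightarrow> 0"
        by (rule tendsto_eventually)
    qed
  qed auto
  then have "eventually (\<lambda>n. (\<integral>\<^sup>+x. ennpowr (ennreal (dist (c 0) x)) p * indicator (A n) x \<partial>M) < ennreal (r / 2)) sequentially"
    using r by (intro order_tendstoD(2)) auto
  then obtain n where n: "(\<integral>\<^sup>+x. ennpowr (ennreal (dist (c 0) x)) p * indicator (A n) x \<partial>M) < ennreal (r / 2)"
    using eventually_happens'[OF sequentially_bot] by blast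
  have "(\<integral>\<^sup>+x. ennpowr (ennreal (dist x (T n x))) p \<partial>M)
      \<le> (\<integral>\<^sup>+x. ennreal (r / 2) + ennpowr (ennreal (dist (c 0) x)) p * indicator (A n) x \<partial>M)"
    by (intro nn_integral_mono bound)
  also have "\<dots> = ennreal (r / 2) + (\<integral>\<^sup>+x. ennpowr (ennreal (dist (c 0) x)) p * indicator (A n) x \<partial>M)"
    by (subst nn_integral_add) (auto simp: emeasure_space_1)
  also have "\<dots> < ennreal (r / 2) + ennreal (r / 2)" using n by (simp add: ennreal_add_left_cancel_less)
  also have "\<dots> = ennreal r" using r by (simp flip: ennreal_plus)
  finally have "lp_norm M p (\<lambda>x. ennreal (dist x (T n x))) < e"
    unfolding lp_norm_less_iff[OF p0] using r(2) by (rule less_le_trans)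
  then show ?thesis using sT TX by blast
qed

section \<open>The triangle inequality\<close>

lemma ennreal_less_add_pos: "x < top \<Longrightarrow> 0 < e \<Longrightarrow> x < x + ennreal e"
  by (cases x) (auto simp: ennreal_less_iff simp flip: ennreal_plus)

text \<open>Given the common label \<open>t\<close>, the two sides are made independent: on each
  cell \<open>A t \<times> B t\<close> the product measure is divided by the common mass
  \<open>c t\<close>, and the density vanishes off the cells. Summing over the finitely many labels
  gives back both marginals.\<close>

lemma exists_gluing:
  assumes "prob_space G" "prob_space H" and R: "finite R"
    and a: "a \<in> measurable G (count_space R)" and b: "b \<in> measurable H (count_space R)"
    and eq: "\<And>t. t \<in> R \<Longrightarrow> emeasure G (a -` {t} \<inter> space G) = emeasure H (b -` {t} \<inter> space H)"
  shows "\<exists>Q. prob_space Q \<and> sets Q = sets (G \<Otimes>\<^sub>M H) \<and> distr Q G fst = G \<and> distr Q H snd = H \<and>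
    (AE w in Q. a (fst w) = b (snd w))"
proof -
  interpret G: prob_space G by fact
  interpret H: prob_space H by fact
  define A where "A t = a -` {t} \<inter> space G" for t
  define B where "B t = b -` {t} \<inter> space H" for t
  define c where "c t = emeasure G (A t)" for t
  have A[measurable]: "A t \<in> sets G" if "t \<in> R" for t using that a by (auto simp: A_def)
  have B[measurable]: "B t \<in> sets H" if "t \<in> R" for t using that b by (auto simp: B_def)
  have cB: "emeasure H (B t) = c t" if "t \<in> R" for t using eq[OF that] by (simp add: c_def A_def B_def)
  define h where "h w = (\<Sum>t\<in>R. indicator (A t \<times> B t) w / c t)" for w
  have h[measurable]: "h \<in> borel_measurable (G \<Otimes>\<^sub>M H)" unfolding h_def by measurable
  define Q where "Q = density (G \<Otimes>\<^sub>M H) h"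
  have Q: "emeasure Q (C \<times> E) = (\<Sum>t\<in>R. emeasure G (A t \<inter> C) * emeasure H (B t \<inter> E) / c t)"
    if [measurable]: "C \<in> sets G" "E \<in> sets H" for C E
  proof -
    have "emeasure Q (C \<times> E) = (\<integral>\<^sup>+w. (\<Sum>t\<in>R. indicator ((A t \<inter> C) \<times> (B t \<inter> E)) w / c t) \<partial>(G \<Otimes>\<^sub>M H))"
      unfolding Q_def by (subst emeasure_density)
        (auto simp: h_def sum_distrib_right intro!: nn_integral_cong sum.cong split: split_indicator)
    also have "\<dots> = (\<Sum>t\<in>R. emeasure (G \<Otimes>\<^sub>M H) ((A t \<inter> C) \<times> (B t \<inter> E)) / c t)"
      by (subst nn_integral_sum) (auto simp: nn_integral_divide intro!: sum.cong)
    finally show ?thesis by (simp add: H.emeasure_pair_measure_Times)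
  qed
  \<comment> \<open>On a cell of mass zero the density is \<infinity>; then \<open>x\<close> is 0 as
    well, and \<open>0 * 0 / 0\<close> is 0 in \<open>ennreal\<close>.\<close>
  have div: "x * c t / c t = x" if "x \<le> c t" for x t
  proof (cases "c t = 0")
    case True
    then show ?thesis using that by simp
  next
    case False
    have "c t < top" by (simp add: c_def G.emeasure_eq_measure)
    then show ?thesis using False by (simp add: ennreal_mult_divide_eq)
  qed
  have sum_G: "(\<Sum>t\<in>R. emeasure G (A t \<inter> C)) = emeasure G C" if [measurable]: "C \<in> sets G" for C
  proof -
    have disj: "disjoint_family_on (\<lambda>t. A t \<inter> C) R" by (auto simp: disjoint_family_on_def A_def)
    have "(\<Sum>t\<in>R. emeasure G (A t \<inter> C)) = emeasure G (\<Union>t\<in>R. A t \<inter> C)"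
      using R disj by (intro sum_emeasure) auto
    also have "(\<Union>t\<in>R. A t \<inter> C) = C"
      using measurable_space[OF a] sets.sets_into_space[OF that] by (auto simp: A_def)
    finally show ?thesis .
  qed
  have sum_H: "(\<Sum>t\<in>R. emeasure H (B t \<inter> C)) = emeasure H C" if [measurable]: "C \<in> sets H" for C
  proof -
    have disj: "disjoint_family_on (\<lambda>t. B t \<inter> C) R" by (auto simp: disjoint_family_on_def B_def)
    have "(\<Sum>t\<in>R. emeasure H (B t \<inter> C)) = emeasure H (\<Union>t\<in>R. B t \<inter> C)"
      using R disj by (intro sum_emeasure) auto
    also have "(\<Union>t\<in>R. B t \<inter> C) = C"
      using measurable_space[OF b] sets.sets_into_space[OF that] by (auto simp: B_def)
    finally show ?thesis .
  qed
  have fst_Q: "fst \<in> measurable Q G" and snd_Q: "snd \<in> measurable Q H" by (auto simp: Q_def)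
  have spQ: "space Q = space G \<times> space H" by (simp add: Q_def space_pair_measure)
  have 1: "distr Q G fst = G"
  proof (rule measure_eqI)
    fix C assume "C \<in> sets (distr Q G fst)"
    then have C[measurable]: "C \<in> sets G" by simp
    have "fst -` C \<inter> space Q = C \<times> space H" using sets.sets_into_space[OF C] by (auto simp: spQ)
    then have "emeasure (distr Q G fst) C = emeasure Q (C \<times> space H)"
      by (simp add: emeasure_distr[OF fst_Q C])
    also have "\<dots> = (\<Sum>t\<in>R. emeasure G (A t \<inter> C))"
    proof (subst Q[OF C sets.top], rule sum.cong[OF refl])
      fix t assume t: "t \<in> R"
      have "B t \<inter> space H = B t" by (auto simp: B_def)
      moreover have "emeasure G (A t \<inter> C) \<le> c t" unfolding c_def using t by (intro emeasure_mono) auto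
      ultimately show "emeasure G (A t \<inter> C) * emeasure H (B t \<inter> space H) / c t = emeasure G (A t \<inter> C)"
        using cB[OF t] div by simp
    qed
    also have "\<dots> = emeasure G C" by (rule sum_G[OF C])
    finally show "emeasure (distr Q G fst) C = emeasure G C" .
  qed simp
  have 2: "distr Q H snd = H"
  proof (rule measure_eqI)
    fix C assume "C \<in> sets (distr Q H snd)"
    then have C[measurable]: "C \<in> sets H" by simp
    have "snd -` C \<inter> space Q = space G \<times> C" using sets.sets_into_space[OF C] by (auto simp: spQ)
    then have "emeasure (distr Q H snd) C = emeasure Q (space G \<times> C)"
      by (simp add: emeasure_distr[OF snd_Q C])
    also have "\<dots> = (\<Sum>t\<in>R. emeasure H (B t \<inter> C))"
    proof (subst Q[OF sets.top C], rule sum.cong[OF refl])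
      fix t assume t: "t \<in> R"
      have "A t \<inter> space G = A t" by (auto simp: A_def)
      moreover have "emeasure H (B t \<inter> C) \<le> c t" unfolding cB[OF t, symmetric] using t by (intro emeasure_mono) auto
      ultimately show "emeasure G (A t \<inter> space G) * emeasure H (B t \<inter> C) / c t = emeasure H (B t \<inter> C)"
        using div by (simp add: c_def[symmetric] mult.commute[of "c t"])
    qed
    also have "\<dots> = emeasure H C" by (rule sum_H[OF C])
    finally show "emeasure (distr Q H snd) C = emeasure H C" .
  qed simp
  have 3: "AE w in Q. a (fst w) = b (snd w)"
    unfolding Q_def AE_density[OF h]
  proof (intro AE_I2 impI)
    fix w assume "0 < h w"
    then have "h w \<noteq> 0" by simp
    then obtain t where "t \<in> R" "indicator (A t \<times> B t) w / c t \<noteq> 0"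
      unfolding h_def by (meson sum.neutral)
    then have "w \<in> A t \<times> B t" by (auto simp: indicator_def split: if_splits)
    then show "a (fst w) = b (snd w)" by (auto simp: A_def B_def)
  qed
  have "prob_space (distr Q G fst)" unfolding 1 by fact
  then have "prob_space Q" by (rule prob_space_distrD[OF fst_Q])
  with 1 2 3 show ?thesis by (intro exI[of _ Q]) (auto simp: Q_def)
qed

lemma wasserstein_dist_triangle:
  assumes p: "1 \<le> p" and M: "M \<in> Pp p X" and L: "L \<in> Pp p X" and N: "N \<in> Pp p X"
  shows "wasserstein_dist p X M N \<le> wasserstein_dist p X M L + wasserstein_dist p X L N"
proof (rule ennreal_le_epsilon)
  let ?W = "wasserstein_dist p X"
  fix e :: real assume fin: "?W M L + ?W L N < top" and e: "0 < e"
  have p0: "0 < p" using p by simp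
  let ?d = "\<lambda>z::'a \<times> 'a. ennreal (dist (fst z) (snd z))"
  \<comment> \<open>There are four errors: the slack of each coupling, and the simple approximation
    of \<open>L\<close>, which is used once for each of the two middle points.\<close>
  have "?W M L < ?W M L + ennreal (e / 4)"
    "?W L N < ?W L N + ennreal (e / 4)"
    using fin e by (auto intro!: ennreal_less_add_pos)
  then obtain G H where G: "G \<in> couplings X M L" "lp_norm G p ?d < ?W M L + ennreal (e / 4)"
    and H: "H \<in> couplings X L N" "lp_norm H p ?d < ?W L N + ennreal (e / 4)"
    unfolding wasserstein_dist_less_iff[OF p0] by blast
  note GD = couplingsD[OF G(1)] and HD = couplingsD[OF H(1)]
  have [measurable_cong]: "sets G = sets (borel_on (X \<times> X))" "sets H = sets (borel_on (X \<times> X))"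
    using GD HD by auto
  have "\<exists>T. simple_function (borel_on X) T \<and> T \<in> X \<rightarrow> X \<and> lp_norm L p (\<lambda>x. ennreal (dist x (T x))) < ennreal (e / 4)"
    using e by (intro exists_simple_approximation[OF p L]) auto
  then obtain T where T: "simple_function (borel_on X) T" "T \<in> X \<rightarrow> X"
    "lp_norm L p (\<lambda>x. ennreal (dist x (T x))) < ennreal (e / 4)" by blast
  have fT: "finite (T ` X)" using simple_functionD(1)[OF T(1)] by simp
  have T_count: "T \<in> measurable (borel_on X) (count_space (T ` X))"
    using measurable_simple_function[OF T(1)] by (auto simp: measurable_def)
  note [measurable] = borel_measurable_dist_simple[OF T(1)]
  have snd_G: "snd \<in> measurable G (borel_on X)" and fst_H: "fst \<in> measurable H (borel_on X)" by measurable
  have fst_G: "fst \<in> measurable G (borel_on X)" and snd_H: "snd \<in> measurable H (borel_on X)" by measurable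
  \<comment> \<open>The couplings are matched only up to a label: both middle coordinates have law
    \<open>L\<close>, so their level sets of \<open>T\<close> have equal mass. After gluing the two
    middle points may differ, but they share their value under \<open>T\<close>.\<close>
  have "\<exists>Q. prob_space Q \<and> sets Q = sets (G \<Otimes>\<^sub>M H) \<and> distr Q G fst = G \<and> distr Q H snd = H \<and>
    (AE w in Q. T (snd (fst w)) = T (fst (snd w)))"
  proof (rule exists_gluing[OF GD(3) HD(3) fT measurable_compose[OF snd_G T_count] measurable_compose[OF fst_H T_count]])
    fix t assume "t \<in> T ` X"
    then have t: "T -` {t} \<inter> X \<in> sets (borel_on X)" using simple_functionD(2)[OF T(1)] by simp
    have "(\<lambda>x. T (snd x)) -` {t} \<inter> space G = snd -` (T -` {t} \<inter> X) \<inter> space G"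
      "(\<lambda>x. T (fst x)) -` {t} \<inter> space H = fst -` (T -` {t} \<inter> X) \<inter> space H"
      using GD(2) HD(2) by auto
    then show "emeasure G ((\<lambda>x. T (snd x)) -` {t} \<inter> space G) = emeasure H ((\<lambda>x. T (fst x)) -` {t} \<inter> space H)"
      using emeasure_distr[OF snd_G t] emeasure_distr[OF fst_H t] GD(5) HD(4) by simp
  qed
  then obtain Q where Q: "prob_space Q" "sets Q = sets (G \<Otimes>\<^sub>M H)" "distr Q G fst = G" "distr Q H snd = H"
    "AE w in Q. T (snd (fst w)) = T (fst (snd w))" by blast
  have [measurable_cong]: "sets Q = sets (G \<Otimes>\<^sub>M H)" by fact
  have fst_Q: "fst \<in> measurable Q G" and snd_Q: "snd \<in> measurable Q H" by measurable
  have norm_fst: "lp_norm Q p (\<lambda>w. \<phi> (fst w)) = lp_norm G p \<phi>" if "\<phi> \<in> borel_measurable G" for \<phi>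
    using lp_norm_distr[OF fst_Q that, of p] unfolding Q(3) by simp
  have norm_snd: "lp_norm Q p (\<lambda>w. \<phi> (snd w)) = lp_norm H p \<phi>" if "\<phi> \<in> borel_measurable H" for \<phi>
    using lp_norm_distr[OF snd_Q that, of p] unfolding Q(4) by simp
  have eT: "(\<lambda>x. ennreal (dist x (T x))) \<in> borel_measurable (borel_on X)" by measurable
  let ?F = "\<lambda>w :: ('a \<times> 'a) \<times> ('a \<times> 'a). fst (fst w)"
  let ?H = "\<lambda>w :: ('a \<times> 'a) \<times> ('a \<times> 'a). snd (snd w)"
  have law_F: "distr Q (borel_on X) ?F = M"
    using distr_distr[OF fst_G fst_Q] Q(3) GD(4) by (simp add: comp_def)
  have law_H: "distr Q (borel_on X) ?H = N"
    using distr_distr[OF snd_H snd_Q] Q(4) HD(5) by (simp add: comp_def)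
  have FQ: "?F \<in> measurable Q (borel_on X)" and HQ: "?H \<in> measurable Q (borel_on X)"
    using measurable_compose[OF fst_Q fst_G] measurable_compose[OF snd_Q snd_H] by auto
  \<comment> \<open>\<open>Q\<close> lives on a product sigma-algebra, for which the pair of outer
    coordinates need not be measurable into \<open>borel_on (X \<times> X)\<close>. The common
    countable set \<open>D1 \<union> D2\<close> makes \<open>wasserstein_dist_le_lp_norm\<close>
    applicable.\<close>
  obtain D1 D2 where D: "countable D1" "countable D2" "AE x in M. x \<in> closure D1" "AE x in N. x \<in> closure D2"
    using PpD(6)[OF M] PpD(6)[OF N] by (auto simp: essentially_separable_def)
  have cl: "closure D1 \<subseteq> closure (D1 \<union> D2)" "closure D2 \<subseteq> closure (D1 \<union> D2)" by (auto intro: closure_mono[THEN subsetD])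
  have pred: "Measurable.pred (borel_on X) (\<lambda>x. x \<in> closure E)" for E
    by (rule measurable_restrict_space1) (simp add: pred_def)
  have "AE w in Q. ?F w \<in> closure D1" "AE w in Q. ?H w \<in> closure D2"
    using D(3,4) unfolding law_F[symmetric] law_H[symmetric]
      AE_distr_iff[OF FQ predE[OF pred]] AE_distr_iff[OF HQ predE[OF pred]] by auto
  then have "AE w in Q. ?F w \<in> closure (D1 \<union> D2)" "AE w in Q. ?H w \<in> closure (D1 \<union> D2)"
    using cl by auto
  then have "?W (distr Q (borel_on X) ?F) (distr Q (borel_on X) ?H)
      \<le> lp_norm Q p (\<lambda>w. ennreal (dist (?F w) (?H w)))"
    using D(1,2) by (intro wasserstein_dist_le_lp_norm[OF p0 Q(1) FQ HQ, of "D1 \<union> D2"]) auto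
  then have "?W M N \<le> lp_norm Q p (\<lambda>w. ennreal (dist (?F w) (?H w)))"
    unfolding law_F law_H .
  also have "\<dots> \<le> lp_norm Q p (\<lambda>w. ?d (fst w) + ((ennreal (dist (snd (fst w)) (T (snd (fst w))))
      + ennreal (dist (fst (snd w)) (T (fst (snd w))))) + ?d (snd w)))"
  proof (rule lp_norm_mono_AE[OF _ p0])
    show "AE w in Q. ennreal (dist (?F w) (?H w)) \<le> ?d (fst w) + ((ennreal (dist (snd (fst w)) (T (snd (fst w))))
      + ennreal (dist (fst (snd w)) (T (fst (snd w))))) + ?d (snd w))"
      using Q(5)
    proof eventually_elim
      fix w :: "('a \<times> 'a) \<times> ('a \<times> 'a)" assume eq: "T (snd (fst w)) = T (fst (snd w))"
      have "dist (?F w) (?H w) \<le> dist (?F w) (snd (fst w)) + dist (snd (fst w)) (?H w)"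
        by (rule dist_triangle)
      also have "dist (snd (fst w)) (?H w) \<le> dist (snd (fst w)) (fst (snd w)) + dist (fst (snd w)) (?H w)"
        by (rule dist_triangle)
      also have "dist (snd (fst w)) (fst (snd w)) \<le> dist (snd (fst w)) (T (snd (fst w))) + dist (fst (snd w)) (T (fst (snd w)))"
        unfolding eq by (rule dist_triangle2)
      finally have "dist (?F w) (?H w) \<le> dist (?F w) (snd (fst w)) + ((dist (snd (fst w)) (T (snd (fst w)))
        + dist (fst (snd w)) (T (fst (snd w)))) + dist (fst (snd w)) (?H w))" by simp
      then show "ennreal (dist (?F w) (?H w)) \<le> ?d (fst w) + ((ennreal (dist (snd (fst w)) (T (snd (fst w))))
      + ennreal (dist (fst (snd w)) (T (fst (snd w))))) + ?d (snd w))"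
        by (simp flip: ennreal_plus add: ennreal_leI)
    qed
  qed
  also have "\<dots> \<le> lp_norm Q p (\<lambda>w. ?d (fst w)) + ((lp_norm Q p (\<lambda>w. ennreal (dist (snd (fst w)) (T (snd (fst w)))))
      + lp_norm Q p (\<lambda>w. ennreal (dist (fst (snd w)) (T (fst (snd w)))))) + lp_norm Q p (\<lambda>w. ?d (snd w)))"
    by (intro order_trans[OF lp_norm_add_le[OF p]] add_left_mono add_right_mono) measurable
  also have "lp_norm Q p (\<lambda>w. ?d (fst w)) = lp_norm G p ?d"
    by (rule norm_fst) measurable
  also have "lp_norm Q p (\<lambda>w. ?d (snd w)) = lp_norm H p ?d"
    by (rule norm_snd) measurable
  also have "lp_norm Q p (\<lambda>w. ennreal (dist (snd (fst w)) (T (snd (fst w))))) = lp_norm L p (\<lambda>x. ennreal (dist x (T x)))"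
    using lp_norm_distr[OF snd_G eT, of p] GD(5) norm_fst[OF measurable_compose[OF snd_G eT]] by simp
  also have "lp_norm Q p (\<lambda>w. ennreal (dist (fst (snd w)) (T (fst (snd w))))) = lp_norm L p (\<lambda>x. ennreal (dist x (T x)))"
    using lp_norm_distr[OF fst_H eT, of p] HD(4) norm_snd[OF measurable_compose[OF fst_H eT]] by simp
  also have "lp_norm G p ?d + ((lp_norm L p (\<lambda>x. ennreal (dist x (T x))) + lp_norm L p (\<lambda>x. ennreal (dist x (T x)))) + lp_norm H p ?d)
     \<le> (?W M L + ennreal (e / 4)) + ((ennreal (e / 4) + ennreal (e / 4)) + (?W L N + ennreal (e / 4)))"
    using G(2) H(2) T(3) by (intro add_mono) auto
  also have "\<dots> = ?W M L + ?W L N + ((ennreal (e / 4) + ennreal (e / 4)) + (ennreal (e / 4) + ennreal (e / 4)))"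
    by (simp add: ac_simps)
  also have "(ennreal (e / 4) + ennreal (e / 4)) + (ennreal (e / 4) + ennreal (e / 4)) = ennreal e"
    using e by (simp flip: ennreal_plus)
  finally show "?W M N \<le> ?W M L + ?W L N + ennreal e" .
qed

section \<open>The Wasserstein algebra of measures\<close>

lemma wasserstein_dist_commute_le:
  assumes "0 < p"
  shows "wasserstein_dist p X N M \<le> wasserstein_dist p X M N"
proof (rule ccontr)
  assume "\<not> ?thesis"
  then have "wasserstein_dist p X M N < wasserstein_dist p X N M" by simp
  then obtain G where G: "G \<in> couplings X M N"
    "lp_norm G p (\<lambda>z. ennreal (dist (fst z) (snd z))) < wasserstein_dist p X N M"
    unfolding wasserstein_dist_less_iff[OF assms] by blast
  note GD = couplingsD[OF G(1)]
  interpret prob_space G by fact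
  have [measurable_cong]: "sets G = sets (borel_on (X \<times> X))" by fact
  have "prod.swap \<in> borel_measurable (borel_on (X \<times> X))"
    by (intro measurable_restrict_space1 borel_measurable_continuous_onI continuous_intros)
  then have "prod.swap \<in> measurable (borel_on (X \<times> X)) (borel_on (X \<times> X))"
    by (auto simp: measurable_restrict_space2_iff)
  then have swap[measurable]: "prod.swap \<in> measurable G (borel_on (X \<times> X))" by measurable
  define H where "H = distr G (borel_on (X \<times> X)) prod.swap"
  have "H \<in> couplings X N M"
    unfolding couplings_def
  proof (intro CollectI conjI)
    show "prob_space H" unfolding H_def by (rule prob_space_distr[OF swap])
    show "distr H (borel_on X) fst = N" "distr H (borel_on X) snd = M"
      unfolding H_def distr_distr[OF measurable_fst_borel_on swap] distr_distr[OF measurable_snd_borel_on swap]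
      using GD(4,5) by (simp_all add: comp_def)
  qed (simp add: H_def)
  then have "wasserstein_dist p X N M \<le> lp_norm H p (\<lambda>z. ennreal (dist (fst z) (snd z)))"
    by (rule wasserstein_dist_le[OF assms])
  also have "\<dots> = lp_norm G p (\<lambda>z. ennreal (dist (fst z) (snd z)))"
    unfolding H_def by (subst lp_norm_distr[OF swap]) (auto simp: dist_commute)
  finally show False using G(2) by simp
qed

lemma wasserstein_dist_commute: "0 < p \<Longrightarrow> wasserstein_dist p X M N = wasserstein_dist p X N M"
  by (intro antisym wasserstein_dist_commute_le)

lemma wasserstein_dist_self:
  assumes "0 < p" "M \<in> Pp p X"
  shows "wasserstein_dist p X M M = 0"
proof -
  note MD = PpD[OF assms(2)]
  obtain D where D: "countable D" "AE x in M. x \<in> closure D"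
    using MD(6) by (auto simp: essentially_separable_def)
  have id: "(\<lambda>x. x) \<in> measurable M (borel_on X)" using MD(1) by (rule measurable_ident_sets)
  have "distr M (borel_on X) (\<lambda>x. x) = M" using MD(1) by (simp add: distr_id2)
  then have "wasserstein_dist p X M M \<le> lp_norm M p (\<lambda>x. ennreal (dist x x))"
    using wasserstein_dist_le_lp_norm[OF assms(1) MD(3) id id D(1) D(2) D(2)] by simp
  then show ?thesis by (simp add: lp_norm_def)
qed

lemma lp_norm_Markov:
  assumes "0 < p" and [measurable]: "f \<in> borel_measurable P"
  shows "emeasure P {x \<in> space P. c \<le> f x} * ennpowr c p \<le> ennpowr (lp_norm P p f) p"
proof -
  have "emeasure P {x \<in> space P. c \<le> f x} * ennpowr c p
      = (\<integral>\<^sup>+x. ennpowr c p * indicator {x \<in> space P. c \<le> f x} x \<partial>P)"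
    by (subst nn_integral_cmult_indicator) (auto simp: mult.commute)
  also have "\<dots> \<le> (\<integral>\<^sup>+x. ennpowr (f x) p \<partial>P)"
    using assms(1) by (intro nn_integral_mono) (auto split: split_indicator)
  finally show ?thesis using assms(1) by (simp add: ennpowr_lp_norm)
qed

text \<open>A coupling of small cost moves almost all mass of a compact \<open>K\<close> to points
  near \<open>K\<close>. Letting the neighbourhoods \<open>A n\<close> shrink to \<open>K\<close>
  compares the two measures on compact sets, and inner regularity of \<open>M\<close> extends this
  to \<open>B\<close>.\<close>

lemma wasserstein_dist_eq_0_imp_le:
  fixes X :: "'a::metric_space set"
  assumes p: "0 < p" and M: "M \<in> Pp p X" and N: "N \<in> Pp p X" and W: "wasserstein_dist p X M N = 0"
    and B: "B \<in> sets M"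
  shows "emeasure M B \<le> emeasure N B"
proof -
  note MD = PpD[OF M] and ND = PpD[OF N]
  interpret M: prob_space M by fact
  interpret N: prob_space N by fact
  have "emeasure M K \<le> emeasure N B" if K: "compact K" "K \<subseteq> B" for K
  proof (cases "K = {}")
    case True
    then show ?thesis by simp
  next
    case False
    have KX: "K \<subseteq> X" using K(2) sets.sets_into_space[OF B] MD(2) by auto
    then have Ks[measurable]: "K \<in> sets (borel_on X)" using K by (intro compact_in_sets_borel_on)
    define A where "A n = {x \<in> X. infdist x K < 1 / Suc n}" for n
    have inf: "(\<lambda>x. infdist x K) \<in> borel_measurable (borel_on X)"
      by (intro measurable_restrict_space1 borel_measurable_continuous_onI continuous_intros)
    then have "{x \<in> space (borel_on X). infdist x K < 1 / Suc n} \<in> sets (borel_on X)" for n by measurable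
    then have A: "A n \<in> sets (borel_on X)" for n by (simp add: A_def)
    have step: "measure M K \<le> measure N (A n) + 1 / Suc n" for n
    proof -
      define e :: real where "e = 1 / Suc n"
      have e: "0 < e" and Ae: "A n = {x \<in> X. infdist x K < e}" by (simp_all add: e_def A_def)
      \<comment> \<open>The p-th power of this bound is \<open>e * e powr p\<close>, so Markov's
        inequality at level \<open>e\<close> leaves exactly mass \<open>e\<close>.\<close>
      have "wasserstein_dist p X M N < ennreal (e * e powr (1 / p))" using e W by simp
      then obtain G where G: "G \<in> couplings X M N"
        "lp_norm G p (\<lambda>z. ennreal (dist (fst z) (snd z))) < ennreal (e * e powr (1 / p))"
        unfolding wasserstein_dist_less_iff[OF p] by blast
      note GD = couplingsD[OF G(1)]
      interpret G: prob_space G by fact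
      have [measurable_cong]: "sets G = sets (borel_on (X \<times> X))" by fact
      let ?Z = "{z \<in> space G. ennreal e \<le> ennreal (dist (fst z) (snd z))}"
      have Z: "?Z \<in> sets G" by measurable
      have fst_G: "fst \<in> measurable G (borel_on X)" and snd_G: "snd \<in> measurable G (borel_on X)" by measurable
      have "emeasure G ?Z * ennpowr (ennreal e) p \<le> ennpowr (lp_norm G p (\<lambda>z. ennreal (dist (fst z) (snd z)))) p"
        by (rule lp_norm_Markov[OF p]) measurable
      also have "\<dots> \<le> ennpowr (ennreal (e * e powr (1 / p))) p"
        using G(2) p by (intro ennpowr_mono) auto
      also have "\<dots> = ennreal (e * e powr p)"
        using e p by (simp add: powr_mult powr_powr)
      finally have "ennreal (measure G ?Z * e powr p) \<le> ennreal (e * e powr p)"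
        using e by (simp add: G.emeasure_eq_measure ennreal_mult)
      then have GZ: "measure G ?Z \<le> e"
        using e by (simp add: ennreal_le_iff)
      have "measure M K = measure G (fst -` K \<inter> space G)"
        using GD(4) measure_distr[OF fst_G Ks] by simp
      also have "\<dots> \<le> measure G ((snd -` A n \<inter> space G) \<union> ?Z)"
      proof (rule G.finite_measure_mono)
        show "fst -` K \<inter> space G \<subseteq> (snd -` A n \<inter> space G) \<union> ?Z"
        proof
          fix z assume z: "z \<in> fst -` K \<inter> space G"
          have zX: "fst z \<in> K" "z \<in> space G" using IntD1[OF z] IntD2[OF z] by (simp_all only: vimage_eq)
          have "snd z \<in> X" using zX(2) unfolding GD(2) mem_Times_iff by (rule conjunct2)
          note zX = zX this
          then have le: "infdist (snd z) K \<le> dist (fst z) (snd z)" by (metis infdist_le dist_commute)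
          show "z \<in> (snd -` A n \<inter> space G) \<union> ?Z"
          proof (cases "e \<le> dist (fst z) (snd z)")
            case True
            then have "z \<in> ?Z" using zX(2) by (simp only: mem_Collect_eq ennreal_leI)
            then show ?thesis by (rule UnI2)
          next
            case False
            then have "snd z \<in> A n" unfolding Ae using le zX(3) by simp
            then show ?thesis using zX(2) by (intro UnI1) simp
          qed
        qed
      qed (use Z measurable_sets[OF snd_G A] in auto)
      also have "\<dots> \<le> measure G (snd -` A n \<inter> space G) + measure G ?Z"
        using Z measurable_sets[OF snd_G A] by (intro measure_Un_le) auto
      also have "measure G (snd -` A n \<inter> space G) = measure N (A n)"
        using GD(5) measure_distr[OF snd_G A] by simp
      finally show ?thesis using GZ by (simp add: e_def)
    qed
    have "(\<lambda>n. measure N (A n)) \<longlonglongrightarrow> measure N (\<Inter>n. A n)"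
    proof (rule N.finite_Lim_measure_decseq)
      show "range A \<subseteq> sets N" using A ND(1) by auto
      show "decseq A"
      proof (rule decseq_SucI, rule subsetI)
        fix n x assume "x \<in> A (Suc n)"
        moreover have "1 / real (Suc (Suc n)) \<le> 1 / real (Suc n)" by (simp add: field_simps)
        ultimately show "x \<in> A n" unfolding A_def by auto
      qed
    qed
    moreover have "(\<Inter>n. A n) = K"
    proof (intro equalityI subsetI)
      fix x assume x: "x \<in> (\<Inter>n. A n)"
      have "infdist x K \<le> 0"
      proof (rule field_le_epsilon)
        fix d :: real assume "0 < d"
        then obtain n where "1 / Suc n < d" using nat_approx_posE by blast
        moreover have "infdist x K < 1 / Suc n" using x by (simp add: A_def)
        ultimately show "infdist x K \<le> 0 + d" by simp
      qed
      then have "infdist x K = 0" using infdist_nonneg[of x K] by simp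
      then show "x \<in> K" using in_closed_iff_infdist_zero[OF compact_imp_closed[OF K(1)] False] by simp
    next
      fix x assume "x \<in> K"
      then show "x \<in> (\<Inter>n. A n)" using KX by (auto simp: A_def)
    qed
    ultimately have "(\<lambda>n. measure N (A n) + 1 / Suc n) \<longlonglongrightarrow> measure N K + 0"
      by (intro tendsto_add LIMSEQ_Suc[OF lim_1_over_n]) auto
    then have "measure M K \<le> measure N K"
      using step by (intro LIMSEQ_le_const[where X="\<lambda>n. measure N (A n) + 1 / Suc n"]) auto
    then have "emeasure M K \<le> emeasure N K" by (simp add: M.emeasure_eq_measure N.emeasure_eq_measure)
    also have "\<dots> \<le> emeasure N B" using K B MD(1) ND(1) by (intro emeasure_mono) auto
    finally show ?thesis .
  qed
  then have "(SUP K\<in>{K. compact K \<and> K \<subseteq> B}. emeasure M K) \<le> emeasure N B" by (intro SUP_least) auto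
  then show ?thesis using MD(4) B by (simp add: radon_measure_def)
qed

lemma extended_metric_space_Pp:
  assumes p: "1 \<le> p"
  shows "extended_metric_space (Pp p X) (wasserstein_dist p X)"
proof
  have p0: "0 < p" using p by simp
  fix M N assume M: "M \<in> Pp p X" and N: "N \<in> Pp p X"
  show "wasserstein_dist p X M N = wasserstein_dist p X N M" by (rule wasserstein_dist_commute[OF p0])
  show "wasserstein_dist p X M N = 0 \<longleftrightarrow> M = N"
  proof
    assume W: "wasserstein_dist p X M N = 0"
    then have W': "wasserstein_dist p X N M = 0" using wasserstein_dist_commute[OF p0] by metis
    have sets: "sets M = sets N" using PpD(1)[OF M] PpD(1)[OF N] by simp
    show "M = N"
    proof (rule measure_eqI[OF sets])
      fix B assume B: "B \<in> sets M"
      then have B': "B \<in> sets N" using sets by simp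
      show "emeasure M B = emeasure N B"
        by (intro antisym wasserstein_dist_eq_0_imp_le[OF p0 M N W B] wasserstein_dist_eq_0_imp_le[OF p0 N M W' B'])
    qed
  qed (use M wasserstein_dist_self[OF p0] in auto)
next
  fix M L N assume "M \<in> Pp p X" "L \<in> Pp p X" "N \<in> Pp p X"
  then show "wasserstein_dist p X M N \<le> wasserstein_dist p X M L + wasserstein_dist p X L N"
    by (rule wasserstein_dist_triangle[OF p])
qed

section \<open>Mixtures and the Wasserstein inequality\<close>

lemma space_mixture [simp]: "space (mixture r M N) = space M"
  by (simp add: sets_eq_imp_space_eq[OF sets_mixture])

lemma nn_integral_mixture:
  assumes sets: "sets N = sets M" and f: "f \<in> borel_measurable M"
  shows "(\<integral>\<^sup>+x. f x \<partial>mixture r M N) = ennreal r * (\<integral>\<^sup>+x. f x \<partial>M) + ennreal (1 - r) * (\<integral>\<^sup>+x. f x \<partial>N)"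
  using f
proof (induction rule: borel_measurable_induct)
  case (cong f g)
  have "(\<integral>\<^sup>+x. f x \<partial>M') = (\<integral>\<^sup>+x. g x \<partial>M')" if "space M' = space M" for M'
    using cong(3) that by (intro nn_integral_cong) auto
  then show ?case using cong(4) sets_eq_imp_space_eq[OF sets] by simp
next
  case (set A)
  then show ?case using sets by (simp add: emeasure_mixture)
next
  case (mult u c)
  then show ?case using sets
    by (simp add: nn_integral_cmult measurable_cong_sets[OF sets refl]
      measurable_cong_sets[OF sets_mixture refl] distrib_left mult.left_commute)
next
  case (add u v)
  then show ?case using sets
    by (simp add: nn_integral_add measurable_cong_sets[OF sets refl]
      measurable_cong_sets[OF sets_mixture refl] distrib_left add_ac)
next
  case (seq U)
  have m: "U i \<in> borel_measurable M" "U i \<in> borel_measurable N" "U i \<in> borel_measurable (mixture r M N)" for i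
    using seq(1) by (auto simp: measurable_cong_sets[OF sets refl] measurable_cong_sets[OF sets_mixture refl])
  have inc: "incseq (\<lambda>i. c * (\<integral>\<^sup>+x. U i x \<partial>M'))" for c M'
    using seq(3) by (auto simp: incseq_def le_fun_def intro!: mult_left_mono nn_integral_mono)
  have conv: "(\<integral>\<^sup>+x. (SUP i. U i x) \<partial>M') = (SUP i. (\<integral>\<^sup>+x. U i x \<partial>M'))"
    if "\<And>i. U i \<in> borel_measurable M'" for M'
    using nn_integral_monotone_convergence_SUP[OF seq(3) that] by simp
  show ?case
    by (simp add: conv m seq SUP_mult_left_ennreal ennreal_SUP_add[OF inc inc] image_comp)
qed

lemma distr_mixture:
  assumes "sets N = sets M" and f: "f \<in> measurable M K"
  shows "distr (mixture r M N) K f = mixture r (distr M K f) (distr N K f)"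
proof (rule measure_eqI)
  have fN: "f \<in> measurable N K" and fm: "f \<in> measurable (mixture r M N) K"
    using f by (simp_all add: measurable_cong_sets[OF assms(1) refl] measurable_cong_sets[OF sets_mixture refl])
  fix B assume "B \<in> sets (distr (mixture r M N) K f)"
  then have B: "B \<in> sets K" by simp
  then show "emeasure (distr (mixture r M N) K f) B = emeasure (mixture r (distr M K f) (distr N K f)) B"
    using measurable_sets[OF f B] sets_eq_imp_space_eq[OF assms(1)] assms(1)
    by (simp add: emeasure_distr[OF f] emeasure_distr[OF fN] emeasure_distr[OF fm] emeasure_mixture)
qed simp

lemma prob_space_mixture:
  assumes "r \<in> {0..1}" "sets N = sets M" "prob_space M" "prob_space N"
  shows "prob_space (mixture r M N)"
proof
  interpret M: prob_space M by fact
  interpret N: prob_space N by fact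
  show "emeasure (mixture r M N) (space (mixture r M N)) = 1"
    using assms(1,2) N.emeasure_space_1 sets_eq_imp_space_eq[OF assms(2)]
    by (simp add: emeasure_mixture M.emeasure_space_1 flip: ennreal_plus)
qed

lemma measure_mixture:
  assumes "r \<in> {0..1}" "sets N = sets M" "finite_measure M" "finite_measure N" "B \<in> sets M"
  shows "measure (mixture r M N) B = r * measure M B + (1 - r) * measure N B"
proof -
  interpret M: finite_measure M by fact
  interpret N: finite_measure N by fact
  show ?thesis using assms(1,2,5) unfolding measure_def
    by (simp add: emeasure_mixture M.emeasure_eq_measure N.emeasure_eq_measure flip: ennreal_plus ennreal_mult)
qed

lemma lp_norm_mixture:
  assumes "0 < p" "sets N = sets M" and [measurable]: "f \<in> borel_measurable M"
  shows "ennpowr (lp_norm (mixture r M N) p f) p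
    = ennreal r * ennpowr (lp_norm M p f) p + ennreal (1 - r) * ennpowr (lp_norm N p f) p"
  using assms(1) by (simp add: ennpowr_lp_norm nn_integral_mixture[OF assms(2)])

lemma mixture_1: "sets N = sets M \<Longrightarrow> mixture 1 M N = M"
  by (rule measure_eqI) (auto simp: emeasure_mixture)

lemma mixture_0: "sets N = sets M \<Longrightarrow> mixture 0 M N = N"
  by (rule measure_eqI) (auto simp: emeasure_mixture)

lemma borel_measurable_dist_Pp:
  "sets M = sets (borel_on X) \<Longrightarrow> (\<lambda>x. ennreal (dist a x)) \<in> borel_measurable M"
  by (subst measurable_cong_sets[OF _ refl]) (auto intro!: measurable_restrict_space1)

lemma mixture_in_Pp:
  assumes p: "1 \<le> p" and r: "r \<in> {0..1}" and M: "M \<in> Pp p X" and N: "N \<in> Pp p X"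
  shows "mixture r M N \<in> Pp p X"
proof -
  have p0: "0 < p" using p by simp
  note MD = PpD[OF M] and ND = PpD[OF N]
  have sets: "sets N = sets M" using MD ND by simp
  interpret Q: prob_space "mixture r M N" using prob_space_mixture[OF r sets MD(3) ND(3)] .
  obtain a where a: "a \<in> X" using M by (auto simp: Pp_def)
  show ?thesis
  proof (rule PpI[OF p0 _ Q.prob_space_axioms _ a])
    show "sets (mixture r M N) = sets (borel_on X)" using MD by simp
    show "radon_measure (mixture r M N)"
    proof (rule radon_measureI)
      fix B and e :: real assume B: "B \<in> sets (mixture r M N)" and e: "0 < e"
      \<comment> \<open>The union of a compact set for \<open>M\<close> and one for \<open>N\<close>
        leaves at most \<open>e\<close> under both measures, hence under the mixture.\<close>
      obtain K where K: "compact K" "K \<subseteq> B" "K \<in> sets M" "measure M (B - K) \<le> e"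
        using radon_measureD[OF MD(5,1,4) _ e, of B] B by auto
      obtain L where L: "compact L" "L \<subseteq> B" "L \<in> sets N" "measure N (B - L) \<le> e"
        using radon_measureD[OF ND(5,1,4) _ e, of B] B sets by auto
      have s: "B - (K \<union> L) \<in> sets M" "B \<in> sets M" "L \<in> sets M" using B K L sets by auto
      have "measure M (B - (K \<union> L)) \<le> e"
        using K s by (intro order_trans[OF finite_measure.finite_measure_mono[OF MD(5)] K(4)]) auto
      moreover have "measure N (B - (K \<union> L)) \<le> e"
        using L s sets by (intro order_trans[OF finite_measure.finite_measure_mono[OF ND(5)] L(4)]) auto
      ultimately have "measure (mixture r M N) (B - (K \<union> L)) \<le> r * e + (1 - r) * e"
        unfolding measure_mixture[OF r sets MD(5) ND(5) s(1)] using r by (intro add_mono mult_left_mono) auto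
      then have "measure (mixture r M N) (B - (K \<union> L)) \<le> e" by (simp add: algebra_simps)
      then show "\<exists>K. compact K \<and> K \<subseteq> B \<and> K \<in> sets (mixture r M N) \<and> measure (mixture r M N) (B - K) \<le> e"
        using K L s by (intro exI[of _ "K \<union> L"]) auto
    qed (rule Q.finite_measure_axioms)
    have "ennpowr (lp_norm (mixture r M N) p (\<lambda>x. ennreal (dist a x))) p < top"
      unfolding lp_norm_mixture[OF p0 sets borel_measurable_dist_Pp[OF MD(1)]]
      using Pp_moment[OF p M] Pp_moment[OF p N] by (simp add: ennreal_add_less_top ennreal_mult_less_top)
    then show "lp_norm (mixture r M N) p (\<lambda>x. ennreal (dist a x)) < top" by simp
  qed
qed

lemma mixture_in_couplings:
  assumes r: "r \<in> {0..1}" and G: "G \<in> couplings X M M'" and H: "H \<in> couplings X N N'"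
  shows "mixture r G H \<in> couplings X (mixture r M N) (mixture r M' N')"
proof -
  note GD = couplingsD[OF G] and HD = couplingsD[OF H]
  have sets: "sets H = sets G" using GD HD by simp
  have m: "fst \<in> measurable G (borel_on X)" "snd \<in> measurable G (borel_on X)"
    by (auto simp: measurable_cong_sets[OF GD(1) refl])
  show ?thesis
    unfolding couplings_def
    using prob_space_mixture[OF r sets GD(3) HD(3)] GD HD
    by (auto simp: distr_mixture[OF sets m(1)] distr_mixture[OF sets m(2)])
qed

lemma wasserstein_dist_mixture_le:
  assumes p: "1 \<le> p" and r: "r \<in> {0..1}"
    and M: "M \<in> Pp p X" "M' \<in> Pp p X" and N: "N \<in> Pp p X" "N' \<in> Pp p X"
  shows "ennpowr (wasserstein_dist p X (mixture r M N) (mixture r M' N')) p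
    \<le> ennreal r * ennpowr (wasserstein_dist p X M M') p + ennreal (1 - r) * ennpowr (wasserstein_dist p X N N') p"
proof -
  let ?W = "wasserstein_dist p X"
  have p0: "0 < p" using p by simp
  have sets: "sets N = sets M" "sets N' = sets M'" using PpD(1) M N by metis+
  let ?d = "\<lambda>z::'a \<times> 'a. ennreal (dist (fst z) (snd z))"
  \<comment> \<open>At the endpoints the distance with weight zero may be infinite, so finiteness of
    the weighted sum gives finiteness of both distances only for \<open>r\<close> strictly between 0
    and 1. There near-optimal couplings are mixed.\<close>
  consider "r = 0" | "r = 1" | "0 < r" "r < 1" using r by fastforce
  then show ?thesis
  proof cases
    case 3
    show ?thesis
    proof (rule ennreal_le_epsilon)
      fix e :: real
      assume "ennreal r * ennpowr (?W M M') p + ennreal (1 - r) * ennpowr (?W N N') p < top"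
        and e: "0 < e"
      then have "ennpowr (?W M M') p < top" "ennpowr (?W N N') p < top"
        using 3 by (auto simp: ennreal_add_less_top ennreal_mult_less_top)
      then have "ennpowr (?W M M') p < ennpowr (?W M M') p + ennreal e"
        "ennpowr (?W N N') p < ennpowr (?W N N') p + ennreal e"
        using e by (intro ennreal_less_add_pos; simp)+
      then have *: "(INF G\<in>couplings X M M'. ennpowr (lp_norm G p ?d) p) < ennpowr (?W M M') p + ennreal e"
        "(INF G\<in>couplings X N N'. ennpowr (lp_norm G p ?d) p) < ennpowr (?W N N') p + ennreal e"
        by (simp_all only: wasserstein_dist_eq[OF p0, symmetric])
      obtain G where G: "G \<in> couplings X M M'"
          "ennpowr (lp_norm G p ?d) p < ennpowr (?W M M') p + ennreal e"
        using *(1) unfolding INF_less_iff by blast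
      obtain H where H: "H \<in> couplings X N N'"
          "ennpowr (lp_norm H p ?d) p < ennpowr (?W N N') p + ennreal e"
        using *(2) unfolding INF_less_iff by blast
      have sGH: "sets H = sets G" using couplingsD(1)[OF G(1)] couplingsD(1)[OF H(1)] by simp
      have [measurable]: "?d \<in> borel_measurable G"
        by (subst measurable_cong_sets[OF couplingsD(1)[OF G(1)] refl]) measurable
      have "ennpowr (?W (mixture r M N) (mixture r M' N')) p \<le> ennpowr (lp_norm (mixture r G H) p ?d) p"
        using p0 wasserstein_dist_le[OF p0 mixture_in_couplings[OF r G(1) H(1)]] by simp
      also have "\<dots> = ennreal r * ennpowr (lp_norm G p ?d) p + ennreal (1 - r) * ennpowr (lp_norm H p ?d) p"
        by (rule lp_norm_mixture[OF p0 sGH]) measurable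
      also have "\<dots> \<le> ennreal r * (ennpowr (?W M M') p + ennreal e)
          + ennreal (1 - r) * (ennpowr (?W N N') p + ennreal e)"
        using G(2) H(2) by (intro add_mono mult_left_mono) auto
      also have "\<dots> = ennreal r * ennpowr (?W M M') p + ennreal (1 - r) * ennpowr (?W N N') p
          + (ennreal r * ennreal e + ennreal (1 - r) * ennreal e)"
        by (simp add: distrib_left ac_simps)
      also have "ennreal r * ennreal e + ennreal (1 - r) * ennreal e = ennreal e"
        using 3 e by (simp add: algebra_simps flip: ennreal_mult ennreal_plus)
      finally show "ennpowr (?W (mixture r M N) (mixture r M' N')) p
        \<le> ennreal r * ennpowr (?W M M') p + ennreal (1 - r) * ennpowr (?W N N') p + ennreal e" .
    qed
  qed (simp_all add: mixture_0 mixture_1 sets)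
qed

lemma barycentric_algebra_Pp:
  assumes p: "1 \<le> p"
  shows "barycentric_algebra (Pp p X) mixture"
proof
  show "mixture r M N \<in> Pp p X" if "r \<in> {0..1}" "M \<in> Pp p X" "N \<in> Pp p X" for r M N
    using that by (rule mixture_in_Pp[OF p])
  show "mixture 1 M N = M" if "M \<in> Pp p X" "N \<in> Pp p X" for M N
    using that by (intro mixture_1) (simp add: PpD)
  show "mixture r M M = M" if "r \<in> {0..1}" "M \<in> Pp p X" for r M
    using that by (intro measure_eqI) (auto simp: emeasure_mixture simp flip: distrib_right ennreal_plus)
  show "mixture r M N = mixture (1 - r) N M" if "r \<in> {0..1}" "M \<in> Pp p X" "N \<in> Pp p X" for r M N
  proof -
    have "sets N = sets M" using that by (simp add: PpD)
    then show ?thesis by (intro measure_eqI) (auto simp: emeasure_mixture add.commute)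
  qed
  show "mixture r (mixture s K L) M = mixture (s * r) K (mixture ((r - s * r) / (1 - s * r)) L M)"
    if s: "s \<in> {0..<1}" and r: "r \<in> {0..<1}" and "K \<in> Pp p X" "L \<in> Pp p X" "M \<in> Pp p X" for s r K L M
  proof (rule measure_eqI)
    have [simp]: "sets L = sets K" "sets M = sets K" using that by (auto simp: PpD)
    fix B assume "B \<in> sets (mixture r (mixture s K L) M)"
    then have B: "B \<in> sets K" by simp
    define t where "t = (r - s * r) / (1 - s * r)"
    have sr: "s * r < 1" using s r mult_strict_mono[of s 1 r 1] by (cases "s = 0 \<or> r = 0") auto
    have t: "0 \<le> t" "t \<le> 1" "(1 - s * r) * t = r * (1 - s)" "(1 - s * r) * (1 - t) = 1 - r"
      using sr s r mult_left_le[of s r] by (auto simp: t_def field_simps)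
    \<comment> \<open>On both sides \<open>K\<close>, \<open>L\<close> and \<open>M\<close> receive
      the weights \<open>s * r\<close>, \<open>r * (1 - s)\<close> and \<open>1 - r\<close>.\<close>
    have e: "ennreal (r * s) = ennreal (s * r)" "ennreal (r * (1 - s)) = ennreal (1 - s * r) * ennreal t"
        "ennreal (1 - r) = ennreal (1 - s * r) * ennreal (1 - t)"
      using t sr by (simp_all add: mult.commute flip: ennreal_mult)
    have "emeasure (mixture r (mixture s K L) M) B
        = ennreal (r * s) * emeasure K B + ennreal (r * (1 - s)) * emeasure L B + ennreal (1 - r) * emeasure M B"
      using B s r by (simp add: emeasure_mixture distrib_left ennreal_mult mult.assoc)
    also have "\<dots> = emeasure (mixture (s * r) K (mixture t L M)) B"
      unfolding e using B by (simp add: emeasure_mixture distrib_left mult.assoc add.assoc)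
    finally show "emeasure (mixture r (mixture s K L) M) B
        = emeasure (mixture (s * r) K (mixture ((r - s * r) / (1 - s * r)) L M)) B" by (simp add: t_def)
  qed simp
qed

lemma extended_metric_wasserstein_algebra_Pp:
  assumes p: "1 \<le> p"
  shows "extended_metric_wasserstein_algebra p (Pp p X) (wasserstein_dist p X) mixture"
proof -
  let ?W = "wasserstein_dist p X"
  have p0: "0 < p" using p by simp
  interpret extended_metric_space "Pp p X" "wasserstein_dist p X" by (rule extended_metric_space_Pp[OF p])
  interpret barycentric_algebra "Pp p X" mixture by (rule barycentric_algebra_Pp[OF p])
  show ?thesis
  proof
    fix r :: real and M M' N N'
    assume r: "r \<in> {0..1}" and P: "M \<in> Pp p X" "M' \<in> Pp p X" "N \<in> Pp p X" "N' \<in> Pp p X"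
    let ?m = "max (?W M M') (?W N N')"
    show le: "ennpowr (?W (mixture r M N) (mixture r M' N')) p
      \<le> ennreal r * ennpowr (?W M M') p + ennreal (1 - r) * ennpowr (?W N N') p"
      by (rule wasserstein_dist_mixture_le[OF p r P])
    also have "\<dots> \<le> ennreal r * ennpowr ?m p + ennreal (1 - r) * ennpowr ?m p"
      using p0 by (intro add_mono mult_left_mono ennpowr_mono) auto
    also have "\<dots> = ennpowr ?m p"
      using r by (simp flip: distrib_right ennreal_plus)
    finally show "?W (mixture r M N) (mixture r M' N') \<le> ?m"
      using p0 by simp
  qed
qed

section \<open>Realising couplings on the unit interval\<close>

text \<open>Atomless and Radon, hence able to carry any sequence of finite couplings. Its space is
  the whole real line, with the mass on the unit interval, which is why functions on it are
  controlled through \<open>range\<close>.\<close>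

abbreviation unit_lebesgue :: "real measure" where
  "unit_lebesgue \<equiv> uniform_measure lborel {0..1}"

lemma prob_space_unit_lebesgue: "prob_space unit_lebesgue"
  by (rule prob_space_uniform_measure) auto

lemma unit_lebesgue_inner:
  assumes "A \<in> sets unit_lebesgue" "0 < e"
  shows "\<exists>K. compact K \<and> K \<subseteq> A \<and> K \<in> sets unit_lebesgue \<and> measure unit_lebesgue (A - K) \<le> e"
proof -
  interpret prob_space unit_lebesgue by (rule prob_space_unit_lebesgue)
  have "radon_measure unit_lebesgue"
    unfolding radon_measure_def
    using inner_regular[of unit_lebesgue] by (simp add: conj_commute emeasure_finite)
  then show ?thesis
    using assms by (intro radon_measureD[where X=UNIV]) (auto simp: finite_measure_axioms sets_restrict_space)
qed

text \<open>Absence of atoms: the mass of \<open>A\<close> to the left of \<open>s\<close> is a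
  1-Lipschitz function of \<open>s\<close> that runs from 0 to the measure of \<open>A\<close>, so
  it takes the value \<open>c\<close>.\<close>

lemma unit_lebesgue_subset_measure:
  assumes A: "A \<in> sets unit_lebesgue" and c: "0 \<le> c" "c \<le> measure unit_lebesgue A"
  shows "\<exists>B\<in>sets unit_lebesgue. B \<subseteq> A \<and> measure unit_lebesgue B = c"
proof -
  let ?U = unit_lebesgue
  interpret prob_space unit_lebesgue by (rule prob_space_unit_lebesgue)
  define F where "F s = measure ?U (A \<inter> {..s})" for s :: real
  have A': "A \<in> sets borel" using A by simp
  have mono: "F s \<le> F t" and lip: "F t - F s \<le> t - s" if "s \<le> t" for s t
  proof -
    show "F s \<le> F t" unfolding F_def using that A' by (intro finite_measure_mono) auto
    have "F t \<le> measure ?U ((A \<inter> {..s}) \<union> {s<..t})"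
      unfolding F_def using that A' by (intro finite_measure_mono) auto
    also have "\<dots> \<le> F s + measure ?U {s<..t}"
      unfolding F_def using A' by (intro measure_Un_le) auto
    also have "measure ?U {s<..t} = measure lborel ({0..1} \<inter> {s<..t})"
      by (subst measure_uniform_measure) auto
    also have "\<dots> \<le> measure lborel {s<..t}"
      using that by (intro measure_mono_fmeasurable) (auto simp: fmeasurable_def)
    also have "\<dots> = t - s" using that by simp
    finally show "F t - F s \<le> t - s" by simp
  qed
  have "continuous_on {0..1} F"
    unfolding continuous_on_iff
  proof (intro ballI allI impI)
    fix s e :: real assume "0 < e"
    have "dist (F t) (F s) < e" if "dist t s < e" for t
      using mono[of s t] mono[of t s] lip[of s t] lip[of t s] that by (cases "s \<le> t") (auto simp: dist_real_def)
    then show "\<exists>d>0. \<forall>t\<in>{0..1}. dist t s < d \<longrightarrow> dist (F t) (F s) < e" using \<open>0 < e\<close> by blast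
  qed
  moreover have "F 0 = 0"
  proof -
    have "F 0 = measure lborel ({0..1} \<inter> (A \<inter> {..0})) / measure lborel {0..1::real}"
      unfolding F_def using A' by (intro measure_uniform_measure) auto
    also have "measure lborel ({0..1} \<inter> (A \<inter> {..0})) \<le> measure lborel {0..0::real}"
      by (intro measure_mono_fmeasurable) (use A' in \<open>auto simp: fmeasurable_def\<close>)
    finally show ?thesis by (simp add: F_def antisym)
  qed
  moreover have "F 1 = measure ?U A"
  proof -
    have "measure ?U {..1} = 1" by (subst measure_uniform_measure) (auto simp: Int_absorb2)
    then have "AE x in ?U. x \<in> {..1}" by (intro AE_prob_1)
    then show ?thesis unfolding F_def using A' by (intro measure_eq_AE) auto
  qed
  ultimately obtain s where "F s = c" using IVT'[of F 0 c 1] c by auto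
  then show ?thesis using A' by (intro bexI[of _ "A \<inter> {..s}"]) (auto simp: F_def)
qed

text \<open>Pieces are carved off one at a time; what is left of \<open>A\<close> still has room for
  the remaining weights.\<close>

lemma unit_lebesgue_disjoint_subsets:
  assumes "finite T" "A \<in> sets unit_lebesgue" "\<And>t. t \<in> T \<Longrightarrow> 0 \<le> w t" "sum w T \<le> measure unit_lebesgue A"
  shows "\<exists>P. (\<forall>t\<in>T. P t \<in> sets unit_lebesgue \<and> P t \<subseteq> A \<and> measure unit_lebesgue (P t) = w t) \<and> disjoint_family_on P T"
  using assms
proof (induction T arbitrary: A)
  case empty
  then show ?case by (auto simp: disjoint_family_on_def)
next
  case (insert t T)
  interpret prob_space unit_lebesgue by (rule prob_space_unit_lebesgue)
  have nn: "0 \<le> w t" "0 \<le> sum w T" using insert.prems by (auto intro: sum_nonneg)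
  have le: "w t + sum w T \<le> measure unit_lebesgue A" using insert by simp
  then obtain B where B: "B \<in> sets unit_lebesgue" "B \<subseteq> A" "measure unit_lebesgue B = w t"
    using unit_lebesgue_subset_measure[OF insert.prems(1), of "w t"] nn by auto
  have "measure unit_lebesgue (A - B) = measure unit_lebesgue A - w t"
    using B insert.prems(1) by (subst finite_measure_Diff) auto
  then obtain P where P: "\<forall>t\<in>T. P t \<in> sets unit_lebesgue \<and> P t \<subseteq> A - B \<and> measure unit_lebesgue (P t) = w t"
    "disjoint_family_on P T"
  proof -
    have "A - B \<in> sets unit_lebesgue" using insert.prems(1) B(1) by (rule sets.Diff)
    moreover have "sum w T \<le> measure unit_lebesgue (A - B)"
      using le \<open>measure unit_lebesgue (A - B) = measure unit_lebesgue A - w t\<close> by linarith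
    ultimately show ?thesis using insert.IH[of "A - B"] insert.prems(2) that by blast
  qed
  have eq: "(P(t := B)) s = P s" if "s \<in> T" for s using that insert.hyps by auto
  show ?case
  proof (intro exI conjI)
    show "\<forall>s\<in>insert t T. (P(t := B)) s \<in> sets unit_lebesgue \<and> (P(t := B)) s \<subseteq> A
        \<and> measure unit_lebesgue ((P(t := B)) s) = w s"
      using P(1) B by auto
    show "disjoint_family_on (P(t := B)) (insert t T)"
      using P insert.hyps by (subst disjoint_family_on_insert) (auto simp: disjoint_family_on_def)
  qed
qed

lemma exists_simple_function_on_partition:
  assumes "finite I" "\<And>i. i \<in> I \<Longrightarrow> Q i \<in> sets M" "disjoint_family_on Q I"
  shows "\<exists>f. simple_function M f \<and> (\<forall>i\<in>I. \<forall>w\<in>Q i. f w = c i) \<and> range f \<subseteq> insert d (c ` I)"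
  using assms
proof (induction I)
  case empty
  then show ?case by (intro exI[of _ "\<lambda>_. d"]) auto
next
  case (insert i I)
  then obtain f where f: "simple_function M f" "\<forall>i\<in>I. \<forall>w\<in>Q i. f w = c i" "range f \<subseteq> insert d (c ` I)"
    by (auto simp: disjoint_family_on_insert)
  have disj: "Q i \<inter> Q j = {}" if "j \<in> I" for j
    using insert.prems(2) insert.hyps that by (auto simp: disjoint_family_on_def)
  have sf: "simple_function M (\<lambda>w. if w \<in> Q i then c i else f w)"
    by (rule simple_function_If_set) (use f insert.prems sets.sets_into_space[of "Q i" M] in \<open>auto simp: Int_absorb2\<close>)
  show ?case
  proof (intro exI conjI ballI)
    fix j w assume "j \<in> insert i I" "w \<in> Q j"
    then show "(if w \<in> Q i then c i else f w) = c j" using f(2) disj[of j] by (cases "j = i") auto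
  next
    show "range (\<lambda>w. if w \<in> Q i then c i else f w) \<subseteq> insert d (c ` insert i I)" using f(3) by auto
  qed (rule sf)
qed

text \<open>An inequality on atoms is enough: it gives \<open>G \<le> H\<close> on all sets, and
  equality of total masses turns the inequality for complements into the converse.\<close>

lemma measure_eqI_finite_atoms:
  assumes "prob_space G" "prob_space H" and sets: "sets H = sets G" and F: "finite F" "F \<subseteq> space G"
    and single: "\<And>z. z \<in> F \<Longrightarrow> {z} \<in> sets G" and AE: "AE z in G. z \<in> F"
    and le: "\<And>z. z \<in> F \<Longrightarrow> measure G {z} \<le> measure H {z}"
  shows "H = G"
proof -
  interpret G: prob_space G by fact
  interpret H: prob_space H by fact
  have Fs: "E \<in> sets G" if "E \<subseteq> F" for E
  proof -
    have "(\<Union>z\<in>E. {z}) \<in> sets G" using that F single by (intro sets.finite_UN) (auto intro: finite_subset)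
    then show ?thesis by simp
  qed
  have mono: "measure G B \<le> measure H B" if B: "B \<in> sets G" for B
  proof -
    have BF: "finite (B \<inter> F)" using F by simp
    have "measure G B = measure G (B \<inter> F)"
      using AE B Fs by (intro measure_eq_AE) auto
    also have "\<dots> = (\<Sum>z\<in>B \<inter> F. measure G {z})"
      using single by (intro G.finite_measure_eq_sum_singleton BF) auto
    also have "\<dots> \<le> (\<Sum>z\<in>B \<inter> F. measure H {z})" by (intro sum_mono le) auto
    also have "\<dots> = measure H (B \<inter> F)"
      using single sets by (intro H.finite_measure_eq_sum_singleton[symmetric] BF) auto
    also have "\<dots> \<le> measure H B" using B sets by (intro H.finite_measure_mono) auto
    finally show ?thesis .
  qed
  have sp: "space H = space G" by (rule sets_eq_imp_space_eq[OF sets])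
  show ?thesis
  proof (rule measure_eqI[OF sets])
    fix B assume "B \<in> sets H"
    then have B: "B \<in> sets G" "B \<in> sets H" using sets by auto
    have "measure G (space G - B) \<le> measure H (space H - B)"
      using mono[of "space G - B"] B sp by auto
    then have "measure H B \<le> measure G B"
      using G.prob_compl[OF B(1)] H.prob_compl[OF B(2)] by simp
    then show "emeasure H B = emeasure G B"
      using mono[OF B(1)] by (simp add: G.emeasure_eq_measure H.emeasure_eq_measure)
  qed
qed

lemma measurable_simple_function_borel_on:
  assumes "simple_function P Y" "Y \<in> space P \<rightarrow> X"
  shows "Y \<in> measurable P (borel_on X)"
  using assms by (auto simp: measurable_restrict_space2_iff dest: borel_measurable_simple_function)

text \<open>\<open>Y\<close> is kept and a second variable is added, so couplings can be chained on
  one space. The fibre of \<open>Y\<close> over \<open>s\<close> has the mass that \<open>G\<close>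
  gives to pairs starting in \<open>s\<close>, which leaves room for disjoint pieces of mass
  \<open>measure G {(s, t)}\<close>; \<open>Z\<close> equals \<open>t\<close> on them.\<close>

lemma exists_coupled_simple_function:
  fixes X :: "'a::metric_space set"
  assumes Y: "simple_function unit_lebesgue Y" "range Y \<subseteq> X"
    and G: "prob_space G" "sets G = sets (borel_on (X \<times> X))"
    and law: "distr unit_lebesgue (borel_on X) Y = distr G (borel_on X) fst"
    and R: "finite R" "R \<subseteq> X" "AE z in G. snd z \<in> R"
  shows "\<exists>Z. simple_function unit_lebesgue Z \<and> range Z \<subseteq> X \<and>
    distr unit_lebesgue (borel_on (X \<times> X)) (\<lambda>w. (Y w, Z w)) = G"
proof -
  let ?U = unit_lebesgue
  interpret U: prob_space unit_lebesgue by (rule prob_space_unit_lebesgue)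
  interpret G: prob_space G by fact
  have spG: "space G = X \<times> X" using sets_eq_imp_space_eq[OF G(2)] by simp
  have fst_G: "fst \<in> measurable G (borel_on X)" by (simp add: measurable_cong_sets[OF G(2) refl])
  have YU: "Y \<in> measurable ?U (borel_on X)"
    by (rule measurable_simple_function_borel_on[OF Y(1)]) (use Y(2) in auto)
  define S where "S = range Y"
  have S: "finite S" "S \<subseteq> X" using simple_functionD(1)[OF Y(1)] Y(2) by (auto simp: S_def)
  have single: "{x} \<in> sets (borel_on X)" if "x \<in> X" for x
    using that by (intro compact_in_sets_borel_on) auto
  have single2: "{z} \<in> sets G" if "z \<in> X \<times> X" for z
    unfolding G(2) using that by (intro compact_in_sets_borel_on) auto
  define A where "A s = Y -` {s}" for s
  have A: "A s \<in> sets ?U" for s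
    using simple_functionD(2)[OF Y(1), of "{s}"] by (simp add: A_def)
  have mA: "measure ?U (A s) = measure G (fst -` {s} \<inter> space G)" if "s \<in> X" for s
    using measure_distr[OF YU single[OF that]] measure_distr[OF fst_G single[OF that]] law
    by (simp add: A_def)
  have sum: "(\<Sum>t\<in>R. measure G {(s, t)}) \<le> measure ?U (A s)" if s: "s \<in> S" for s
  proof -
    have sX: "s \<in> X" using s S by auto
    have "(\<Sum>t\<in>R. measure G {(s, t)}) = (\<Sum>z\<in>Pair s ` R. measure G {z})"
      by (subst sum.reindex) (auto simp: inj_on_def)
    also have "\<dots> = measure G (Pair s ` R)"
      using R sX by (intro G.finite_measure_eq_sum_singleton[symmetric] single2) auto
    also have "\<dots> \<le> measure G (fst -` {s} \<inter> space G)"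
      using R sX by (intro G.finite_measure_mono measurable_sets[OF fst_G single]) (auto simp: spG)
    finally show ?thesis using mA[OF sX] by simp
  qed
  have "\<exists>P. (\<forall>t\<in>R. P t \<in> sets ?U \<and> P t \<subseteq> A s \<and> measure ?U (P t) = measure G {(s, t)})
      \<and> disjoint_family_on P R" if "s \<in> S" for s
    by (rule unit_lebesgue_disjoint_subsets[OF R(1) A _ sum[OF that]]) simp
  then obtain P where P: "\<And>s t. s \<in> S \<Longrightarrow> t \<in> R \<Longrightarrow> P s t \<in> sets ?U \<and> P s t \<subseteq> A s
      \<and> measure ?U (P s t) = measure G {(s, t)}"
      "\<And>s. s \<in> S \<Longrightarrow> disjoint_family_on (P s) R"
    by metis
  have "disjoint_family_on (\<lambda>(s, t). P s t) (S \<times> R)"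
    unfolding disjoint_family_on_def
  proof (intro ballI impI)
    fix i j assume "i \<in> S \<times> R" "j \<in> S \<times> R" "i \<noteq> j"
    then obtain s t s' t' where ij: "i = (s, t)" "j = (s', t')" "s \<in> S" "t \<in> R" "s' \<in> S" "t' \<in> R" "s \<noteq> s' \<or> t \<noteq> t'"
      by auto
    have "P s t \<inter> P s' t' = {}"
    proof (cases "s = s'")
      case True
      then show ?thesis using P(2)[OF ij(3)] ij by (auto simp: disjoint_family_on_def)
    next
      case False
      have "P s t \<subseteq> A s" "P s' t' \<subseteq> A s'" using P(1) ij by auto
      then show ?thesis using False by (auto simp: A_def)
    qed
    then show "(case i of (s, t) \<Rightarrow> P s t) \<inter> (case j of (s, t) \<Rightarrow> P s t) = {}" using ij by simp
  qed
  \<comment> \<open>Off the pieces \<open>Z\<close> takes the value \<open>Y 0\<close>, a point of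
    \<open>X\<close>. The law does not feel this, because the pieces already carry the full mass of
    \<open>G\<close>.\<close>
  then obtain Z where Z: "simple_function ?U Z"
      "\<forall>i\<in>S \<times> R. \<forall>w\<in>(case i of (s, t) \<Rightarrow> P s t). Z w = snd i" "range Z \<subseteq> insert (Y 0) (snd ` (S \<times> R))"
    using exists_simple_function_on_partition[of "S \<times> R" "\<lambda>(s, t). P s t" ?U snd "Y 0"] P(1) S(1) R(1)
    by auto
  have ZX: "range Z \<subseteq> X" by (rule order_trans[OF Z(3)]) (use Y(2) R(2) in auto)
  let ?YZ = "\<lambda>w. (Y w, Z w)"
  have YZ: "?YZ \<in> measurable ?U (borel_on (X \<times> X))"
    by (rule measurable_simple_function_borel_on) (use Y Z(1) ZX in auto)
  have "distr ?U (borel_on (X \<times> X)) ?YZ = G"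
  proof (rule measure_eqI_finite_atoms[OF G(1) U.prob_space_distr[OF YZ], of "S \<times> R"])
    show "AE z in G. z \<in> S \<times> R"
    proof -
      have Ss: "{x \<in> space (borel_on X). x \<in> S} \<in> sets (borel_on X)"
      proof -
        have "S \<in> sets (borel_on X)" using S by (intro compact_in_sets_borel_on finite_imp_compact)
        moreover have "{x \<in> space (borel_on X). x \<in> S} = S" using S by auto
        ultimately show ?thesis by simp
      qed
      have "AE x in distr ?U (borel_on X) Y. x \<in> S"
        unfolding AE_distr_iff[OF YU Ss] by (simp add: S_def)
      then have "AE z in G. fst z \<in> S" unfolding law AE_distr_iff[OF fst_G Ss] .
      then show ?thesis using R(3) by eventually_elim (simp add: mem_Times_iff)
    qed
    fix z assume z: "z \<in> S \<times> R"
    then obtain s t where st: "z = (s, t)" "s \<in> S" "t \<in> R" by auto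
    then have zX: "z \<in> X \<times> X" using S R by auto
    have "measure G {z} = measure ?U (P s t)" unfolding st(1) using P(1)[OF st(2,3)] by metis
    also have "\<dots> \<le> measure ?U (?YZ -` {z} \<inter> space ?U)"
    proof (rule U.finite_measure_mono)
      show "P s t \<subseteq> ?YZ -` {z} \<inter> space ?U"
      proof
        fix w assume w: "w \<in> P s t"
        then have "Y w = s" using P(1)[OF st(2,3)] by (auto simp: A_def)
        moreover have "Z w = t" using Z(2) w st by fastforce
        ultimately show "w \<in> ?YZ -` {z} \<inter> space ?U" using st by simp
      qed
      show "?YZ -` {z} \<inter> space ?U \<in> sets ?U"
        using measurable_sets[OF YZ, of "{z}"] single2[OF zX] G(2) by simp
    qed
    also have "\<dots> = measure (distr ?U (borel_on (X \<times> X)) ?YZ) {z}"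
      using single2[OF zX] G(2) by (intro measure_distr[OF YZ, symmetric]) simp
    finally show "measure G {z} \<le> measure (distr ?U (borel_on (X \<times> X)) ?YZ) {z}" .
    show "{z} \<in> sets G" by (rule single2[OF zX])
  qed (use G S R spG in auto)
  then show ?thesis using Z(1) ZX by blast
qed

section \<open>Completeness\<close>

lemma summable_dist_imp_Cauchy:
  fixes y :: "nat \<Rightarrow> 'a::metric_space"
  assumes "summable (\<lambda>n. dist (y n) (y (Suc n)))"
  shows "Cauchy y"
proof -
  let ?s = "\<lambda>n. \<Sum>k<n. dist (y k) (y (Suc k))"
  have le: "dist (y m) (y n) \<le> ?s n - ?s m" if "m \<le> n" for m n
    using that
  proof (induction n rule: dec_induct)
    case (step n)
    then show ?case using dist_triangle[of "y m" "y (Suc n)" "y n"] by simp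
  qed simp
  have "Cauchy ?s"
    using assms by (intro convergent_Cauchy) (simp add: summable_iff_convergent)
  show ?thesis
  proof (rule metric_CauchyI)
    fix e :: real assume "0 < e"
    then obtain N where N: "\<And>m n. N \<le> m \<Longrightarrow> N \<le> n \<Longrightarrow> dist (?s m) (?s n) < e"
      using \<open>Cauchy ?s\<close> unfolding Cauchy_def by blast
    have "dist (y m) (y n) < e" if "N \<le> m" "N \<le> n" for m n
    proof (cases "m \<le> n")
      case True
      then show ?thesis using le[OF True] N[OF that] by (auto simp: dist_real_def)
    next
      case False
      then have "n \<le> m" by simp
      then show ?thesis using le[of n m] N[OF that(2,1)] by (auto simp: dist_real_def dist_commute)
    qed
    then show "\<exists>N. \<forall>m\<ge>N. \<forall>n\<ge>N. dist (y m) (y n) < e" by blast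
  qed
qed

lemma borel_measurable_dist_simple_functions:
  fixes Y Z :: "'w \<Rightarrow> 'a::metric_space"
  assumes "simple_function P Y" "simple_function P Z"
  shows "(\<lambda>w. ennreal (dist (Y w) (Z w))) \<in> borel_measurable P"
  using assms by (intro borel_measurable_simple_function simple_function_compose2[where h="\<lambda>x y. ennreal (dist x y)"])

text \<open>\<open>S n\<close> is the length of the path through \<open>Y n\<close>,
  \<open>Y (Suc n)\<close> and so on. Minkowski's inequality bounds its norm by a geometric sum,
  whence the factor 2. Where \<open>S 0\<close> is finite the path is Cauchy in \<open>X\<close>,
  and \<open>S n\<close> dominates the distance from \<open>Y n\<close> to the limit.\<close>

lemma exists_lp_limit:
  fixes X :: "'a::metric_space set" and Y :: "nat \<Rightarrow> 'w \<Rightarrow> 'a"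
  assumes X: "complete X" and p: "1 \<le> p"
    and Y: "\<And>n. simple_function P (Y n)" "\<And>n w. w \<in> space P \<Longrightarrow> Y n w \<in> X"
    and c: "0 \<le> c" "\<And>n. lp_norm P p (\<lambda>w. ennreal (dist (Y n w) (Y (Suc n) w))) \<le> ennreal (c * (1 / 2) ^ n)"
  shows "\<exists>Z D. Z \<in> measurable P (borel_on X) \<and> countable D \<and> (\<forall>w\<in>space P. Z w \<in> closure D) \<and>
    (\<forall>n w. w \<in> space P \<longrightarrow> Y n w \<in> closure D) \<and>
    (\<forall>n. lp_norm P p (\<lambda>w. ennreal (dist (Y n w) (Z w))) \<le> ennreal (2 * c * (1 / 2) ^ n))"
proof -
  have p0: "0 < p" using p by simp
  define d where "d k w = dist (Y k w) (Y (Suc k) w)" for k w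
  have [measurable]: "(\<lambda>w. ennreal (d k w)) \<in> borel_measurable P" for k
    unfolding d_def by (rule borel_measurable_dist_simple_functions[OF Y(1) Y(1)])
  define S where "S n w = (\<Sum>k. ennreal (d (n + k) w))" for n w
  have S[measurable]: "S n \<in> borel_measurable P" for n unfolding S_def by measurable
  have S_norm: "lp_norm P p (S n) \<le> ennreal (2 * c * (1 / 2) ^ n)" for n
  proof -
    have "lp_norm P p (S n) \<le> (\<Sum>k. lp_norm P p (\<lambda>w. ennreal (d (n + k) w)))"
      unfolding S_def by (rule lp_norm_suminf_le[OF p]) measurable
    also have "\<dots> \<le> (\<Sum>k. ennreal (c * (1 / 2) ^ (n + k)))"
      unfolding d_def by (intro suminf_le c(2)) auto
    also have "\<dots> = ennreal (\<Sum>k. c * (1 / 2) ^ n * (1 / 2) ^ k)"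
      using c(1) by (subst suminf_ennreal2[symmetric]) (auto intro!: summable_mult summable_geometric simp: power_add mult.assoc)
    also have "(\<Sum>k. c * (1 / 2) ^ n * (1 / 2) ^ k) = 2 * c * (1 / 2 :: real) ^ n"
      by (subst suminf_mult) (auto simp: suminf_geometric)
    finally show ?thesis .
  qed
  define good where "good w \<longleftrightarrow> S 0 w < top" for w
  have good: "AE w in P. good w"
  proof -
    have "(\<integral>\<^sup>+w. ennpowr (S 0 w) p \<partial>P) < ennpowr top p"
      unfolding lp_norm_less_iff[OF p0, symmetric] using S_norm[of 0] by (rule le_less_trans) simp
    then have "AE w in P. ennpowr (S 0 w) p \<noteq> \<infinity>"
      by (intro nn_integral_PInf_AE) auto
    then show ?thesis unfolding good_def by eventually_elim (auto simp: less_top)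
  qed
  have lim: "\<exists>l\<in>X. (\<lambda>n. Y n w) \<longlonglongrightarrow> l" if w: "w \<in> space P" "good w" for w
  proof -
    have "summable (\<lambda>k. d k w)"
      using w(2) by (intro summable_suminf_not_top) (auto simp: good_def S_def d_def)
    then have "Cauchy (\<lambda>n. Y n w)" unfolding d_def by (rule summable_dist_imp_Cauchy)
    then show ?thesis
      using X[unfolded complete_def, rule_format, of "\<lambda>n. Y n w"] Y(2)[OF w(1)] by blast
  qed
  \<comment> \<open>On the exceptional null set the sequence is frozen at \<open>Y 0\<close>, so it
    converges at every point; this makes the limit measurable and places all its values in the
    closure of the values of the sequence.\<close>
  define Y' where "Y' n w = (if good w then Y n w else Y 0 w)" for n w
  define Z where "Z w = (if good w then SOME l. l \<in> X \<and> (\<lambda>n. Y n w) \<longlonglongrightarrow> l else Y 0 w)" for w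
  have Z_good: "Z w \<in> X \<and> (\<lambda>n. Y n w) \<longlonglongrightarrow> Z w" if "w \<in> space P" "good w" for w
  proof -
    have "\<exists>l. l \<in> X \<and> (\<lambda>n. Y n w) \<longlonglongrightarrow> l" using lim[OF that] by blast
    from someI_ex[OF this] show ?thesis using that by (simp add: Z_def)
  qed
  have Y'_lim: "(\<lambda>n. Y' n w) \<longlonglongrightarrow> Z w" if "w \<in> space P" for w
    using Z_good[OF that] by (cases "good w") (auto simp: Y'_def Z_def)
  have ZX: "Z w \<in> X" if "w \<in> space P" for w
    using Z_good[OF that] Y(2)[OF that, of 0] by (cases "good w") (auto simp: Z_def)
  have Y'_meas: "Y' n \<in> borel_measurable P" for n
  proof -
    note [measurable] = borel_measurable_simple_function[OF Y(1)]
    show ?thesis unfolding Y'_def good_def by measurable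
  qed
  have Z_meas: "Z \<in> borel_measurable P"
    by (rule borel_measurable_LIMSEQ_metric[OF Y'_meas Y'_lim])
  \<comment> \<open>Countable, because simple functions have finite range. It supplies the
    separability used later to pair \<open>Z\<close> with the \<open>Y n\<close> and to show that
    the law of \<open>Z\<close> is Radon.\<close>
  define D where "D = (\<Union>n. Y n ` space P)"
  have D: "countable D"
    unfolding D_def using simple_functionD(1)[OF Y(1)] by (auto intro: countable_finite)
  have YD: "Y n w \<in> D" if "w \<in> space P" for n w using that by (auto simp: D_def)
  have ZD: "Z w \<in> closure D" if w: "w \<in> space P" for w
    unfolding closure_sequential using Y'_lim[OF w] YD[OF w]
    by (intro exI[of _ "\<lambda>n. Y' n w"]) (auto simp: Y'_def)
  have "lp_norm P p (\<lambda>w. ennreal (dist (Y n w) (Z w))) \<le> ennreal (2 * c * (1 / 2) ^ n)" for n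
  proof (rule order_trans[OF lp_norm_mono_AE[OF _ p0] S_norm])
    show "AE w in P. ennreal (dist (Y n w) (Z w)) \<le> S n w"
      using good AE_space
    proof eventually_elim
      fix w assume w: "good w" "w \<in> space P"
      have "dist (Y n w) (Y (n + m) w) \<le> (\<Sum>k<m. d (n + k) w)" for m
      proof (induction m)
        case (Suc m)
        then show ?case using dist_triangle[of "Y n w" "Y (n + Suc m) w" "Y (n + m) w"] by (simp add: d_def)
      qed simp
      then have "ennreal (dist (Y n w) (Y (n + m) w)) \<le> ennreal (\<Sum>k<m. d (n + k) w)" for m
        by (rule ennreal_leI)
      also have "ennreal (\<Sum>k<m. d (n + k) w) = (\<Sum>k<m. ennreal (d (n + k) w))" for m
        by (rule sum_ennreal[symmetric]) (simp add: d_def)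
      also have "(\<Sum>k<m. ennreal (d (n + k) w)) \<le> S n w" for m
        unfolding S_def by (rule sum_le_suminf) auto
      finally have le: "ennreal (dist (Y n w) (Y (n + m) w)) \<le> S n w" for m .
      have lim: "(\<lambda>m. ennreal (dist (Y n w) (Y (n + m) w))) \<longlonglongrightarrow> ennreal (dist (Y n w) (Z w))"
      proof (intro tendsto_ennrealI tendsto_intros)
        show "(\<lambda>m. Y (n + m) w) \<longlonglongrightarrow> Z w"
          using LIMSEQ_ignore_initial_segment[of "\<lambda>n. Y n w" "Z w" n] Z_good[OF w(2,1)] by (simp add: add.commute)
      qed
      show "ennreal (dist (Y n w) (Z w)) \<le> S n w"
        by (rule LIMSEQ_le_const2[OF lim]) (use le in blast)
    qed
  qed
  moreover have "Z \<in> measurable P (borel_on X)"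
    using Z_meas ZX by (auto simp: measurable_restrict_space2_iff)
  ultimately show ?thesis
    using D ZD YD closure_subset[of D] by (intro exI[of _ Z] exI[of _ D]) blast
qed

section \<open>Finitely supported measures, and completeness of the Wasserstein space\<close>

lemma finite_support_in_Pp:
  fixes X :: "'a::metric_space set"
  assumes p: "1 \<le> p" and sets: "sets M = sets (borel_on X)" and "prob_space M"
    and F: "finite F" "F \<subseteq> X" and AE: "AE x in M. x \<in> F"
  shows "M \<in> Pp p X"
proof -
  have p0: "0 < p" using p by simp
  interpret prob_space M by fact
  obtain a where a: "a \<in> F" using eventually_happens'[OF ae_filter_bot AE] by blast
  show ?thesis
  proof (rule PpI[OF p0 sets prob_space_axioms])
    show "radon_measure M"
    proof (rule radon_measureI[OF finite_measure_axioms])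
      fix B and e :: real assume B: "B \<in> sets M" and "0 < e"
      have K: "compact (B \<inter> F)" using F(1) by (intro finite_imp_compact) auto
      have Ks: "B \<inter> F \<in> sets M" unfolding sets using K F(2) by (intro compact_in_sets_borel_on) auto
      have "measure M (B - B \<inter> F) = measure M {}"
        using AE B Ks by (intro measure_eq_AE) auto
      then show "\<exists>K. compact K \<and> K \<subseteq> B \<and> K \<in> sets M \<and> measure M (B - K) \<le> e"
        using K Ks \<open>0 < e\<close> by (intro exI[of _ "B \<inter> F"]) auto
    qed
    show "a \<in> X" using a F(2) by auto
    have "lp_norm M p (\<lambda>x. ennreal (dist a x)) \<le> lp_norm M p (\<lambda>x. ennreal (Max (dist a ` F)))"
    proof (rule lp_norm_mono_AE[OF _ p0])
      show "AE x in M. ennreal (dist a x) \<le> ennreal (Max (dist a ` F))"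
        using AE by eventually_elim (use F(1) in \<open>auto intro!: ennreal_leI Max_ge\<close>)
    qed
    also have "\<dots> < top" using p0 by (simp add: lp_norm_const)
    finally show "lp_norm M p (\<lambda>x. ennreal (dist a x)) < top" .
  qed
qed

lemma simple_distr_in_Pp:
  assumes p: "1 \<le> p" and M: "M \<in> Pp p X" and T: "simple_function (borel_on X) T" "T \<in> X \<rightarrow> X"
  shows "distr M (borel_on X) T \<in> Pp p X" "AE x in distr M (borel_on X) T. x \<in> T ` X"
proof -
  note MD = PpD[OF M]
  have TM: "T \<in> measurable M (borel_on X)"
    unfolding measurable_cong_sets[OF MD(1) refl] by (rule measurable_simple_function_borel_on[OF T(1)]) (use T(2) in simp)
  have fin: "finite (T ` X)" using simple_functionD(1)[OF T(1)] by simp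
  have TX: "T ` X \<subseteq> X" using T(2) by auto
  have "T ` X \<in> sets (borel_on X)" using fin TX by (intro compact_in_sets_borel_on finite_imp_compact)
  moreover have "{x \<in> space (borel_on X). x \<in> T ` X} = T ` X" using TX by auto
  ultimately show AE: "AE x in distr M (borel_on X) T. x \<in> T ` X"
    by (subst AE_distr_iff[OF TM]) (auto simp: MD(2) intro!: AE_I2)
  show "distr M (borel_on X) T \<in> Pp p X"
    by (rule finite_support_in_Pp[OF p _ prob_space.prob_space_distr[OF MD(3) TM] fin TX AE]) simp
qed

lemma wasserstein_dist_simple_distr_le:
  assumes p: "1 \<le> p" and M: "M \<in> Pp p X" and T: "simple_function (borel_on X) T" "T \<in> X \<rightarrow> X"
  shows "wasserstein_dist p X M (distr M (borel_on X) T) \<le> lp_norm M p (\<lambda>x. ennreal (dist x (T x)))"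
proof -
  note MD = PpD[OF M]
  have p0: "0 < p" using p by simp
  have TM: "T \<in> measurable M (borel_on X)"
    unfolding measurable_cong_sets[OF MD(1) refl] by (rule measurable_simple_function_borel_on[OF T(1)]) (use T(2) in simp)
  have id: "(\<lambda>x. x) \<in> measurable M (borel_on X)" using MD(1) by (rule measurable_ident_sets)
  obtain D where D: "countable D" "AE x in M. x \<in> closure D"
    using MD(6) by (auto simp: essentially_separable_def)
  have fin: "finite (T ` X)" using simple_functionD(1)[OF T(1)] by simp
  have "closure D \<subseteq> closure (D \<union> T ` X)" by (intro closure_mono) auto
  then have "AE x in M. x \<in> closure (D \<union> T ` X)" using D(2) by auto
  moreover have "AE x in M. T x \<in> closure (D \<union> T ` X)"
    using closure_subset[of "D \<union> T ` X"] by (intro AE_I2) (auto simp: MD(2))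
  moreover have "countable (D \<union> T ` X)" using D(1) fin by (auto intro: countable_finite)
  ultimately have "wasserstein_dist p X (distr M (borel_on X) (\<lambda>x. x)) (distr M (borel_on X) T)
      \<le> lp_norm M p (\<lambda>x. ennreal (dist x (T x)))"
    by (intro wasserstein_dist_le_lp_norm[OF p0 MD(3) id TM])
  then show ?thesis using MD(1) by (simp add: distr_id2)
qed

lemma complete_extended_metric_space_Pp:
  fixes X :: "'a::metric_space set"
  assumes X: "complete X" and p: "1 \<le> p"
  shows "complete_extended_metric_space (Pp p X) (wasserstein_dist p X)"
proof -
  let ?U = unit_lebesgue
  let ?W = "wasserstein_dist p X"
  have p0: "0 < p" using p by simp
  interpret extended_metric_space "Pp p X" "wasserstein_dist p X" by (rule extended_metric_space_Pp[OF p])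
  interpret U: prob_space unit_lebesgue by (rule prob_space_unit_lebesgue)
  show ?thesis
  proof
    fix \<mu> :: "nat \<Rightarrow> 'a measure"
    assume \<mu>: "range \<mu> \<subseteq> Pp p X"
      and Cauchy: "\<And>e. 0 < e \<Longrightarrow> \<exists>N. \<forall>m\<ge>N. \<forall>n\<ge>N. ?W (\<mu> m) (\<mu> n) < e"
    have \<mu>P: "\<mu> n \<in> Pp p X" for n using \<mu> by auto
    define r :: "nat \<Rightarrow> real" where "r k = (1 / 2) ^ k" for k
    have r: "0 < r k" "0 < ennreal (r k)" for k by (auto simp: r_def)
    have "\<exists>N. \<forall>m\<ge>N. \<forall>n\<ge>N. ?W (\<mu> m) (\<mu> n) < ennreal (r k)" for k
      using Cauchy r(2) by blast
    then obtain N where N: "\<And>k m n. N k \<le> m \<Longrightarrow> N k \<le> n \<Longrightarrow> ?W (\<mu> m) (\<mu> n) < ennreal (r k)"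
      by metis
    \<comment> \<open>The sum over all earlier thresholds makes the indices nondecreasing while
      keeping \<open>\<phi> k\<close> above \<open>N k\<close>.\<close>
    define \<phi> where "\<phi> k = (\<Sum>i\<le>k. N i)" for k
    have \<phi>: "N k \<le> \<phi> k" "\<phi> k \<le> \<phi> (Suc k)" for k unfolding \<phi>_def by (auto intro: member_le_sum)
    have "\<exists>T. simple_function (borel_on X) T \<and> T \<in> X \<rightarrow> X \<and> lp_norm (\<mu> (\<phi> k)) p (\<lambda>x. ennreal (dist x (T x))) < ennreal (r k)" for k
      by (rule exists_simple_approximation[OF p \<mu>P r(2)])
    then obtain T where T: "\<And>k. simple_function (borel_on X) (T k)" "\<And>k. T k \<in> X \<rightarrow> X"
      "\<And>k. lp_norm (\<mu> (\<phi> k)) p (\<lambda>x. ennreal (dist x (T k x))) < ennreal (r k)" by metis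
    define \<nu> where "\<nu> k = distr (\<mu> (\<phi> k)) (borel_on X) (T k)" for k
    have \<nu>: "\<nu> k \<in> Pp p X" "AE x in \<nu> k. x \<in> T k ` X" for k
      unfolding \<nu>_def using simple_distr_in_Pp[OF p \<mu>P T(1,2)] by auto
    have \<mu>\<nu>: "?W (\<mu> (\<phi> k)) (\<nu> k) < ennreal (r k)" for k
      unfolding \<nu>_def by (rule le_less_trans[OF wasserstein_dist_simple_distr_le[OF p \<mu>P T(1,2)] T(3)])
    \<comment> \<open>The triangle inequality through the two approximated measures costs
      \<open>r k + r k + r (Suc k)\<close>, which is at most \<open>3 * r k\<close>.\<close>
    have \<nu>\<nu>: "?W (\<nu> k) (\<nu> (Suc k)) < ennreal (3 * r k)" for k
    proof -
      have "?W (\<nu> k) (\<nu> (Suc k)) \<le> ?W (\<nu> k) (\<mu> (\<phi> k)) + ?W (\<mu> (\<phi> k)) (\<nu> (Suc k))"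
        by (rule triangle[OF \<nu>(1) \<mu>P \<nu>(1)])
      also have "\<dots> \<le> ?W (\<mu> (\<phi> k)) (\<nu> k) + (?W (\<mu> (\<phi> k)) (\<mu> (\<phi> (Suc k))) + ?W (\<mu> (\<phi> (Suc k))) (\<nu> (Suc k)))"
        using sym[OF \<nu>(1) \<mu>P] by (intro add_mono triangle[OF \<mu>P \<mu>P \<nu>(1)]) simp
      also have "\<dots> < ennreal (r k) + (ennreal (r k) + ennreal (r (Suc k)))"
        using N[of k "\<phi> k" "\<phi> (Suc k)"] \<phi>[of k] by (intro add_strict_mono \<mu>\<nu>) auto
      also have "\<dots> \<le> ennreal (3 * r k)"
        by (simp add: r_def flip: ennreal_plus)
      finally show ?thesis .
    qed
    then have "\<exists>G\<in>couplings X (\<nu> k) (\<nu> (Suc k)). lp_norm G p (\<lambda>z. ennreal (dist (fst z) (snd z))) < ennreal (3 * r k)" for k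
      unfolding wasserstein_dist_less_iff[OF p0] .
    then obtain G where G: "\<And>k. G k \<in> couplings X (\<nu> k) (\<nu> (Suc k))"
      "\<And>k. lp_norm (G k) p (\<lambda>z. ennreal (dist (fst z) (snd z))) < ennreal (3 * r k)" by metis
    have TX: "finite (T k ` X)" "T k ` X \<subseteq> X" for k
      using simple_functionD(1)[OF T(1)] T(2)[of k] by auto
    have AE_snd: "AE z in H. snd z \<in> T k ` X" if H: "sets H = sets (borel_on (X \<times> X))" "distr H (borel_on X) snd = \<nu> k" for H k
    proof -
      have m: "snd \<in> measurable H (borel_on X)" by (simp add: measurable_cong_sets[OF H(1) refl])
      have "T k ` X \<in> sets (borel_on X)" using TX by (intro compact_in_sets_borel_on finite_imp_compact)
      moreover have "{x \<in> space (borel_on X). x \<in> T k ` X} = T k ` X" using TX by auto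
      ultimately have S: "{x \<in> space (borel_on X). x \<in> T k ` X} \<in> sets (borel_on X)" by metis
      have "AE x in distr H (borel_on X) snd. x \<in> T k ` X" unfolding H(2) by (rule \<nu>(2))
      then show ?thesis unfolding AE_distr_iff[OF m S] .
    qed
    let ?P = "\<lambda>k Y. simple_function ?U Y \<and> range Y \<subseteq> X \<and> distr ?U (borel_on X) Y = \<nu> k"
    let ?Q = "\<lambda>k Y Z. lp_norm ?U p (\<lambda>w. ennreal (dist (Y w) (Z w))) \<le> ennreal (3 * r k)"
    have meas: "Y \<in> measurable ?U (borel_on X)" if "simple_function ?U Y" "range Y \<subseteq> X" for Y
      by (rule measurable_simple_function_borel_on[OF that(1)]) (use that(2) in auto)
    have pair: "(\<lambda>w. (Y w, Z w)) \<in> measurable ?U (borel_on (X \<times> X))"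
      if "simple_function ?U Y" "range Y \<subseteq> X" "simple_function ?U Z" "range Z \<subseteq> X" for Y Z
      by (rule measurable_simple_function_borel_on) (use that in auto)
    \<comment> \<open>At each step the current variable is kept and the next one is added such that
      the pair has law \<open>G k\<close>. So the whole sequence lives on one space and its
      consecutive distances inherit the norms of the couplings.\<close>
    have "\<exists>Y. \<forall>k. ?P k (Y k) \<and> ?Q k (Y k) (Y (Suc k))"
    proof (rule dependent_nat_choice)
      obtain a where a: "a \<in> X" using \<mu>P[of 0] by (auto simp: Pp_def)
      have sets0: "sets (\<nu> 0) = sets (borel_on X)" by (simp add: \<nu>_def)
      interpret \<nu>0: prob_space "\<nu> 0" using PpD(3)[OF \<nu>(1)] .
      have "Pair a \<in> borel_measurable (borel_on X)"
        by (intro measurable_restrict_space1 borel_measurable_continuous_onI continuous_intros)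
      then have "Pair a \<in> measurable (borel_on X) (borel_on (X \<times> X))"
        using a by (auto simp: measurable_restrict_space2_iff)
      then have m: "Pair a \<in> measurable (\<nu> 0) (borel_on (X \<times> X))"
        by (simp add: measurable_cong_sets[OF sets0 refl])
      \<comment> \<open>The coupling of the Dirac measure at \<open>a\<close> with
        \<open>\<nu> 0\<close>. Realising it over the constant function \<open>a\<close> produces
        the first variable.\<close>
      define H where "H = distr (\<nu> 0) (borel_on (X \<times> X)) (Pair a)"
      have "distr H (borel_on X) fst = distr (\<nu> 0) (borel_on X) (\<lambda>_. a)"
        unfolding H_def by (subst distr_distr[OF _ m]) (auto simp: comp_def)
      also have "\<dots> = distr ?U (borel_on X) (\<lambda>_. a)"
        using a by (subst \<nu>0.distr_const, simp) (subst U.distr_const, simp_all)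
      finally have law: "distr ?U (borel_on X) (\<lambda>_. a) = distr H (borel_on X) fst" ..
      have law_snd: "distr H (borel_on X) snd = \<nu> 0"
        unfolding H_def by (subst distr_distr[OF _ m]) (auto simp: comp_def distr_id2 sets0)
      have Hs: "sets H = sets (borel_on (X \<times> X))" by (simp add: H_def)
      have "prob_space H" unfolding H_def by (rule \<nu>0.prob_space_distr[OF m])
      from exists_coupled_simple_function[OF _ _ this Hs law TX AE_snd[OF Hs law_snd]] a
      obtain Z where Z: "simple_function ?U Z" "range Z \<subseteq> X"
        "distr ?U (borel_on (X \<times> X)) (\<lambda>w. (a, Z w)) = H" by auto
      have "(\<lambda>w. (a, Z w)) \<in> measurable ?U (borel_on (X \<times> X))"
        using a Z by (intro pair) auto
      from distr_distr[OF measurable_snd_borel_on this] Z(3) law_snd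
      have "distr ?U (borel_on X) Z = \<nu> 0" by (simp add: comp_def)
      then show "\<exists>Y. ?P 0 Y" using Z by blast
    next
      fix Y :: "real \<Rightarrow> 'a" and k assume Y: "?P k Y"
      note GD = couplingsD[OF G(1)[of k]]
      have law: "distr ?U (borel_on X) Y = distr (G k) (borel_on X) fst" using Y GD(4) by simp
      from exists_coupled_simple_function[OF _ _ GD(3,1) law TX AE_snd[OF GD(1,5)]] Y
      obtain Z where Z: "simple_function ?U Z" "range Z \<subseteq> X"
        "distr ?U (borel_on (X \<times> X)) (\<lambda>w. (Y w, Z w)) = G k" by auto
      have YZ: "(\<lambda>w. (Y w, Z w)) \<in> measurable ?U (borel_on (X \<times> X))"
        using Y Z by (intro pair) auto
      from distr_distr[OF measurable_snd_borel_on YZ] Z(3) GD(5)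
      have "distr ?U (borel_on X) Z = \<nu> (Suc k)" by (simp add: comp_def)
      moreover have "lp_norm ?U p (\<lambda>w. ennreal (dist (Y w) (Z w))) = lp_norm (G k) p (\<lambda>z. ennreal (dist (fst z) (snd z)))"
        using lp_norm_distr[OF YZ, of "\<lambda>z. ennreal (dist (fst z) (snd z))" p] Z(3) by simp
      ultimately show "\<exists>Z. ?P (Suc k) Z \<and> ?Q k Y Z" using Z(1,2) G(2)[of k] by (intro exI[of _ Z]) auto
    qed
    then obtain Y where Y: "\<And>k. simple_function ?U (Y k)" "\<And>k. range (Y k) \<subseteq> X"
      "\<And>k. distr ?U (borel_on X) (Y k) = \<nu> k"
      "\<And>k. lp_norm ?U p (\<lambda>w. ennreal (dist (Y k w) (Y (Suc k) w))) \<le> ennreal (3 * r k)"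
      by blast
    have YX: "Y n w \<in> X" for n w using Y(2)[of n] by auto
    obtain Z D where ZD: "Z \<in> measurable ?U (borel_on X)" "countable D"
      "\<forall>w\<in>space ?U. Z w \<in> closure D" "\<forall>n w. w \<in> space ?U \<longrightarrow> Y n w \<in> closure D"
      "\<forall>n. lp_norm ?U p (\<lambda>w. ennreal (dist (Y n w) (Z w))) \<le> ennreal (2 * 3 * (1 / 2) ^ n)"
      using exists_lp_limit[OF X p Y(1) YX zero_le_numeral Y(4)[unfolded r_def]] by blast
    have Z: "Z \<in> measurable ?U (borel_on X)" "countable D"
      "\<And>w. Z w \<in> closure D" "\<And>n w. Y n w \<in> closure D"
      "\<And>n. lp_norm ?U p (\<lambda>w. ennreal (dist (Y n w) (Z w))) \<le> ennreal (6 * r n)"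
      using ZD by (simp_all add: r_def)
    define L where "L = distr ?U (borel_on X) Z"
    have \<nu>L: "?W (\<nu> n) L \<le> ennreal (6 * r n)" for n
      unfolding L_def Y(3)[symmetric]
      by (rule order_trans[OF wasserstein_dist_le_lp_norm[OF p0 prob_space_unit_lebesgue meas[OF Y(1,2)] Z(1,2)] Z(5)])
        (auto intro: Z)
    have L: "L \<in> Pp p X"
    proof -
      obtain a where a: "a \<in> X" using \<mu>P[of 0] by (auto simp: Pp_def)
      show ?thesis
      proof (rule PpI[OF p0 _ _ _ a])
        show "sets L = sets (borel_on X)" by (simp add: L_def)
        show "prob_space L" unfolding L_def by (rule U.prob_space_distr[OF Z(1)])
        show "radon_measure L"
          unfolding L_def
          by (rule radon_measure_distr_separable[OF U.finite_measure_axioms unit_lebesgue_inner Z(1,2,3)])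
        have mY: "(\<lambda>w. ennreal (dist a (Y 0 w))) \<in> borel_measurable ?U"
          using meas[OF Y(1,2), of 0] by (rule measurable_compose) (rule borel_measurable_dist_Pp[OF refl])
        have mYZ: "(\<lambda>w. ennreal (dist (Y 0 w) (Z w))) \<in> borel_measurable ?U"
        proof -
          have "(\<lambda>w. (Y 0 w, Z w)) \<in> borel_measurable ?U"
            using meas[OF Y(1,2), of 0] Z(1)
            by (intro borel_measurable_Pair_separable[OF _ _ Z(2)] measurable_borel_onD[where X=X] Z) auto
          then have "(\<lambda>w. dist (fst (Y 0 w, Z w)) (snd (Y 0 w, Z w))) \<in> borel_measurable ?U"
            by (rule measurable_compose) (intro borel_measurable_continuous_onI continuous_intros)
          then show ?thesis by simp
        qed
        have "lp_norm L p (\<lambda>x. ennreal (dist a x)) = lp_norm ?U p (\<lambda>w. ennreal (dist a (Z w)))"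
          unfolding L_def by (rule lp_norm_distr[OF Z(1) borel_measurable_dist_Pp]) simp
        also have "\<dots> \<le> lp_norm ?U p (\<lambda>w. ennreal (dist a (Y 0 w)) + ennreal (dist (Y 0 w) (Z w)))"
          using p0 by (intro lp_norm_mono) (auto simp: dist_triangle simp flip: ennreal_plus intro!: ennreal_leI)
        also have "\<dots> \<le> lp_norm ?U p (\<lambda>w. ennreal (dist a (Y 0 w))) + lp_norm ?U p (\<lambda>w. ennreal (dist (Y 0 w) (Z w)))"
          by (rule lp_norm_add_le[OF p mY mYZ])
        also have "lp_norm ?U p (\<lambda>w. ennreal (dist a (Y 0 w))) = lp_norm (\<nu> 0) p (\<lambda>x. ennreal (dist a x))"
          unfolding Y(3)[symmetric] by (rule lp_norm_distr[OF meas[OF Y(1,2)] borel_measurable_dist_Pp, symmetric]) simp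
        also have "\<dots> + lp_norm ?U p (\<lambda>w. ennreal (dist (Y 0 w) (Z w))) < top"
          using Pp_moment[OF p \<nu>(1)[of 0]] le_less_trans[OF Z(5)[of 0], of top] by (simp add: ennreal_add_less_top)
        finally show "lp_norm L p (\<lambda>x. ennreal (dist a x)) < top" .
      qed
    qed
    \<comment> \<open>The three parts contribute \<open>r n\<close>, \<open>r n\<close> and
      \<open>6 * r n\<close>; the constant 9 makes the estimate strict. The 6 is twice the 3 from
      the couplings, by the geometric sum.\<close>
    have near: "?W (\<mu> m) L < ennreal (9 * r n)" if m: "\<phi> n \<le> m" for m n
    proof -
      have "?W (\<mu> m) L \<le> ?W (\<mu> m) (\<mu> (\<phi> n)) + ?W (\<mu> (\<phi> n)) L"
        by (rule triangle[OF \<mu>P \<mu>P L])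
      also have "\<dots> \<le> ?W (\<mu> m) (\<mu> (\<phi> n)) + (?W (\<mu> (\<phi> n)) (\<nu> n) + ?W (\<nu> n) L)"
        by (intro add_left_mono triangle[OF \<mu>P \<nu>(1) L])
      also have "\<dots> \<le> ennreal (r n) + (ennreal (r n) + ennreal (6 * r n))"
        using N[of n m "\<phi> n"] \<phi>(1)[of n] m \<mu>\<nu>[of n] by (intro add_mono \<nu>L) auto
      also have "\<dots> < ennreal (9 * r n)"
        using r(1)[of n] by (simp add: ennreal_less_iff flip: ennreal_plus)
      finally show ?thesis .
    qed
    have "\<exists>K. \<forall>n\<ge>K. ?W (\<mu> n) L < e" if e: "0 < e" for e
    proof -
      have "(\<lambda>n. ennreal (9 * r n)) \<longlonglongrightarrow> ennreal (9 * 0)"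
        unfolding r_def by (intro tendsto_ennrealI tendsto_mult tendsto_const LIMSEQ_power_zero) auto
      then have "eventually (\<lambda>n. ennreal (9 * r n) < e) sequentially"
        using e by (intro order_tendstoD(2)) auto
      then obtain n where "ennreal (9 * r n) < e" using eventually_happens'[OF sequentially_bot] by blast
      then show ?thesis using near[of n] by (intro exI[of _ "\<phi> n"]) (auto intro: less_trans)
    qed
    then show "\<exists>l\<in>Pp p X. \<forall>e>0. \<exists>N. \<forall>n\<ge>N. ?W (\<mu> n) l < e" using L by blast
  qed
qed

section \<open>Finite convex combinations\<close>

text \<open>A barycentric algebra \<open>A\<close> generates a commutative monoid of weighted points, in which
  \<open>(a, x) + (b, y) = (a + b, x +\<^bsub>a/(a+b)\<^esub> y)\<close>; finite convex combinations are its finite sums.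
  \<open>Junk\<close> absorbs ill-formed arguments, which makes the addition total.\<close>

datatype 'b cone = Null | Junk | Weighted real 'b

text \<open>Weight zero gives the neutral element, so such terms drop out of sums whatever their
  point is.\<close>

definition cone_point :: "real \<Rightarrow> 'b \<Rightarrow> 'b cone" where
  "cone_point a x = (if a = 0 then Null else Weighted a x)"

primrec cone_scale :: "real \<Rightarrow> 'b cone \<Rightarrow> 'b cone" where
  "cone_scale c Null = Null"
| "cone_scale c Junk = Junk"
| "cone_scale c (Weighted a x) = Weighted (c * a) x"

lemma cone_scale_point: "c \<noteq> 0 \<Longrightarrow> cone_scale c (cone_point a x) = cone_point (c * a) x"
  by (simp add: cone_point_def)

context barycentric_algebra
begin

fun cone_add :: "'a cone \<Rightarrow> 'a cone \<Rightarrow> 'a cone" where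
  "cone_add Null v = v"
| "cone_add u Null = u"
| "cone_add (Weighted a x) (Weighted b y) =
    (if 0 < a \<and> 0 < b \<and> x \<in> A \<and> y \<in> A then Weighted (a + b) (cc (a / (a + b)) x y) else Junk)"
| "cone_add _ _ = Junk"

lemma cone_add_Null [simp]: "cone_add u Null = u"
  by (cases u) auto

lemma cone_add_Junk: "cone_add Junk v = Junk" "cone_add v Junk = Junk"
  by (cases v; simp)+

text \<open>Ill-formed weighted points turn every sum with a summand other than \<open>Null\<close>
  into \<open>Junk\<close>, which lets associativity hold without side conditions.\<close>

lemma cone_add_invalid:
  assumes "\<not> (0 < a \<and> x \<in> A)" "v \<noteq> Null"
  shows "cone_add (Weighted a x) v = Junk" "cone_add v (Weighted a x) = Junk"
  using assms by (cases v; auto)+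

lemma cone_add_neq_Null: "cone_add (Weighted a x) (Weighted b y) \<noteq> Null"
  by simp

lemma ratio_closed: "0 < a \<Longrightarrow> 0 < b \<Longrightarrow> x \<in> A \<Longrightarrow> y \<in> A \<Longrightarrow> cc (a / (a + b)) x y \<in> A"
  by (rule closed) (auto simp: field_simps)

lemma cone_add_commute: "cone_add u v = cone_add v u"
proof (cases u; cases v)
  fix a x b y assume uv: "u = Weighted a x" "v = Weighted b y"
  show ?thesis
  proof (cases "0 < a \<and> 0 < b \<and> x \<in> A \<and> y \<in> A")
    case True
    then have "cc (a / (a + b)) x y = cc (1 - a / (a + b)) y x" by (intro skew_comm) (auto simp: field_simps)
    also have "1 - a / (a + b) = b / (b + a)" using True by (simp add: field_simps)
    finally show ?thesis using True uv by (simp add: add.commute)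
  next
    case False
    then show ?thesis using uv by auto
  qed
qed auto

lemma cone_add_assoc: "cone_add (cone_add u v) w = cone_add u (cone_add v w)"
proof (cases u; cases v; cases w)
  fix a x b y c z assume uvw: "u = Weighted a x" "v = Weighted b y" "w = Weighted c z"
  show ?thesis
  proof (cases "0 < a \<and> 0 < b \<and> 0 < c \<and> x \<in> A \<and> y \<in> A \<and> z \<in> A")
    case True
    \<comment> \<open>These are the shares of \<open>a + b\<close> in the total weight and of
      \<open>a\<close> in \<open>a + b\<close>. In such homogeneous weights the inner parameter
      \<open>(r - s * r) / (1 - s * r)\<close> of skew associativity is simply
      \<open>b / (b + c)\<close>.\<close>
    define r s where "r = (a + b) / (a + b + c)" and "s = a / (a + b)"
    have pos: "0 < a + b" "0 < a + b + c" "0 < b + c" using True by auto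
    have rs: "r \<in> {0..<1}" "s \<in> {0..<1}" using True by (auto simp: r_def s_def)
    have sr: "s * r = a / (a + (b + c))" using pos by (simp add: r_def s_def add.assoc)
    have "r - s * r = b / (a + b + c)"
      unfolding sr by (simp add: r_def add.assoc flip: diff_divide_distrib)
    moreover have "1 - s * r = (b + c) / (a + b + c)"
      unfolding sr using pos by (simp add: field_simps)
    ultimately have q: "(r - s * r) / (1 - s * r) = b / (b + c)" using pos by simp
    have "cc r (cc s x y) z = cc (s * r) x (cc ((r - s * r) / (1 - s * r)) y z)"
      using True by (intro skew_assoc rs) auto
    then have "cc ((a + b) / (a + b + c)) (cc (a / (a + b)) x y) z = cc (a / (a + (b + c))) x (cc (b / (b + c)) y z)"
      unfolding q unfolding sr unfolding r_def s_def .
    then show ?thesis using True uvw ratio_closed by (simp add: add.assoc)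
  next
    case False
    then consider "\<not> (0 < a \<and> x \<in> A)" | "\<not> (0 < b \<and> y \<in> A)" | "\<not> (0 < c \<and> z \<in> A)" by blast
    then show ?thesis
    proof cases
      case 1
      then show ?thesis unfolding uvw
        by (simp only: cone_add_invalid[OF 1] cone_add_Junk cone_add_neq_Null cone.distinct not_False_eq_True)
    next
      case 2
      then show ?thesis unfolding uvw
        by (simp only: cone_add_invalid[OF 2] cone_add_Junk cone_add_neq_Null cone.distinct not_False_eq_True)
    next
      case 3
      then show ?thesis unfolding uvw
        by (simp only: cone_add_invalid[OF 3] cone_add_Junk cone_add_neq_Null cone.distinct not_False_eq_True)
    qed
  qed
qed (auto simp: cone_add_Junk)

text \<open>From here on independence of the order, regrouping along fibres and termwise addition of
  finite convex combinations are instances of the laws of finite sums in a commutative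
  monoid.\<close>

sublocale cone: comm_monoid_set cone_add Null
  by unfold_locales (rule cone_add_assoc cone_add_commute cone_add_Null)+

abbreviation cone_sum :: "('i \<Rightarrow> 'a cone) \<Rightarrow> 'i set \<Rightarrow> 'a cone" where
  "cone_sum \<equiv> cone.F"

lemma cone_add_point:
  assumes "0 \<le> a" "0 \<le> b" "x \<in> A"
  shows "cone_add (cone_point a x) (cone_point b x) = cone_point (a + b) x"
  using assms idem[of "a / (a + b)" x] by (auto simp: cone_point_def)

lemma cone_sum_point:
  assumes "finite I" "\<And>i. i \<in> I \<Longrightarrow> 0 \<le> a i" "x \<in> A"
  shows "cone_sum (\<lambda>i. cone_point (a i) x) I = cone_point (sum a I) x"
  using assms(1,2)
proof (induction I)
  case (insert i I)
  then show ?case using assms(3) by (simp add: cone_add_point sum_nonneg)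
qed (simp add: cone_point_def)

lemma cone_scale_add:
  assumes "0 < c"
  shows "cone_scale c (cone_add u v) = cone_add (cone_scale c u) (cone_scale c v)"
proof (cases u; cases v)
  fix a x b y assume uv: "u = Weighted a x" "v = Weighted b y"
  have "c * a / (c * a + c * b) = a / (a + b)" using assms by (simp flip: distrib_left)
  then show ?thesis using uv assms by (auto simp: zero_less_mult_iff distrib_left)
qed auto

lemma cone_scale_sum:
  assumes "0 < c"
  shows "cone_scale c (cone_sum f I) = cone_sum (\<lambda>i. cone_scale c (f i)) I"
  by (induction I rule: infinite_finite_induct) (auto simp: cone_scale_add[OF assms])

lemma cone_sum_cases:
  assumes "finite I" "\<And>i. i \<in> I \<Longrightarrow> 0 \<le> a i" "\<And>i. i \<in> I \<Longrightarrow> x i \<in> A"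
  shows "sum a I = 0 \<and> cone_sum (\<lambda>i. cone_point (a i) (x i)) I = Null \<or>
    0 < sum a I \<and> (\<exists>z\<in>A. cone_sum (\<lambda>i. cone_point (a i) (x i)) I = Weighted (sum a I) z)"
  using assms
proof (induction I)
  case (insert i I)
  have i: "0 \<le> a i" "x i \<in> A" using insert.prems by auto
  from insert consider "sum a I = 0" "cone_sum (\<lambda>i. cone_point (a i) (x i)) I = Null"
    | z where "0 < sum a I" "z \<in> A" "cone_sum (\<lambda>i. cone_point (a i) (x i)) I = Weighted (sum a I) z"
    by auto
  then show ?case
  proof cases
    case 1
    then show ?thesis using insert.hyps i by (auto simp: cone_point_def)
  next
    case 2
    then show ?thesis using insert.hyps i ratio_closed[of "a i" "sum a I" "x i" z] by (auto simp: cone_point_def)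
  qed
qed simp

text \<open>For a finite family in \<open>A\<close> with nonnegative weights of sum 1 only the
  \<open>Weighted\<close> case occurs, with \<open>s = 1\<close>.\<close>

definition convex_combination :: "'i set \<Rightarrow> ('i \<Rightarrow> real) \<Rightarrow> ('i \<Rightarrow> 'a) \<Rightarrow> 'a" where
  "convex_combination I a x =
    (case cone_sum (\<lambda>i. cone_point (a i) (x i)) I of Weighted s z \<Rightarrow> z | _ \<Rightarrow> undefined)"

lemma convex_combination_eqI:
  "cone_sum (\<lambda>i. cone_point (a i) (x i)) I = Weighted s z \<Longrightarrow> convex_combination I a x = z"
  by (simp add: convex_combination_def)

lemma cone_sum_convex_combination:
  assumes "finite I" "\<And>i. i \<in> I \<Longrightarrow> 0 \<le> a i" "\<And>i. i \<in> I \<Longrightarrow> x i \<in> A" "sum a I = 1"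
  shows "cone_sum (\<lambda>i. cone_point (a i) (x i)) I = Weighted 1 (convex_combination I a x)"
    "convex_combination I a x \<in> A"
  using cone_sum_cases[of I a x] assms by (auto dest: convex_combination_eqI)

text \<open>Scaling by a positive factor is additive on the cone, so the mixture is the sum of the
  two scaled cone elements. The factors \<open>r\<close> and \<open>1 - r\<close> must be positive:
  scaling by 0 yields a weighted point of weight 0, which is not \<open>Null\<close>.\<close>

lemma convex_combination_mix:
  assumes "finite I" "\<And>i. i \<in> I \<Longrightarrow> x i \<in> A" and r: "0 < r" "r < 1"
    and a: "\<And>i. i \<in> I \<Longrightarrow> 0 \<le> a i" "sum a I = 1" and b: "\<And>i. i \<in> I \<Longrightarrow> 0 \<le> b i" "sum b I = 1"
  shows "convex_combination I (\<lambda>i. r * a i + (1 - r) * b i) x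
    = cc r (convex_combination I a x) (convex_combination I b x)"
proof (rule convex_combination_eqI)
  have "cone_sum (\<lambda>i. cone_point (r * a i + (1 - r) * b i) (x i)) I
    = cone_sum (\<lambda>i. cone_add (cone_scale r (cone_point (a i) (x i))) (cone_scale (1 - r) (cone_point (b i) (x i)))) I"
    using assms by (intro cone.cong refl) (simp add: cone_scale_point cone_add_point)
  also have "\<dots> = cone_add (cone_scale r (cone_sum (\<lambda>i. cone_point (a i) (x i)) I))
      (cone_scale (1 - r) (cone_sum (\<lambda>i. cone_point (b i) (x i)) I))"
    using r by (simp add: cone.distrib cone_scale_sum)
  also have "\<dots> = Weighted 1 (cc r (convex_combination I a x) (convex_combination I b x))"
    using assms by (simp add: cone_sum_convex_combination)
  finally show "cone_sum (\<lambda>i. cone_point (r * a i + (1 - r) * b i) (x i)) I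
    = Weighted 1 (cc r (convex_combination I a x) (convex_combination I b x))" .
qed

text \<open>The sum is regrouped along the fibres of \<open>h\<close>; within a fibre the points
  coincide, and idempotence merges their weights.\<close>

lemma convex_combination_reindex:
  assumes I: "finite I" and a: "\<And>i. i \<in> I \<Longrightarrow> 0 \<le> a i" and x: "\<And>i. i \<in> I \<Longrightarrow> x (h i) \<in> A"
  shows "convex_combination (h ` I) (\<lambda>j. sum a {i \<in> I. h i = j}) x = convex_combination I a (\<lambda>i. x (h i))"
proof -
  have "cone_sum (\<lambda>j. cone_point (sum a {i \<in> I. h i = j}) (x j)) (h ` I)
    = cone_sum (\<lambda>j. cone_sum (\<lambda>i. cone_point (a i) (x (h i))) {i \<in> I. h i = j}) (h ` I)"
  proof (rule cone.cong[OF refl])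
    fix j assume j: "j \<in> h ` I"
    have "cone_point (sum a {i \<in> I. h i = j}) (x j) = cone_sum (\<lambda>i. cone_point (a i) (x j)) {i \<in> I. h i = j}"
      using I a x j by (intro cone_sum_point[symmetric]) auto
    also have "\<dots> = cone_sum (\<lambda>i. cone_point (a i) (x (h i))) {i \<in> I. h i = j}"
      by (rule cone.cong) auto
    finally show "cone_point (sum a {i \<in> I. h i = j}) (x j) = cone_sum (\<lambda>i. cone_point (a i) (x (h i))) {i \<in> I. h i = j}" .
  qed
  also have "\<dots> = cone_sum (\<lambda>i. cone_point (a i) (x (h i))) I"
    using I by (intro cone.group) auto
  finally show ?thesis by (simp add: convex_combination_def)
qed

text \<open>The integral of the composite of \<open>\<phi>\<close> and \<open>V\<close> in the
  algebra. Weights are indexed by values of \<open>V\<close>, which need not lie in the algebra, so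
  the same formula serves for maps into \<open>X\<close> and for pairs of such maps.\<close>

definition simple_barycenter :: "'w measure \<Rightarrow> ('w \<Rightarrow> 'c) \<Rightarrow> ('c \<Rightarrow> 'a) \<Rightarrow> 'a" where
  "simple_barycenter P V \<phi> =
    convex_combination (V ` space P) (\<lambda>v. measure P (V -` {v} \<inter> space P)) \<phi>"

end

lemma measure_simple_function_vimage:
  assumes "finite_measure P" and V: "simple_function P V"
  shows "measure P ((\<lambda>w. h (V w)) -` {j} \<inter> space P)
    = (\<Sum>v\<in>{v \<in> V ` space P. h v = j}. measure P (V -` {v} \<inter> space P))"
proof -
  interpret finite_measure P by fact
  have "(\<Sum>v\<in>{v \<in> V ` space P. h v = j}. measure P (V -` {v} \<inter> space P))
    = measure P (\<Union>v\<in>{v \<in> V ` space P. h v = j}. V -` {v} \<inter> space P)"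
    using simple_functionD[OF V] by (intro finite_measure_finite_Union[symmetric]) (auto simp: disjoint_family_on_def)
  also have "(\<Union>v\<in>{v \<in> V ` space P. h v = j}. V -` {v} \<inter> space P) = (\<lambda>w. h (V w)) -` {j} \<inter> space P" by auto
  finally show ?thesis ..
qed

lemma sum_measure_simple_function:
  assumes "prob_space P" and V: "simple_function P V"
  shows "(\<Sum>v\<in>V ` space P. measure P (V -` {v} \<inter> space P)) = 1"
  using measure_simple_function_vimage[of P V "\<lambda>_. ()" "()"] assms
  by (simp add: prob_space.finite_measure prob_space.prob_space)

context barycentric_algebra
begin

lemma simple_barycenter_closed:
  assumes "prob_space P" "simple_function P V" "\<And>w. w \<in> space P \<Longrightarrow> \<phi> (V w) \<in> A"
  shows "simple_barycenter P V \<phi> \<in> A"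
  unfolding simple_barycenter_def
  by (rule cone_sum_convex_combination(2)) (use assms simple_functionD(1)[OF assms(2)] sum_measure_simple_function in auto)

lemma simple_barycenter_compose:
  assumes "prob_space P" and V: "simple_function P V" and "\<And>w. w \<in> space P \<Longrightarrow> \<phi> (h (V w)) \<in> A"
  shows "simple_barycenter P (\<lambda>w. h (V w)) \<phi> = simple_barycenter P V (\<lambda>v. \<phi> (h v))"
proof -
  interpret prob_space P by fact
  have "simple_barycenter P (\<lambda>w. h (V w)) \<phi> = convex_combination (h ` V ` space P)
      (\<lambda>j. \<Sum>v\<in>{v \<in> V ` space P. h v = j}. measure P (V -` {v} \<inter> space P)) \<phi>"
    unfolding simple_barycenter_def measure_simple_function_vimage[OF finite_measure_axioms V] image_image ..
  also have "\<dots> = simple_barycenter P V (\<lambda>v. \<phi> (h v))"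
    unfolding simple_barycenter_def
    using simple_functionD(1)[OF V] assms(3) by (intro convex_combination_reindex) auto
  finally show ?thesis .
qed

text \<open>Surjectivity of \<open>h\<close> makes the two index sets of values coincide.\<close>

lemma simple_barycenter_distr:
  assumes h: "h \<in> measurable P N" "h ` space P = space N" and T: "simple_function N T"
  shows "simple_barycenter (distr P N h) T \<phi> = simple_barycenter P (\<lambda>w. T (h w)) \<phi>"
proof -
  have "measure (distr P N h) (T -` {t} \<inter> space N) = measure P ((\<lambda>w. T (h w)) -` {t} \<inter> space P)" for t
  proof -
    have "h -` (T -` {t} \<inter> space N) \<inter> space P = (\<lambda>w. T (h w)) -` {t} \<inter> space P"
      using measurable_space[OF h(1)] by auto
    then show ?thesis using measure_distr[OF h(1) simple_functionD(2)[OF T, of "{t}"]] by simp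
  qed
  then show ?thesis
    unfolding simple_barycenter_def space_distr by (simp flip: h(2) add: image_image)
qed

lemma simple_barycenter_mixture:
  assumes r: "0 < r" "r < 1" and sets: "sets N = sets M" and "prob_space M" "prob_space N"
    and T: "simple_function M T" and \<phi>: "\<And>w. w \<in> space M \<Longrightarrow> \<phi> (T w) \<in> A"
  shows "simple_barycenter (mixture r M N) T \<phi> = cc r (simple_barycenter M T \<phi>) (simple_barycenter N T \<phi>)"
proof -
  have sp: "space N = space M" by (rule sets_eq_imp_space_eq[OF sets])
  have TN: "simple_function N T" by (rule iffD1[OF simple_function_cong_algebra[OF sets sp] T])
  have m: "measure (mixture r M N) (T -` {v} \<inter> space M)
      = r * measure M (T -` {v} \<inter> space M) + (1 - r) * measure N (T -` {v} \<inter> space M)" for v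
    using r assms(4,5) simple_functionD(2)[OF T] by (intro measure_mixture sets) (auto intro: prob_space.finite_measure)
  show ?thesis
    unfolding simple_barycenter_def space_mixture m sp
    by (rule convex_combination_mix)
      (use r \<phi> simple_functionD(1)[OF T] sum_measure_simple_function[OF assms(4) T]
        sum_measure_simple_function[OF assms(5) TN] sp in auto)
qed

lemma simple_barycenter_const:
  assumes "prob_space P" "\<phi> x \<in> A"
  shows "simple_barycenter P (\<lambda>_. x) \<phi> = \<phi> x"
proof -
  interpret prob_space P by fact
  have "(\<lambda>_. x) ` space P = {x}" using not_empty by auto
  then show ?thesis
    unfolding simple_barycenter_def
    by (intro convex_combination_eqI[of _ _ _ 1]) (simp add: cone_point_def prob_space)
qed

end

section \<open>The Wasserstein inequality for finite convex combinations\<close>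

context extended_metric_wasserstein_algebra
begin

text \<open>The inequality is homogeneous in the weights, so the induction can split off one point
  without rescaling the others.\<close>

lemma cone_sum_wasserstein:
  assumes "finite I" "\<And>i. i \<in> I \<Longrightarrow> 0 \<le> a i" "\<And>i. i \<in> I \<Longrightarrow> x i \<in> A" "\<And>i. i \<in> I \<Longrightarrow> y i \<in> A"
    and "cone_sum (\<lambda>i. cone_point (a i) (x i)) I = Weighted s u"
    and "cone_sum (\<lambda>i. cone_point (a i) (y i)) I = Weighted s v"
  shows "ennreal s * ennpowr (d u v) p \<le> (\<Sum>i\<in>I. ennreal (a i) * ennpowr (d (x i) (y i)) p)"
  using assms
proof (induction I arbitrary: s u v)
  case (insert i I)
  let ?S = "\<Sum>i\<in>I. ennreal (a i) * ennpowr (d (x i) (y i)) p"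
  have i: "0 \<le> a i" "x i \<in> A" "y i \<in> A" using insert.prems by auto
  have I: "0 \<le> a j" "x j \<in> A" "y j \<in> A" if "j \<in> I" for j using insert.prems that by auto
  have eqs: "cone_add (cone_point (a i) (x i)) (cone_sum (\<lambda>i. cone_point (a i) (x i)) I) = Weighted s u"
    "cone_add (cone_point (a i) (y i)) (cone_sum (\<lambda>i. cone_point (a i) (y i)) I) = Weighted s v"
    using insert.prems insert.hyps by auto
  show ?case
  proof (cases "sum a I = 0")
    case True
    then have "cone_sum (\<lambda>i. cone_point (a i) (x i)) I = Null" "cone_sum (\<lambda>i. cone_point (a i) (y i)) I = Null"
      using cone_sum_cases[of I a x] cone_sum_cases[of I a y] insert.hyps(1) I by auto
    then have "u = x i" "v = y i" "s = a i" using eqs by (auto simp: cone_point_def split: if_splits)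
    then show ?thesis using insert.hyps by simp
  next
    case False
    then obtain u' v' where uv: "u' \<in> A" "v' \<in> A" "0 < sum a I"
      "cone_sum (\<lambda>i. cone_point (a i) (x i)) I = Weighted (sum a I) u'"
      "cone_sum (\<lambda>i. cone_point (a i) (y i)) I = Weighted (sum a I) v'"
      using cone_sum_cases[of I a x] cone_sum_cases[of I a y] insert.hyps(1) I by auto
    have IH: "ennreal (sum a I) * ennpowr (d u' v') p \<le> ?S"
      using insert.IH[OF I uv(4,5)] .
    show ?thesis
    proof (cases "a i = 0")
      case True
      then have "u = u'" "v = v'" "s = sum a I" using eqs uv by (auto simp: cone_point_def)
      then show ?thesis using IH True insert.hyps by simp
    next
      case False
      \<comment> \<open>The share of the new point in the total weight; multiplying the binary
        inequality by \<open>s\<close> turns the shares back into weights.\<close>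
      define r where "r = a i / (a i + sum a I)"
      have ai: "0 < a i" using False i by simp
      have r: "r \<in> {0..1}" using ai uv(3) by (auto simp: r_def)
      have s: "s = a i + sum a I" "u = cc r (x i) u'" "v = cc r (y i) v'"
        using eqs uv ai i by (auto simp: cone_point_def r_def)
      have sr: "s * r = a i" "s * (1 - r) = sum a I" "0 \<le> s"
        using ai uv(3) by (auto simp: s(1) r_def field_simps)
      have "ennreal s * ennpowr (d u v) p \<le> ennreal s * (ennreal r * ennpowr (d (x i) (y i)) p + ennreal (1 - r) * ennpowr (d u' v') p)"
        unfolding s(2,3) by (intro mult_left_mono wasserstein r i uv) auto
      also have "\<dots> = ennreal (s * r) * ennpowr (d (x i) (y i)) p + ennreal (s * (1 - r)) * ennpowr (d u' v') p"
        using r sr(3) by (simp add: distrib_left mult.assoc ennreal_mult)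
      also have "\<dots> \<le> ennreal (a i) * ennpowr (d (x i) (y i)) p + ?S"
        unfolding sr by (intro add_left_mono IH)
      finally show ?thesis using insert.hyps by simp
    qed
  qed
qed simp

text \<open>Both barycentres are rewritten over the values of the pair of \<open>Y\<close> and
  \<open>Z\<close>, with the same weights. The finite inequality then applies, and its right-hand
  side is the integral of a simple function.\<close>

lemma simple_barycenter_wasserstein:
  assumes "prob_space P" and Y: "simple_function P Y" and Z: "simple_function P Z"
    and \<phi>: "\<And>w. w \<in> space P \<Longrightarrow> \<phi> (Y w) \<in> A" "\<And>w. w \<in> space P \<Longrightarrow> \<phi> (Z w) \<in> A"
  shows "ennpowr (d (simple_barycenter P Y \<phi>) (simple_barycenter P Z \<phi>)) p
    \<le> (\<integral>\<^sup>+w. ennpowr (d (\<phi> (Y w)) (\<phi> (Z w))) p \<partial>P)"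
proof -
  interpret P: prob_space P by fact
  define V where "V w = (Y w, Z w)" for w
  have V: "simple_function P V" unfolding V_def by (intro simple_function_Pair Y Z)
  define m where "m v = measure P (V -` {v} \<inter> space P)" for v
  let ?x = "\<lambda>v. \<phi> (fst v)" and ?y = "\<lambda>v. \<phi> (snd v)" and ?I = "V ` space P"
  have I: "finite ?I" "\<And>v. v \<in> ?I \<Longrightarrow> 0 \<le> m v" "\<And>v. v \<in> ?I \<Longrightarrow> ?x v \<in> A" "\<And>v. v \<in> ?I \<Longrightarrow> ?y v \<in> A" "sum m ?I = 1"
    using simple_functionD(1)[OF V] \<phi> sum_measure_simple_function[OF assms(1) V] by (auto simp: m_def V_def)
  have V_bary: "simple_barycenter P V \<psi> = convex_combination ?I m \<psi>" for \<psi>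
    unfolding simple_barycenter_def m_def[abs_def] ..
  have eq: "simple_barycenter P Y \<phi> = convex_combination ?I m ?x" "simple_barycenter P Z \<phi> = convex_combination ?I m ?y"
    using simple_barycenter_compose[OF assms(1) V, of \<phi> fst] simple_barycenter_compose[OF assms(1) V, of \<phi> snd] \<phi>
    unfolding V_bary by (simp_all add: V_def)
  have "ennreal 1 * ennpowr (d (convex_combination ?I m ?x) (convex_combination ?I m ?y)) p
      \<le> (\<Sum>v\<in>?I. ennreal (m v) * ennpowr (d (?x v) (?y v)) p)"
    by (rule cone_sum_wasserstein[OF I(1-4) cone_sum_convex_combination(1)[OF I(1,2,3,5)] cone_sum_convex_combination(1)[OF I(1,2,4,5)]])
  also have "\<dots> = (\<Sum>v\<in>?I. ennpowr (d (?x v) (?y v)) p * emeasure P {w \<in> space P. V w = v})"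
    by (intro sum.cong refl) (simp add: m_def P.emeasure_eq_measure mult.commute vimage_def Int_def conj_commute)
  also have "\<dots> = simple_integral P (\<lambda>w. ennpowr (d (?x (V w)) (?y (V w))) p)"
    by (rule simple_function_partition[symmetric]) (auto intro!: simple_function_compose1[OF V, of "\<lambda>v. ennpowr (d (?x v) (?y v)) p"] V)
  also have "\<dots> = (\<integral>\<^sup>+w. ennpowr (d (?x (V w)) (?y (V w))) p \<partial>P)"
    by (rule nn_integral_eq_simple_integral[symmetric]) (rule simple_function_compose1[OF V, of "\<lambda>v. ennpowr (d (?x v) (?y v)) p"])
  finally show ?thesis by (simp add: eq V_def)
qed

end

section \<open>The universal property\<close>

lemma return_in_Pp:
  fixes X :: "'a::metric_space set"
  assumes p: "1 \<le> p" and x: "x \<in> X"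
  shows "return (borel_on X) x \<in> Pp p X"
proof (rule finite_support_in_Pp[OF p])
  have xs: "x \<in> space (borel_on X)" using x by simp
  show "prob_space (return (borel_on X) x)" by (rule prob_space_return[OF xs])
  have "{x} \<in> sets (borel_on X)" using x by (intro compact_in_sets_borel_on) auto
  then have "{y \<in> space (borel_on X). y \<in> {x}} \<in> sets (borel_on X)"
    using x by (auto simp: Collect_conv_if)
  then show "AE z in return (borel_on X) x. z \<in> {x}"
    by (subst AE_return[OF xs]) (simp_all add: pred_def)
qed (use x in auto)

text \<open>An atom at \<open>x\<close> of mass \<open>r\<close> is split off: \<open>M\<close> is a
  mixture of the Dirac measure at \<open>x\<close> and of \<open>M\<close> conditioned on the
  complement of \<open>x\<close>, which has smaller support. As the support is meant almost
  everywhere, an atom of mass zero is simply dropped.\<close>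

lemma finite_support_Pp_induct:
  fixes X :: "'a::metric_space set"
  assumes p: "1 \<le> p"
    and mix: "\<And>r M N. r \<in> {0..1} \<Longrightarrow> M \<in> Pp p X \<Longrightarrow> N \<in> Pp p X \<Longrightarrow> Q M \<Longrightarrow> Q N \<Longrightarrow> Q (mixture r M N)"
    and dirac: "\<And>x. x \<in> X \<Longrightarrow> Q (return (borel_on X) x)"
    and F: "finite F" "F \<subseteq> X" and M: "sets M = sets (borel_on X)" "prob_space M" "AE x in M. x \<in> F"
  shows "Q M"
  using F M
proof (induction F arbitrary: M)
  case empty
  interpret prob_space M by fact
  have "AE x in M. False" using empty.prems(4) by simp
  then show ?case using AE_False by blast
next
  case (insert x F)
  interpret prob_space M by fact
  have sM: "sets M = sets (borel_on X)" and AE: "AE y in M. y \<in> insert x F" by fact+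
  have spM: "space M = X" using sets_eq_imp_space_eq[OF sM] by simp
  have xX: "x \<in> X" using insert.prems by simp
  have x: "{x} \<in> sets M" unfolding sM using xX by (intro compact_in_sets_borel_on) auto
  define r where "r = measure M {x}"
  have r01: "r \<in> {0..1}" by (simp add: r_def)
  have xs: "x \<in> space (borel_on X)" using xX by simp
  interpret R: prob_space "return (borel_on X) x" by (rule prob_space_return[OF xs])
  consider "r = 0" | "r = 1" | "0 < r" "r < 1" using r01 by fastforce
  then show ?case
  proof cases
    case 1
    then have "{x} \<in> null_sets M" using x by (auto simp: null_sets_def emeasure_eq_measure r_def)
    then have "AE y in M. y \<notin> {x}" by (rule AE_not_in)
    then have "AE y in M. y \<in> F" using AE by eventually_elim auto
    then show ?thesis using insert by simp
  next
    case 2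
    have "M = return (borel_on X) x"
    proof (rule measure_eqI_finite_atoms[OF R.prob_space_axioms prob_space_axioms, of "{x}"])
      have "{y \<in> space (borel_on X). y \<in> {x}} \<in> sets (borel_on X)"
        using x sM xX by (auto simp: Collect_conv_if)
      then show "AE z in return (borel_on X) x. z \<in> {x}"
        by (subst AE_return[OF xs]) (simp_all add: pred_def)
      show "measure (return (borel_on X) x) {z} \<le> measure M {z}" if "z \<in> {x}" for z
        using that 2 R.prob_le_1 by (simp add: r_def)
    qed (use sM x xX in auto)
    then show ?thesis using dirac[OF xX] by simp
  next
    case 3
    define N where "N = uniform_measure M (X - {x})"
    have Xx: "X - {x} \<in> sets M" using x sets.top[of M] by (auto simp: spM)
    have mXx: "measure M (X - {x}) = 1 - r" using prob_compl[OF x] by (simp add: spM r_def)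
    have eXx: "emeasure M (X - {x}) = ennreal (1 - r)" by (simp add: emeasure_eq_measure mXx)
    have sN: "sets N = sets (borel_on X)" by (simp add: N_def sM)
    have pN: "prob_space N" unfolding N_def using 3 by (intro prob_space_uniform_measure) (auto simp: eXx)
    have AEN: "AE y in N. y \<in> F"
      unfolding N_def using AE by (intro AE_uniform_measureI[OF Xx]) auto
    have "Q N" using insert.IH[OF _ sN pN AEN] insert.prems(1) by simp
    moreover have "N \<in> Pp p X"
      using insert.hyps insert.prems(1) by (intro finite_support_in_Pp[OF p sN pN _ _ AEN]) auto
    ultimately have "Q (mixture r (return (borel_on X) x) N)"
      using dirac[OF xX] return_in_Pp[OF p xX] r01 by (intro mix) auto
    moreover have "M = mixture r (return (borel_on X) x) N"
    proof (rule measure_eqI)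
      fix B assume B: "B \<in> sets M"
      have s: "(X - {x}) \<inter> B \<in> sets M" using Xx B by auto
      have "emeasure (mixture r (return (borel_on X) x) N) B
          = ennreal r * indicator B x + ennreal (1 - r) * (emeasure M ((X - {x}) \<inter> B) / ennreal (1 - r))"
        using B sM sN Xx by (subst emeasure_mixture) (auto simp: N_def eXx)
      also have "ennreal (1 - r) * (emeasure M ((X - {x}) \<inter> B) / ennreal (1 - r)) = emeasure M ((X - {x}) \<inter> B)"
        using 3 by (simp add: emeasure_eq_measure divide_ennreal flip: ennreal_mult)
      also have "ennreal r * indicator B x = emeasure M ({x} \<inter> B)"
        by (cases "x \<in> B") (simp_all add: r_def emeasure_eq_measure)
      also have "emeasure M ({x} \<inter> B) + emeasure M ((X - {x}) \<inter> B) = emeasure M (({x} \<inter> B) \<union> ((X - {x}) \<inter> B))"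
        using x B s by (intro plus_emeasure) auto
      also have "({x} \<inter> B) \<union> ((X - {x}) \<inter> B) = B" using sets.sets_into_space[OF B] spM by auto
      finally show "emeasure M B = emeasure (mixture r (return (borel_on X) x) N) B" ..
    qed (simp add: sM)
    ultimately show ?thesis by simp
  qed
qed

lemma nonexpansive_on_return:
  fixes X :: "'a::metric_space set"
  assumes p: "1 \<le> p"
  shows "nonexpansive_on X (\<lambda>x y. ennreal (dist x y)) (Pp p X) (wasserstein_dist p X) (return (borel_on X))"
  unfolding nonexpansive_on_def
proof (intro conjI ballI funcsetI)
  fix x assume "x \<in> X"
  then show "return (borel_on X) x \<in> Pp p X" by (rule return_in_Pp[OF p])
next
  fix x y assume xy: "x \<in> X" "y \<in> X"
  have p0: "0 < p" using p by simp
  interpret prob_space "return (borel_on X) x" by (rule prob_space_return) (use xy in simp)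
  have "wasserstein_dist p X (distr (return (borel_on X) x) (borel_on X) (\<lambda>_. x)) (distr (return (borel_on X) x) (borel_on X) (\<lambda>_. y))
      \<le> lp_norm (return (borel_on X) x) p (\<lambda>_. ennreal (dist x y))"
    using xy closure_subset[of "{x, y}"]
    by (intro wasserstein_dist_le_lp_norm[OF p0 prob_space_axioms, of _ X _ "{x, y}"]) auto
  then show "wasserstein_dist p X (return (borel_on X) x) (return (borel_on X) y) \<le> ennreal (dist x y)"
    using xy p0 by (simp add: distr_const lp_norm_const)
qed

section \<open>Barycentres of arbitrary measures and the extension of nonexpansive maps\<close>

context complete_extended_metric_wasserstein_algebra
begin

lemma dist_simple_barycenter_le:
  fixes X :: "'x::metric_space set"
  assumes p: "0 < p" and f: "nonexpansive_on X (\<lambda>x y. ennreal (dist x y)) A d f"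
    and P: "prob_space P" and Y: "simple_function P Y" "\<And>w. w \<in> space P \<Longrightarrow> Y w \<in> X"
    and Z: "simple_function P Z" "\<And>w. w \<in> space P \<Longrightarrow> Z w \<in> X"
  shows "d (simple_barycenter P Y f) (simple_barycenter P Z f) \<le> lp_norm P p (\<lambda>w. ennreal (dist (Y w) (Z w)))"
proof -
  have f': "\<And>x. x \<in> X \<Longrightarrow> f x \<in> A" "\<And>x y. x \<in> X \<Longrightarrow> y \<in> X \<Longrightarrow> d (f x) (f y) \<le> ennreal (dist x y)"
    using f by (auto simp: nonexpansive_on_def)
  have "ennpowr (d (simple_barycenter P Y f) (simple_barycenter P Z f)) p \<le> (\<integral>\<^sup>+w. ennpowr (d (f (Y w)) (f (Z w))) p \<partial>P)"
    by (rule simple_barycenter_wasserstein[OF P Y(1) Z(1)]) (use Y Z f' in auto)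
  also have "\<dots> \<le> (\<integral>\<^sup>+w. ennpowr (ennreal (dist (Y w) (Z w))) p \<partial>P)"
    using p Y Z f' by (intro nn_integral_mono ennpowr_mono) auto
  also have "\<dots> = ennpowr (lp_norm P p (\<lambda>w. ennreal (dist (Y w) (Z w)))) p"
    by (simp add: ennpowr_lp_norm[OF p])
  finally show ?thesis using p by simp
qed

text \<open>The bound against all simple \<open>T\<close> at once pins down the barycentre
  independently of an approximating sequence. Later arguments can thus choose a \<open>T\<close>
  adapted to several measures at the same time.\<close>

lemma exists_barycenter:
  fixes X :: "'x::metric_space set"
  assumes p: "1 \<le> p" and f: "nonexpansive_on X (\<lambda>x y. ennreal (dist x y)) A d f" and M: "M \<in> Pp p X"
  shows "\<exists>b\<in>A. \<forall>T. simple_function (borel_on X) T \<longrightarrow> T \<in> X \<rightarrow> X \<longrightarrow>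
    d b (simple_barycenter M T f) \<le> lp_norm M p (\<lambda>x. ennreal (dist x (T x)))"
proof -
  have p0: "0 < p" using p by simp
  note MD = PpD[OF M]
  let ?c = "\<lambda>T. lp_norm M p (\<lambda>x. ennreal (dist x (T x)))"
  have simple: "simple_function M T" if "simple_function (borel_on X) T" for T :: "'x \<Rightarrow> 'x"
    by (rule iffD1[OF simple_function_cong_algebra that]) (use MD in simp_all)
  have closed: "simple_barycenter M T f \<in> A" if "simple_function (borel_on X) T" "T \<in> X \<rightarrow> X" for T
    by (rule simple_barycenter_closed[OF MD(3) simple[OF that(1)]]) (use f that MD(2) in \<open>auto simp: nonexpansive_on_def\<close>)
  have meas: "(\<lambda>x. ennreal (dist x (T x))) \<in> borel_measurable M" if "simple_function (borel_on X) T" for T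
    unfolding measurable_cong_sets[OF MD(1) refl]
    using borel_measurable_dist_simple[OF that] by measurable
  have dist: "d (simple_barycenter M S f) (simple_barycenter M T f) \<le> ?c S + ?c T"
    if S: "simple_function (borel_on X) S" "S \<in> X \<rightarrow> X" and T: "simple_function (borel_on X) T" "T \<in> X \<rightarrow> X" for S T
  proof -
    have "d (simple_barycenter M S f) (simple_barycenter M T f) \<le> lp_norm M p (\<lambda>x. ennreal (dist (S x) (T x)))"
      by (rule dist_simple_barycenter_le[OF p0 f MD(3) simple[OF S(1)] _ simple[OF T(1)]]) (use S T MD(2) in auto)
    also have "\<dots> \<le> lp_norm M p (\<lambda>x. ennreal (dist x (S x)) + ennreal (dist x (T x)))"
      by (intro lp_norm_mono p0) (simp add: dist_triangle3 ennreal_leI flip: ennreal_plus)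
    also have "\<dots> \<le> ?c S + ?c T" by (intro lp_norm_add_le p meas S T)
    finally show ?thesis .
  qed
  define r :: "nat \<Rightarrow> real" where "r n = (1 / 2) ^ n" for n
  have r: "0 < r n" for n by (simp add: r_def)
  have r_lim: "(\<lambda>n. ennreal (2 * r n)) \<longlonglongrightarrow> ennreal (2 * 0)"
    unfolding r_def by (intro tendsto_ennrealI tendsto_mult tendsto_const LIMSEQ_power_zero) auto
  have r_mono: "r m \<le> r n" if "n \<le> m" for m n
    unfolding r_def using that by (intro power_decreasing) auto
  have "\<exists>T. simple_function (borel_on X) T \<and> T \<in> X \<rightarrow> X \<and> ?c T < ennreal (r n)" for n
    using r by (intro exists_simple_approximation[OF p M]) auto
  then obtain T where T: "\<And>n. simple_function (borel_on X) (T n)" "\<And>n. T n \<in> X \<rightarrow> X" "\<And>n. ?c (T n) < ennreal (r n)"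
    by metis
  define b where "b n = simple_barycenter M (T n) f" for n
  have bA: "b n \<in> A" for n unfolding b_def by (rule closed[OF T(1,2)])
  have bT: "d (b n) (simple_barycenter M S f) \<le> ennreal (r n) + ?c S"
    if "simple_function (borel_on X) S" "S \<in> X \<rightarrow> X" for n S
    unfolding b_def using T(3)[of n] by (intro order_trans[OF dist[OF T(1,2) that]] add_right_mono) auto
  have "\<exists>l\<in>A. \<forall>e>0. \<exists>N. \<forall>n\<ge>N. d (b n) l < e"
  proof (rule Cauchy_convergent)
    show "range b \<subseteq> A" using bA by auto
    fix e :: ennreal assume "0 < e"
    then have "eventually (\<lambda>n. ennreal (2 * r n) < e) sequentially"
      using r_lim by (intro order_tendstoD(2)) auto
    then obtain N where N: "ennreal (2 * r N) < e" using eventually_happens'[OF sequentially_bot] by blast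
    have "d (b m) (b n) < e" if "N \<le> m" "N \<le> n" for m n
    proof -
      have "d (b m) (b n) \<le> ennreal (r m) + ?c (T n)"
        using bT[OF T(1,2)] by (simp add: b_def)
      also have "\<dots> \<le> ennreal (r N) + ennreal (r N)"
        using T(3)[of n] r_mono[OF that(1)] r_mono[OF that(2)] ennreal_leI[of "r n" "r N"]
        by (intro add_mono) (auto intro: ennreal_leI order_trans less_imp_le)
      also have "\<dots> = ennreal (2 * r N)" using r[of N] by (simp flip: ennreal_plus)
      finally show ?thesis using N by simp
    qed
    then show "\<exists>N. \<forall>m\<ge>N. \<forall>n\<ge>N. d (b m) (b n) < e" by blast
  qed
  then obtain l where l: "l \<in> A" "\<And>e. 0 < e \<Longrightarrow> \<exists>N. \<forall>n\<ge>N. d (b n) l < e" by blast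
  have "d l (simple_barycenter M S f) \<le> ?c S" if S: "simple_function (borel_on X) S" "S \<in> X \<rightarrow> X" for S
  proof (rule ennreal_le_epsilon)
    fix e :: real assume e: "0 < e"
    then obtain N where N: "\<And>n. N \<le> n \<Longrightarrow> d (b n) l < ennreal (e / 2)" using l(2)[of "ennreal (e / 2)"] by auto
    have "eventually (\<lambda>n. ennreal (2 * r n) < ennreal e) sequentially"
      using r_lim e by (intro order_tendstoD(2)) auto
    then have "eventually (\<lambda>n. ennreal (2 * r n) < ennreal e \<and> N \<le> n) sequentially"
      using eventually_ge_at_top[of N] by eventually_elim simp
    \<comment> \<open>The first condition gives \<open>r n \<le> e / 2\<close>, the second puts
      \<open>b n\<close> within \<open>e / 2\<close> of \<open>l\<close>.\<close>
    then obtain n where n: "ennreal (2 * r n) < ennreal e" "N \<le> n"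
      using eventually_happens'[OF sequentially_bot] by blast
    have rn: "r n \<le> e / 2" using n(1) r[of n] by (simp add: ennreal_less_iff)
    have "d l (simple_barycenter M S f) \<le> d l (b n) + d (b n) (simple_barycenter M S f)"
      by (rule triangle[OF l(1) bA closed[OF S]])
    also have "\<dots> \<le> ennreal (e / 2) + (ennreal (e / 2) + ?c S)"
      using N[OF n(2)] sym[OF l(1) bA[of n]] rn
      by (intro add_mono order_trans[OF bT[OF S]]) (auto intro: ennreal_leI add_right_mono)
    also have "\<dots> = ?c S + (ennreal (e / 2) + ennreal (e / 2))" by (simp add: ac_simps)
    also have "ennreal (e / 2) + ennreal (e / 2) = ennreal e" using e by (simp flip: ennreal_plus)
    finally show "d l (simple_barycenter M S f) \<le> ?c S + ennreal e" .
  qed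
  then show ?thesis using l(1) by blast
qed

lemma Wasserstein_extension_unique:
  fixes X :: "'x::metric_space set"
  assumes p: "1 \<le> p"
    and g: "nonexpansive_on (Pp p X) (wasserstein_dist p X) A d g" "affine_on (Pp p X) mixture cc g"
    and h: "nonexpansive_on (Pp p X) (wasserstein_dist p X) A d h" "affine_on (Pp p X) mixture cc h"
    and eq: "\<And>x. x \<in> X \<Longrightarrow> g (return (borel_on X) x) = h (return (borel_on X) x)"
    and M: "M \<in> Pp p X"
  shows "g M = h M"
proof -
  have p0: "0 < p" using p by simp
  have gA: "g M \<in> A" "h M \<in> A" if "M \<in> Pp p X" for M
    using g(1) h(1) that by (auto simp: nonexpansive_on_def)
  have "d (g M) (h M) \<le> 0"
  proof (rule ennreal_le_epsilon)
    fix e :: real assume e: "0 < e"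
    obtain T where T: "simple_function (borel_on X) T" "T \<in> X \<rightarrow> X"
      "lp_norm M p (\<lambda>x. ennreal (dist x (T x))) < ennreal (e / 2)"
      using exists_simple_approximation[OF p M, of "ennreal (e / 2)"] e by auto
    define N where "N = distr M (borel_on X) T"
    have N: "N \<in> Pp p X" "AE x in N. x \<in> T ` X"
      unfolding N_def by (rule simple_distr_in_Pp[OF p M T(1,2)])+
    have W: "wasserstein_dist p X M N \<le> ennreal (e / 2)"
      unfolding N_def using wasserstein_dist_simple_distr_le[OF p M T(1,2)] T(3) by simp
    have TX: "finite (T ` X)" "T ` X \<subseteq> X" using simple_functionD(1)[OF T(1)] T(2) by auto
    \<comment> \<open>Affinity determines both maps on finitely supported measures from their values
      on Dirac measures. Returning to \<open>M\<close> costs \<open>e / 2\<close> for each map,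
      since both are nonexpansive.\<close>
    have "g N = h N"
    proof (rule finite_support_Pp_induct[OF p, where Q="\<lambda>N. g N = h N" and F="T ` X"])
      fix r :: real and M N assume "r \<in> {0..1}" "M \<in> Pp p X" "N \<in> Pp p X" "g M = h M" "g N = h N"
      then show "g (mixture r M N) = h (mixture r M N)" using g(2) h(2) by (simp add: affine_on_def)
    qed (use eq N PpD[OF N(1)] TX in auto)
    then have "d (g M) (h M) \<le> d (g M) (g N) + d (h M) (h N)"
      using triangle[OF gA(1)[OF M] gA(1)[OF N(1)] gA(2)[OF M]] sym[OF gA(2)[OF M] gA(2)[OF N(1)]] by simp
    also have "\<dots> \<le> ennreal (e / 2) + ennreal (e / 2)"
      using g(1) h(1) M N(1) by (intro add_mono order_trans[OF _ W]) (auto simp: nonexpansive_on_def)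
    also have "\<dots> = 0 + ennreal e" using e by (simp flip: ennreal_plus)
    finally show "d (g M) (h M) \<le> 0 + ennreal e" .
  qed
  then show ?thesis using eq_0_iff[OF gA[OF M]] by simp
qed

lemma Wasserstein_extension_exists:
  fixes X :: "'x::metric_space set"
  assumes p: "1 \<le> p" and f: "nonexpansive_on X (\<lambda>x y. ennreal (dist x y)) A d f"
  shows "\<exists>g. nonexpansive_on (Pp p X) (wasserstein_dist p X) A d g \<and> affine_on (Pp p X) mixture cc g \<and>
    (\<forall>x\<in>X. g (return (borel_on X) x) = f x)"
proof -
  let ?W = "wasserstein_dist p X"
  have p0: "0 < p" using p by simp
  have fA: "f x \<in> A" if "x \<in> X" for x using f that by (auto simp: nonexpansive_on_def)
  obtain g where g: "\<And>M. M \<in> Pp p X \<Longrightarrow> g M \<in> A"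
    "\<And>M T. M \<in> Pp p X \<Longrightarrow> simple_function (borel_on X) T \<Longrightarrow> T \<in> X \<rightarrow> X \<Longrightarrow>
      d (g M) (simple_barycenter M T f) \<le> lp_norm M p (\<lambda>x. ennreal (dist x (T x)))"
    using exists_barycenter[OF p f] by metis
  have simple: "simple_function M T" if "M \<in> Pp p X" "simple_function (borel_on X) T" for M and T :: "'x \<Rightarrow> 'x"
    by (rule iffD1[OF simple_function_cong_algebra that(2)]) (use PpD[OF that(1)] in simp_all)
  have baryA: "simple_barycenter M T f \<in> A"
    if "M \<in> Pp p X" "simple_function (borel_on X) T" "T \<in> X \<rightarrow> X" for M T
    by (rule simple_barycenter_closed[OF PpD(3)[OF that(1)] simple[OF that(1,2)]])
      (use fA that PpD(2)[OF that(1)] in auto)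
  have dirac: "g (return (borel_on X) x) = f x" if x: "x \<in> X" for x
  proof -
    have P: "return (borel_on X) x \<in> Pp p X" by (rule return_in_Pp[OF p x])
    have T: "simple_function (borel_on X) (\<lambda>_. x)" "(\<lambda>_. x) \<in> X \<rightarrow> X" using x by auto
    have m: "(\<lambda>y. dist y x) \<in> borel_measurable (borel_on X)" by (rule borel_measurable_dist_simple[OF T(1)])
    have "lp_norm (return (borel_on X) x) p (\<lambda>y. ennreal (dist y x)) = 0"
      unfolding lp_norm_def using x m by (subst nn_integral_return) auto
    then have "d (g (return (borel_on X) x)) (simple_barycenter (return (borel_on X) x) (\<lambda>_. x) f) = 0"
      using g(2)[OF P T] by simp
    moreover have "simple_barycenter (return (borel_on X) x) (\<lambda>_. x) f = f x"
      using fA[OF x] by (intro simple_barycenter_const PpD(3)[OF P])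
    ultimately show ?thesis using eq_0_iff[OF g(1)[OF P] fA[OF x]] by simp
  qed
  have nonexp: "d (g M) (g N) \<le> ?W M N" if M: "M \<in> Pp p X" and N: "N \<in> Pp p X" for M N
  proof (rule ennreal_le_epsilon)
    fix e :: real assume fin: "?W M N < top" and e: "0 < e"
    \<comment> \<open>Five errors occur: replacing \<open>g M\<close> and \<open>g N\<close> by
      simple barycentres, the two simple approximations under the coupling, and the slack of the
      coupling.\<close>
    let ?e = "ennreal (e / 5)"
    have e5: "0 < ?e" using e by simp
    have "?W M N < ?W M N + ?e"
      using fin e by (intro ennreal_less_add_pos) auto
    then obtain G where G: "G \<in> couplings X M N"
      "lp_norm G p (\<lambda>z. ennreal (dist (fst z) (snd z))) < ?W M N + ?e"
      unfolding wasserstein_dist_less_iff[OF p0] by blast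
    note GD = couplingsD[OF G(1)]
    obtain S where S: "simple_function (borel_on X) S" "S \<in> X \<rightarrow> X"
      "lp_norm M p (\<lambda>x. ennreal (dist x (S x))) < ?e"
      using exists_simple_approximation[OF p M e5] by blast
    obtain T where T: "simple_function (borel_on X) T" "T \<in> X \<rightarrow> X"
      "lp_norm N p (\<lambda>x. ennreal (dist x (T x))) < ?e"
      using exists_simple_approximation[OF p N e5] by blast
    have fst_G: "fst \<in> measurable G (borel_on X)" and snd_G: "snd \<in> measurable G (borel_on X)"
      by (simp_all add: measurable_cong_sets[OF GD(1) refl])
    have SG: "simple_function G (\<lambda>z. S (fst z))" and TG: "simple_function G (\<lambda>z. T (snd z))"
      using simple_function_comp[OF fst_G S(1)] simple_function_comp[OF snd_G T(1)] by auto
    have m: "(\<lambda>x. ennreal (dist x (S x))) \<in> borel_measurable (borel_on X)"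
      "(\<lambda>x. ennreal (dist x (T x))) \<in> borel_measurable (borel_on X)"
      using borel_measurable_dist_simple[OF S(1)] borel_measurable_dist_simple[OF T(1)] by measurable
    have md: "(\<lambda>z. ennreal (dist (fst z) (snd z))) \<in> borel_measurable G"
      unfolding measurable_cong_sets[OF GD(1) refl] by measurable
    have "fst ` space G = space (borel_on X)" "snd ` space G = space (borel_on X)"
      unfolding GD(2) by auto
    \<comment> \<open>Both barycentres are moved to the space of the coupling, where the two simple
      maps can be compared pointwise.\<close>
    then have bary: "simple_barycenter M S f = simple_barycenter G (\<lambda>z. S (fst z)) f"
      "simple_barycenter N T f = simple_barycenter G (\<lambda>z. T (snd z)) f"
      using simple_barycenter_distr[OF fst_G _ S(1), of f] simple_barycenter_distr[OF snd_G _ T(1), of f] GD(4,5) by auto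
    have "d (simple_barycenter M S f) (simple_barycenter N T f) \<le> lp_norm G p (\<lambda>z. ennreal (dist (S (fst z)) (T (snd z))))"
      unfolding bary using S(2) T(2) GD(2) by (intro dist_simple_barycenter_le[OF p0 f GD(3) SG _ TG]) auto
    also have "\<dots> \<le> lp_norm G p (\<lambda>z. ennreal (dist (fst z) (S (fst z))) +
        (ennreal (dist (fst z) (snd z)) + ennreal (dist (snd z) (T (snd z)))))"
    proof (rule lp_norm_mono[OF _ p0])
      fix z
      have "dist (S (fst z)) (T (snd z)) \<le> dist (fst z) (S (fst z)) + dist (fst z) (T (snd z))"
        by (rule dist_triangle3)
      also have "dist (fst z) (T (snd z)) \<le> dist (fst z) (snd z) + dist (snd z) (T (snd z))"
        by (rule dist_triangle)
      finally show "ennreal (dist (S (fst z)) (T (snd z))) \<le> ennreal (dist (fst z) (S (fst z))) +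
          (ennreal (dist (fst z) (snd z)) + ennreal (dist (snd z) (T (snd z))))"
        by (simp add: ennreal_leI flip: ennreal_plus)
    qed
    also have "\<dots> \<le> lp_norm G p (\<lambda>z. ennreal (dist (fst z) (S (fst z)))) +
        lp_norm G p (\<lambda>z. ennreal (dist (fst z) (snd z)) + ennreal (dist (snd z) (T (snd z))))"
      using measurable_compose[OF fst_G m(1)] measurable_compose[OF snd_G m(2)] md
      by (intro lp_norm_add_le p borel_measurable_add)
    also have "\<dots> \<le> lp_norm G p (\<lambda>z. ennreal (dist (fst z) (S (fst z)))) +
        (lp_norm G p (\<lambda>z. ennreal (dist (fst z) (snd z))) + lp_norm G p (\<lambda>z. ennreal (dist (snd z) (T (snd z)))))"
      using measurable_compose[OF snd_G m(2)] md
      by (intro add_left_mono lp_norm_add_le p)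
    also have "lp_norm G p (\<lambda>z. ennreal (dist (fst z) (S (fst z)))) = lp_norm M p (\<lambda>x. ennreal (dist x (S x)))"
      using lp_norm_distr[OF fst_G m(1), of p] GD(4) by simp
    also have "lp_norm G p (\<lambda>z. ennreal (dist (snd z) (T (snd z)))) = lp_norm N p (\<lambda>x. ennreal (dist x (T x)))"
      using lp_norm_distr[OF snd_G m(2), of p] GD(5) by simp
    also have "lp_norm M p (\<lambda>x. ennreal (dist x (S x))) +
        (lp_norm G p (\<lambda>z. ennreal (dist (fst z) (snd z))) + lp_norm N p (\<lambda>x. ennreal (dist x (T x))))
      \<le> ?e + ((?W M N + ?e) + ?e)"
      using S(3) T(3) G(2) by (intro add_mono) auto
    finally have mid: "d (simple_barycenter M S f) (simple_barycenter N T f)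
      \<le> ?e + ((?W M N + ?e) + ?e)" .
    have MS: "d (g M) (simple_barycenter M S f) \<le> ?e"
      using g(2)[OF M S(1,2)] S(3) by simp
    have NT: "d (simple_barycenter N T f) (g N) \<le> ?e"
      using g(2)[OF N T(1,2)] T(3) sym[OF g(1)[OF N] baryA[OF N T(1,2)]] by simp
    have "d (g M) (g N) \<le> d (g M) (simple_barycenter M S f) + d (simple_barycenter M S f) (g N)"
      by (rule triangle[OF g(1)[OF M] baryA[OF M S(1,2)] g(1)[OF N]])
    also have "\<dots> \<le> d (g M) (simple_barycenter M S f) +
        (d (simple_barycenter M S f) (simple_barycenter N T f) + d (simple_barycenter N T f) (g N))"
      by (intro add_left_mono triangle[OF baryA[OF M S(1,2)] baryA[OF N T(1,2)] g(1)[OF N]])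
    also have "\<dots> \<le> ?e +
        ((?e + ((?W M N + ?e) + ?e)) + ?e)"
      by (intro add_mono MS NT mid)
    also have "\<dots> = ?W M N +
        (?e + (?e + (?e + (?e + ?e))))"
      by (simp add: ac_simps)
    also have "?e + (?e + (?e + (?e + ?e))) = ennreal e"
      using e by (simp flip: ennreal_plus)
    finally show "d (g M) (g N) \<le> ?W M N + ennreal e" .
  qed
  have affine: "g (mixture r M N) = cc r (g M) (g N)"
    if r: "r \<in> {0..1}" and M: "M \<in> Pp p X" and N: "N \<in> Pp p X" for r M N
  proof -
    note MD = PpD[OF M] and ND = PpD[OF N]
    have sets: "sets N = sets M" using MD ND by simp
    have gA: "g M \<in> A" "g N \<in> A" using g(1) M N by auto
    \<comment> \<open>At the endpoints one component has weight zero, and approximating the mixture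
      gives no control over it; there the claim is \<open>one\<close>, combined with
      \<open>skew_comm\<close> for \<open>r = 0\<close>.\<close>
    consider "r = 0" | "r = 1" | "0 < r" "r < 1" using r by fastforce
    then show ?thesis
    proof cases
      case 1
      then have "cc r (g M) (g N) = cc 1 (g N) (g M)" using skew_comm[of 0, OF _ gA] by simp
      then show ?thesis using 1 one[OF gA(2,1)] mixture_0[OF sets] by simp
    next
      case 2
      then show ?thesis using one[OF gA] mixture_1[OF sets] by simp
    next
      case 3
      let ?L = "mixture r M N"
      have L: "?L \<in> Pp p X" by (rule mixture_in_Pp[OF p r M N])
      have cA: "cc r (g M) (g N) \<in> A" by (rule closed[OF r gA])
      have "d (g ?L) (cc r (g M) (g N)) \<le> 0"
      proof (rule ennreal_le_epsilon)
        fix e :: real assume e: "0 < e"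
        \<comment> \<open>Both weights are at least \<open>m\<close>. Hence an error \<delta> for
          the mixture, with \<delta>^p equal to \<open>m\<close> times the p-th power of
          \<open>e / 2\<close>, forces an error of at most \<open>e / 2\<close> for \<open>M\<close>
          and for \<open>N\<close> under the same \<open>T\<close>.\<close>
        define m where "m = min r (1 - r)"
        have m: "0 < m" "m \<le> r" "m \<le> 1 - r" "m \<le> 1" using 3 by (auto simp: m_def)
        define \<delta> where "\<delta> = e / 2 * m powr (1 / p)"
        have "\<delta> powr p = (e / 2) powr p * (m powr (1 / p)) powr p"
          unfolding \<delta>_def by (rule powr_mult)
        also have "(m powr (1 / p)) powr p = m" using m p0 by (simp add: powr_powr)
        finally have \<delta>: "0 < \<delta>" "ennpowr (ennreal \<delta>) p = ennreal m * ennpowr (ennreal (e / 2)) p"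
          using e m by (simp_all add: \<delta>_def mult.commute flip: ennreal_mult)
        have "m powr (1 / p) \<le> 1" using m p0 powr_mono2[of "1 / p" m 1] by simp
        then have \<delta>e: "\<delta> \<le> e / 2" using e by (simp add: \<delta>_def mult_left_le)
        obtain T where T: "simple_function (borel_on X) T" "T \<in> X \<rightarrow> X"
          "lp_norm ?L p (\<lambda>x. ennreal (dist x (T x))) < ennreal \<delta>"
          using exists_simple_approximation[OF p L, of "ennreal \<delta>"] \<delta>(1) by auto
        let ?h = "\<lambda>x. ennreal (dist x (T x))"
        have meas: "?h \<in> borel_measurable M"
          unfolding measurable_cong_sets[OF MD(1) refl] using borel_measurable_dist_simple[OF T(1)] by measurable
        have "ennreal r * ennpowr (lp_norm M p ?h) p + ennreal (1 - r) * ennpowr (lp_norm N p ?h) p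
            = ennpowr (lp_norm ?L p ?h) p"
          by (rule lp_norm_mixture[OF p0 sets meas, symmetric])
        also have "\<dots> \<le> ennreal m * ennpowr (ennreal (e / 2)) p"
          unfolding \<delta>(2)[symmetric] using T(3) p0 by (intro ennpowr_mono) auto
        finally have sum: "ennreal r * ennpowr (lp_norm M p ?h) p + ennreal (1 - r) * ennpowr (lp_norm N p ?h) p
            \<le> ennreal m * ennpowr (ennreal (e / 2)) p" .
        have small: "lp_norm K p ?h \<le> ennreal (e / 2)"
          if "ennreal s * ennpowr (lp_norm K p ?h) p \<le> ennreal m * ennpowr (ennreal (e / 2)) p" "m \<le> s" for s K
        proof -
          have "ennreal m * ennpowr (lp_norm K p ?h) p \<le> ennreal s * ennpowr (lp_norm K p ?h) p"
            using that(2) by (intro mult_right_mono ennreal_leI) auto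
          also note that(1)
          finally have "ennpowr (lp_norm K p ?h) p \<le> ennpowr (ennreal (e / 2)) p"
            using m(1) by (subst (asm) ennreal_mult_le_mult_iff) auto
          then show ?thesis using p0 by simp
        qed
        have normM: "lp_norm M p ?h \<le> ennreal (e / 2)"
          by (rule small[OF order_trans[OF _ sum] m(2)]) simp
        have normN: "lp_norm N p ?h \<le> ennreal (e / 2)"
          by (rule small[OF order_trans[OF _ sum] m(3)]) simp
        let ?bM = "simple_barycenter M T f" and ?bN = "simple_barycenter N T f"
        have bA: "?bM \<in> A" "?bN \<in> A" using baryA[OF M T(1,2)] baryA[OF N T(1,2)] .
        have bL: "simple_barycenter ?L T f = cc r ?bM ?bN"
          using fA T(2) MD(2)
          by (intro simple_barycenter_mixture[OF 3 sets MD(3) ND(3) simple[OF M T(1)]]) auto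
        have 1: "d (g ?L) (cc r ?bM ?bN) \<le> ennreal (e / 2)"
          by (rule order_trans[OF g(2)[OF L T(1,2), unfolded bL]
            order_trans[OF less_imp_le[OF T(3)] ennreal_leI[OF \<delta>e]]])
        have "d (cc r ?bM ?bN) (cc r (g M) (g N)) \<le> max (d ?bM (g M)) (d ?bN (g N))"
          by (rule nonexpansive[OF r bA(1) gA(1) bA(2) gA(2)])
        also have "\<dots> \<le> ennreal (e / 2)"
          using order_trans[OF g(2)[OF M T(1,2)] normM] order_trans[OF g(2)[OF N T(1,2)] normN]
            sym[OF gA(1) bA(1)] sym[OF gA(2) bA(2)] by simp
        finally have 2: "d (cc r ?bM ?bN) (cc r (g M) (g N)) \<le> ennreal (e / 2)" .
        have "d (g ?L) (cc r (g M) (g N)) \<le> d (g ?L) (cc r ?bM ?bN) + d (cc r ?bM ?bN) (cc r (g M) (g N))"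
          by (rule triangle[OF g(1)[OF L] closed[OF r bA] cA])
        also have "\<dots> \<le> ennreal (e / 2) + ennreal (e / 2)" by (rule add_mono[OF 1 2])
        also have "\<dots> = 0 + ennreal e" using e by (simp flip: ennreal_plus)
        finally show "d (g ?L) (cc r (g M) (g N)) \<le> 0 + ennreal e" .
      qed
      then show ?thesis using eq_0_iff[OF g(1)[OF L] cA] by simp
    qed
  qed
  show ?thesis
    using g(1) nonexp affine dirac
    by (intro exI[of _ g]) (auto simp: nonexpansive_on_def affine_on_def)
qed

end

theorem theorem3p8:
  fixes X :: "'a::metric_space set" and p :: real
  assumes "complete X" and "p \<ge> 1"
  shows "complete_extended_metric_wasserstein_algebra p (Pp p X) (wasserstein_dist p X) mixture \<and>
    nonexpansive_on X (\<lambda>x y. ennreal (dist x y)) (Pp p X) (wasserstein_dist p X)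
      (return (borel_on X)) \<and>
    (\<forall>(B :: 'b set) d cc f.
      complete_extended_metric_wasserstein_algebra p B d cc \<longrightarrow>
      nonexpansive_on X (\<lambda>x y. ennreal (dist x y)) B d f \<longrightarrow>
      (\<exists>!g. g \<in> Pp p X \<rightarrow>\<^sub>E B \<and>
        nonexpansive_on (Pp p X) (wasserstein_dist p X) B d g \<and>
        affine_on (Pp p X) mixture cc g \<and>
        (\<forall>x\<in>X. g (return (borel_on X) x) = f x)))"
proof (intro conjI allI impI)
  show "complete_extended_metric_wasserstein_algebra p (Pp p X) (wasserstein_dist p X) mixture"
    using extended_metric_wasserstein_algebra_Pp[OF assms(2)] complete_extended_metric_space_Pp[OF assms]
    by (simp add: complete_extended_metric_wasserstein_algebra_def)
  show "nonexpansive_on X (\<lambda>x y. ennreal (dist x y)) (Pp p X) (wasserstein_dist p X) (return (borel_on X))"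
    by (rule nonexpansive_on_return[OF assms(2)])
next
  fix B :: "'b set" and d cc f
  assume B: "complete_extended_metric_wasserstein_algebra p B d cc"
    and f: "nonexpansive_on X (\<lambda>x y. ennreal (dist x y)) B d f"
  interpret B: complete_extended_metric_wasserstein_algebra p B d cc by fact
  obtain g where g: "nonexpansive_on (Pp p X) (wasserstein_dist p X) B d g" "affine_on (Pp p X) mixture cc g"
      "\<forall>x\<in>X. g (return (borel_on X) x) = f x"
    using B.Wasserstein_extension_exists[OF assms(2) f] by blast
  \<comment> \<open>Making the map \<open>undefined\<close> outside \<open>Pp p X\<close> puts it
    into \<open>Pp p X \<rightarrow>\<^sub>E B\<close>, so that agreement on \<open>Pp p X\<close>
    becomes equality of functions.\<close>
  let ?g = "restrict g (Pp p X)"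
  show "\<exists>!g. g \<in> Pp p X \<rightarrow>\<^sub>E B \<and> nonexpansive_on (Pp p X) (wasserstein_dist p X) B d g \<and>
      affine_on (Pp p X) mixture cc g \<and> (\<forall>x\<in>X. g (return (borel_on X) x) = f x)"
  proof (rule ex1I[of _ ?g])
    have gB: "g \<in> Pp p X \<rightarrow> B" using g(1) by (simp add: nonexpansive_on_def)
    then have "?g \<in> Pp p X \<rightarrow>\<^sub>E B" by auto
    moreover have "nonexpansive_on (Pp p X) (wasserstein_dist p X) B d ?g"
      using g(1) gB by (simp add: nonexpansive_on_def Pi_iff)
    moreover have "affine_on (Pp p X) mixture cc ?g"
      unfolding affine_on_def
    proof (intro ballI)
      fix r :: real and M N assume r: "r \<in> {0..1}" and MN: "M \<in> Pp p X" "N \<in> Pp p X"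
      then show "?g (mixture r M N) = cc r (?g M) (?g N)"
        using g(2)[unfolded affine_on_def, rule_format, OF r MN] mixture_in_Pp[OF assms(2) r MN] by simp
    qed
    moreover have "\<forall>x\<in>X. ?g (return (borel_on X) x) = f x"
    proof
      fix x assume x: "x \<in> X"
      then show "?g (return (borel_on X) x) = f x"
        using g(3)[rule_format, OF x] return_in_Pp[OF assms(2) x] by simp
    qed
    ultimately show "?g \<in> Pp p X \<rightarrow>\<^sub>E B \<and> nonexpansive_on (Pp p X) (wasserstein_dist p X) B d ?g \<and>
        affine_on (Pp p X) mixture cc ?g \<and> (\<forall>x\<in>X. ?g (return (borel_on X) x) = f x)" by blast
    fix h assume h: "h \<in> Pp p X \<rightarrow>\<^sub>E B \<and> nonexpansive_on (Pp p X) (wasserstein_dist p X) B d h \<and>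
        affine_on (Pp p X) mixture cc h \<and> (\<forall>x\<in>X. h (return (borel_on X) x) = f x)"
    have eq: "h M = g M" if "M \<in> Pp p X" for M
      by (rule B.Wasserstein_extension_unique[OF assms(2) _ _ g(1,2) _ that]) (use h g(3) in simp_all)
    show "h = ?g"
    proof
      fix M
      show "h M = ?g M"
        using eq[of M] PiE_arb[OF conjunct1[OF h], of M] by (cases "M \<in> Pp p X") simp_all
    qed
  qed
qed

end
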